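(* Let $B=\langle x,y\rangle\le F$, where $x=x_0x_1x_2^{-1}x_0^{-1}$ and $y=x_0x_1^{-2}$, and let $\psi:\mathcal C_2\to\mathcal C_2$ be the order-preserving homeomorphism represented by the binary transducer $T^\psi$ given in the context. For the interval homeomorphism induced by $\psi$ (also denoted $\psi$), one has $$B=F\cap F^\psi$$ inside $\operatorname{Homeo}_+(0,1)$. In particular, the Brin--Navas group (of which $B$ is a copy) is the intersection of two copies of Thompson's group $F$.
   Context: $\mathcal C_2=\{0,1\}^{\mathbb N}$ with the lexicographic order; $\rho_2:\mathcal C_2\to[0,1]$, $\rho_2(\omega)=\sum_j\omega_j2^{-j}$. An order-preserving homeomorphism of $\mathcal C_2$ descends via $\rho_2$ to an increasing homeomorphism of $[0,1]$. Thompson's group $F=F_2$ is the group of increasing piecewise-linear homeomorphisms of $[0,1]$ with finitely many breakpoints, all dyadic, and slopes integer powers of $2$; equivalently it acts on $\mathcal C_2$ by order-preserving finite prefix replacements. Products are composed left to right: $(fg)(t)=g(f(t))$. The generators act on $\mathcal C_2$ by $x_0$: $00\eta\mapsto0\eta$, $01\eta\mapsto10\eta$, $1\eta\mapsto11\eta$; $x_1$: $0\eta\mapsto0\eta$, $100\eta\mapsto10\eta$, $101\eta\mapsto110\eta$, $11\eta\mapsto111\eta$; and $x_2=x_0^{-1}x_1x_0$. $F^\psi=\psi^{-1}F\psi$ (left-to-right), i.e. $\{t\mapsto\psi(f(\psi^{-1}(t))):f\in F\}$. The transducer $T^\psi$ has states $\rho,\ell,r,a,b,c,d$ and initial state $\rho$;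 "$s$: $0\mid w\to s'$, $1\mid w'\to s''$" means that in state $s$, on input $0$ it outputs $w$ and moves to $s'$, and on input $1$ it outputs $w'$ and moves to $s''$ ($\varepsilon$ is the empty word): $\rho$: $0\mid0\to\ell$, $1\mid1\to r$; $\ell$: $0\mid0\to\ell$, $1\mid1\to a$; $r$: $0\mid0\to b$, $1\mid1\to r$; $a$: $0\mid0\to a$, $1\mid1\to c$; $b$: $0\mid0\to c$, $1\mid1\to b$; $c$: $0\mid00\to a$, $1\mid\varepsilon\to d$; $d$: $0\mid01\to c$, $1\mid1\to b$. $\psi(\omega)$ is the infinite concatenation of the outputs on input $\omega$ from the initial state. The Brin--Navas group is the elementary amenable group (of elementary class $\omega+2$) introduced by Brin and by Navas; $B$ is its concrete copy inside $F$. *)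

theory Defs
  imports
    "HOL-Analysis.Analysis"
    "HOL-Library.Fun_Lexorder"
    "HOL-Algebra.Generated_Groups"
begin

section \<open>The Cantor set and maps induced on the unit interval\<close>

text \<open>The digit of index \<open>j \<ge> 1\<close> of the mathematical notation is \<open>\<omega> (j - 1)\<close> here. The library
  topology on functions is the product topology (with \<open>bool\<close> discrete), and \<^const>\<open>less_fun\<close> is
  the strict lexicographic order.\<close>

type_synonym cantor = "nat \<Rightarrow> bool"

abbreviation d0 :: bool where "d0 \<equiv> False"
abbreviation d1 :: bool where "d1 \<equiv> True"

definition rho2 :: "cantor \<Rightarrow> real" where
  "rho2 \<omega> = (\<Sum>j. of_bool (\<omega> j) / 2 ^ Suc j)"

definition order_homeo :: "(cantor \<Rightarrow> cantor) \<Rightarrow> bool" where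
  "order_homeo \<phi> \<longleftrightarrow>
     (\<exists>\<phi>'. homeomorphism UNIV UNIV \<phi> \<phi>') \<and>
     (\<forall>\<omega> \<eta>. less_fun \<omega> \<eta> \<longrightarrow> less_fun (\<phi> \<omega>) (\<phi> \<eta>))"

text \<open>The interval map \<open>h\<close> with \<open>h (rho2 \<omega>) = rho2 (\<phi> \<omega>)\<close>, continued by the identity outside \<open>[0,1]\<close>.
  It is well defined whenever \<open>\<phi>\<close> is an order-preserving homeomorphism, since the two-point fibres
  of \<^const>\<open>rho2\<close> are the pairs of adjacent elements of the lexicographic order.\<close>

definition induced :: "(cantor \<Rightarrow> cantor) \<Rightarrow> real \<Rightarrow> real" where
  "induced \<phi> t =
     (if t \<in> {0..1} then THE s. \<exists>\<omega>. rho2 \<omega> = t \<and> s = rho2 (\<phi> \<omega>) else t)"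

definition cat :: "bool list \<Rightarrow> cantor \<Rightarrow> cantor" where
  "cat w \<eta> = (\<lambda>n. if n < length w then w ! n else \<eta> (n - length w))"

text \<open>A table entry \<open>(u, v)\<close> stands for the rule \<open>u\<eta> \<mapsto> v\<eta>\<close>. The prefixes \<open>u\<close> of a table are meant
  to partition the Cantor set.\<close>

definition prefix_replacement :: "(bool list \<times> bool list) list \<Rightarrow> cantor \<Rightarrow> cantor" where
  "prefix_replacement tab \<omega> =
     (THE \<omega>'. \<exists>(u, v) \<in> set tab. \<exists>\<eta>. \<omega> = cat u \<eta> \<and> \<omega>' = cat v \<eta>)"


section \<open>The ambient group and Thompson's group \<open>F\<close>\<close>

text \<open>An increasing homeomorphism of \<open>(0,1)\<close> extends uniquely to one of \<open>[0,1]\<close>; it is represented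
  by its extension to \<open>\<real>\<close> that is the identity outside \<open>[0,1]\<close>. Products are composed from left
  to right.\<close>

definition Homeo :: "(real \<Rightarrow> real) monoid" where
  "Homeo =
     \<lparr>carrier = {f. (\<exists>g. homeomorphism {0..1} {0..1} f g) \<and> strict_mono_on {0..1} f \<and>
                    (\<forall>t. t \<notin> {0..1} \<longrightarrow> f t = t)},
      mult = (\<lambda>f g. g \<circ> f),
      one = id\<rparr>"

definition dyadic :: "real set" where
  "dyadic = {t. \<exists>(m::int) (n::nat). t = of_int m / 2 ^ n}"

definition Thompson_F :: "(real \<Rightarrow> real) set" where
  "Thompson_F =
     {f \<in> carrier Homeo. \<exists>S. finite S \<and> S \<subseteq> dyadic \<and>
        (\<forall>p q. 0 \<le> p \<and> p < q \<and> q \<le> 1 \<and> {p<..<q} \<inter> S = {} \<longrightarrow>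
           (\<exists>(k::int) c. \<forall>t\<in>{p..q}. f t = 2 powi k * t + c))}"

text \<open>\<open>F\<^sup>\<psi> = \<psi>\<inverse> F \<psi>\<close>, that is, all \<open>t \<mapsto> \<psi> (f (\<psi>\<inverse> t))\<close>.\<close>

definition conj_F :: "(real \<Rightarrow> real) \<Rightarrow> (real \<Rightarrow> real) set" where
  "conj_F \<psi> = {inv\<^bsub>Homeo\<^esub> \<psi> \<otimes>\<^bsub>Homeo\<^esub> f \<otimes>\<^bsub>Homeo\<^esub> \<psi> | f. f \<in> Thompson_F}"

definition x0 :: "real \<Rightarrow> real" where
  "x0 = induced (prefix_replacement
     [([d0, d0], [d0]), ([d0, d1], [d1, d0]), ([d1], [d1, d1])])"

definition x1 :: "real \<Rightarrow> real" where
  "x1 = induced (prefix_replacement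
     [([d0], [d0]), ([d1, d0, d0], [d1, d0]), ([d1, d0, d1], [d1, d1, d0]),
      ([d1, d1], [d1, d1, d1])])"

definition x2 :: "real \<Rightarrow> real" where
  "x2 = inv\<^bsub>Homeo\<^esub> x0 \<otimes>\<^bsub>Homeo\<^esub> x1 \<otimes>\<^bsub>Homeo\<^esub> x0"

definition B :: "(real \<Rightarrow> real) set" where
  "B = generate Homeo
     {x0 \<otimes>\<^bsub>Homeo\<^esub> x1 \<otimes>\<^bsub>Homeo\<^esub> inv\<^bsub>Homeo\<^esub> x2 \<otimes>\<^bsub>Homeo\<^esub> inv\<^bsub>Homeo\<^esub> x0,
      x0 \<otimes>\<^bsub>Homeo\<^esub> x1 [^]\<^bsub>Homeo\<^esub> (-2::int)}"


section \<open>The transducer\<close>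

datatype state = Rho | L | R | StA | StB | StC | StD

fun transition :: "state \<Rightarrow> bool \<Rightarrow> bool list \<times> state" where
  "transition Rho i = (if i then ([d1], R) else ([d0], L))"
| "transition L i = (if i then ([d1], StA) else ([d0], L))"
| "transition R i = (if i then ([d1], R) else ([d0], StB))"
| "transition StA i = (if i then ([d1], StC) else ([d0], StA))"
| "transition StB i = (if i then ([d1], StB) else ([d0], StC))"
| "transition StC i = (if i then ([], StD) else ([d0, d0], StA))"
| "transition StD i = (if i then ([d1], StB) else ([d0, d1], StC))"

fun emitted :: "state \<Rightarrow> bool list \<Rightarrow> bool list" where
  "emitted s [] = []"
| "emitted s (i # w) = (case transition s i of (v, s') \<Rightarrow> v @ emitted s' w)"

text \<open>The outputs on the finite prefixes of \<open>\<omega>\<close> form a chain of prefixes of the infinite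
  concatenation, so its \<open>n\<close>-th letter can be read off from any prefix whose output is long enough.\<close>

definition psi_cantor :: "cantor \<Rightarrow> cantor" where
  "psi_cantor \<omega> n =
     (let out = (\<lambda>k. emitted Rho (map \<omega> [0..<k]))
      in out (LEAST k. n < length (out k)) ! n)"

definition psi :: "real \<Rightarrow> real" where
  "psi = induced psi_cantor"


section \<open>The abstract Brin--Navas group\<close>

text \<open>The letter \<open>(g, True)\<close> stands for the generator \<open>g\<close> and \<open>(g, False)\<close> for its formal inverse.\<close>

type_synonym 'g word = "('g \<times> bool) list"

definition word_inv :: "'g word \<Rightarrow> 'g word" where
  "word_inv w = rev (map (\<lambda>(g, e). (g, \<not> e)) w)"

definition word_pow :: "'g word \<Rightarrow> int \<Rightarrow> 'g word" where
  "word_pow w k =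
     (if k \<ge> 0 then concat (replicate (nat k) w)
      else concat (replicate (nat (- k)) (word_inv w)))"

definition word_conj :: "'g word \<Rightarrow> 'g word \<Rightarrow> 'g word" where
  "word_conj u w = word_inv w @ u @ w"

definition word_comm :: "'g word \<Rightarrow> 'g word \<Rightarrow> 'g word" where
  "word_comm u w = word_inv u @ word_inv w @ u @ w"

inductive insertion :: "'g word set \<Rightarrow> 'g word \<Rightarrow> 'g word \<Rightarrow> bool" for Rel where
  cancel: "insertion Rel (p @ q) (p @ [(g, e), (g, \<not> e)] @ q)"
| relator: "r \<in> Rel \<Longrightarrow> insertion Rel (p @ q) (p @ r @ q)"

definition word_eq :: "'g word set \<Rightarrow> ('g word \<times> 'g word) set" where
  "word_eq Rel = {(u, w). equivclp (insertion Rel) u w}"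

definition presented_group :: "'g word set \<Rightarrow> 'g word set monoid" where
  "presented_group Rel =
     \<lparr>carrier = UNIV // word_eq Rel,
      mult = (\<lambda>X Y. \<Union>u\<in>X. \<Union>w\<in>Y. word_eq Rel `` {u @ w}),
      one = word_eq Rel `` {[]}\<rparr>"

text \<open>With \<open>g\<^sub>i = s\<^bsup>-i\<^esup> g s\<^bsup>i\<^esup>\<close>, the relators say that for every \<open>m\<close> the subgroup generated by the
  \<open>g\<^sub>i\<close> with \<open>i > m\<close> commutes with its conjugates by the nontrivial powers of \<open>g\<^sub>m\<close>. Hence
  \<open>\<langle>g\<^sub>i | i \<ge> m\<rangle>\<close> is the restricted wreath product of \<open>\<langle>g\<^sub>i | i > m\<rangle>\<close> by the infinite cyclic group
  \<open>\<langle>g\<^sub>m\<rangle>\<close>, and the whole group is the bi-infinite iterated wreath product of copies of \<open>\<int>\<close> extended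
  by the shift \<open>s\<close>. This is the elementary amenable group of Brin and Navas.\<close>

datatype bn_gen = Shift | Base

definition bn_base :: "int \<Rightarrow> bn_gen word" where
  "bn_base i = word_conj [(Base, True)] (word_pow [(Shift, True)] i)"

definition Brin_Navas :: "bn_gen word set monoid" where
  "Brin_Navas = presented_group
     {word_comm (word_conj (bn_base i) (word_pow (bn_base m) k)) (bn_base j) | i j m k.
        m < i \<and> m < j \<and> k \<noteq> 0}"

end

theory Submission
  imports Defs
begin

text \<open>
  The proof attaches a height to every dyadic point of \<open>(0,1)\<close>. The states of the transducer colour the
  standard dyadic intervals on the image side by types with the subdivision rules \<open>\<rho> \<rightarrow> \<ell> r\<close>,
  \<open>\<ell> \<rightarrow> \<ell> a\<close>, \<open>r \<rightarrow> b r\<close>, \<open>a \<rightarrow> a c\<close>, \<open>b \<rightarrow> c b\<close>, \<open>c \<rightarrow> a b\<close>. Counting \<open>a\<close> as \<open>+1\<close>, \<open>b\<close>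
  as \<open>-1\<close> and \<open>c\<close> as \<open>0\<close> is compatible with these rules and defines height differences.

  The maps computed by different states are different. Hence, if \<open>g\<close> and \<open>\<psi>\<inverse> g \<psi>\<close> are both finite prefix
  replacements, then \<open>g\<close> preserves the types of all small intervals, so it changes all heights by one
  constant; \<open>y\<close> raises heights by \<open>1\<close> and \<open>x\<close> preserves them. Conversely, let \<open>g \<in> F\<close> change all heights
  by a constant. After multiplication by a power of \<open>y\<close> it preserves heights, which makes it the identity near \<open>0\<close>
  and \<open>1\<close>, and after conjugation by a power of \<open>y\<close> it is supported in \<open>[1/4, 3/4]\<close>. The points of
  height \<open>0\<close> in this interval form one orbit of \<open>x\<close>, so after multiplication by a power of \<open>x\<close> the map fixes
  them all and is a finite product of maps supported between two neighbours. A map of the form \<open>y x\<^sup>j\<close>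
  conjugates each factor back to \<open>[1/4, 3/4]\<close>, with breakpoints of smaller height.

  For the presentation, the conjugates \<open>g\<^sub>i\<close> of \<open>x\<close> by \<open>y\<^sup>i\<close> have nested supports, and the support of
  \<open>g\<^bsub>m+1\<^esub>\<close> is a fundamental domain of \<open>g\<^sub>m\<close>; so a trivial product of conjugates by
  different powers of \<open>g\<^sub>m\<close> is trivial factor by factor.
\<close>

section \<open>The Cantor set\<close>


text \<open>The obstacle in showing that the intersection shifts heights is that \<open>psi\<close>
  does not carry every standard interval to a standard interval: state \<open>StC\<close> cuts its
  image at 1/4 instead of 1/2, and the image of state \<open>StD\<close> is only [1/4, 1]. Types are
  therefore defined on the image side by halving rules of their own, and the halves that
  \<open>psi\<close> misses are recovered from their children. On a small cylinder the relation
  between \<open>f\<close>, \<open>g\<close> and \<open>psi\<close> equates two maps computed by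
  states, up to prefixes; \<open>StD\<close> is ruled out there because 3/4 is not a power of 2. The
  induction that puts height preserving maps into \<open>B\<close> runs over the greatest height of
  a breakpoint. It ends because dyadic points inside (1/4, 3/4) have height at least 0, so that a
  map with breakpoints of negative height only is affine there. The power of \<open>x\<close> to
  divide by is read off from the slope at 1/4; order then forces all chain points to be fixed. For
  the presentation, a word is rewritten with all shifts in front. The height shift of its value
  gives the exponent of the shift, and the displacement of a chain point gives the exponent of each
  \<open>bn_base m\<close>.\<close>

lemma cat_Nil [simp]: "cat [] \<eta> = \<eta>"
  by (simp add: cat_def)

lemma cat_append: "cat (u @ v) \<eta> = cat u (cat v \<eta>)"
proof
  fix n
  show "cat (u @ v) \<eta> n = cat u (cat v \<eta>) n"
    by (cases "n < length u") (auto simp: cat_def nth_append intro!: arg_cong[where f=\<eta>])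
qed

lemma cat_Cons: "cat (i # u) \<eta> = cat [i] (cat u \<eta>)"
  using cat_append[of "[i]" u] by simp

lemma cat_single_nth: "cat [i] \<eta> n = (case n of 0 \<Rightarrow> i | Suc m \<Rightarrow> \<eta> m)"
  by (auto simp: cat_def split: nat.split)

lemma cat_single_Suc [simp]: "cat [i] \<eta> (Suc n) = \<eta> n" "cat [i] \<eta> 0 = i"
  by (auto simp: cat_single_nth)

lemma cat_map_upt: "cat (map \<omega> [0..<n]) (\<lambda>k. \<omega> (n + k)) = \<omega>"
  by (auto simp: cat_def fun_eq_iff)

lemma cantor_cases: obtains i \<eta> where "\<omega> = cat [i] \<eta>"
proof
  show "\<omega> = cat [\<omega> 0] (\<lambda>n. \<omega> (Suc n))"
    by (auto simp: cat_single_nth fun_eq_iff split: nat.split)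
qed

lemma map_cat_single: "map (cat [i] \<eta>) [0..<Suc k] = i # map \<eta> [0..<k]"
  by (simp add: map_upt_Suc del: upt_Suc)

section \<open>Binary expansions of points of the interval\<close>

definition const_seq :: "bool \<Rightarrow> cantor" where
  "const_seq b = (\<lambda>_. b)"

lemma cat_const_seq [simp]: "cat [b] (const_seq b) = const_seq b"
  by (auto simp: const_seq_def cat_single_nth fun_eq_iff split: nat.split)

lemma half_powers_summable: "summable (\<lambda>j. 1 / 2 ^ Suc j :: real)"
  using sums_summable[OF power_half_series] by (simp add: power_divide)

lemma rho2_summable: "summable (\<lambda>j. of_bool (\<omega> j) / 2 ^ Suc j :: real)"
  by (rule summable_comparison_test'[where N=0, OF half_powers_summable]) auto

lemma rho2_cat1: "rho2 (cat [i] \<eta>) = (of_bool i + rho2 \<eta>) / 2"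
proof -
  have "rho2 (cat [i] \<eta>) = (\<Sum>j. of_bool (\<eta> j) / 2 ^ Suc (Suc j)) + of_bool i / 2"
    unfolding rho2_def using suminf_split_head[OF rho2_summable[of "cat [i] \<eta>"]] by simp
  also have "(\<Sum>j. of_bool (\<eta> j) / 2 ^ Suc (Suc j)) = (\<Sum>j. (of_bool (\<eta> j) / 2 ^ Suc j) / 2 :: real)"
    by (simp add: mult.commute)
  also have "\<dots> = rho2 \<eta> / 2"
    unfolding rho2_def by (rule suminf_divide[OF rho2_summable])
  finally show ?thesis by (simp add: field_simps)
qed

lemma rho2_bounds: "0 \<le> rho2 \<omega>" "rho2 \<omega> \<le> 1"
proof -
  show "0 \<le> rho2 \<omega>"
    unfolding rho2_def by (rule suminf_nonneg[OF rho2_summable]) auto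
  have "rho2 \<omega> \<le> (\<Sum>j. 1 / 2 ^ Suc j)"
    unfolding rho2_def by (rule suminf_le[OF _ rho2_summable half_powers_summable]) auto
  then show "rho2 \<omega> \<le> 1"
    using power_half_series by (simp add: sums_iff power_divide)
qed

text \<open>The left end of the standard dyadic interval formed by the sequences with this prefix;
  the length of the interval is \<open>1 / 2 ^ length u\<close>.\<close>

fun val :: "bool list \<Rightarrow> real" where
  "val [] = 0"
| "val (i # w) = (of_bool i + val w) / 2"

lemma rho2_cat: "rho2 (cat u \<eta>) = val u + rho2 \<eta> / 2 ^ length u"
proof (induction u)
  case (Cons i u)
  then show ?case by (simp add: cat_Cons[of i u] rho2_cat1 field_simps)
qed simp

lemma val_append: "val (u @ v) = val u + val v / 2 ^ length u"
  by (induction u) (auto simp: field_simps)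

lemma rho2_const [simp]: "rho2 (const_seq d0) = 0" "rho2 (const_seq d1) = 1"
  using rho2_cat1[of d0 "const_seq d0"] rho2_cat1[of d1 "const_seq d1"] by auto

lemma rho2_eq_of_bool: assumes "rho2 \<omega> = of_bool b" shows "\<omega> = const_seq b"
proof
  fix n
  have "\<omega> n = b" using assms
  proof (induction n arbitrary: \<omega>)
    case 0
    obtain i \<eta> where \<omega>: "\<omega> = cat [i] \<eta>" by (rule cantor_cases)
    then show ?case using 0 rho2_bounds[of \<eta>] by (cases i; cases b) (auto simp: rho2_cat1)
  next
    case (Suc n)
    obtain i \<eta> where \<omega>: "\<omega> = cat [i] \<eta>" by (rule cantor_cases)
    then show ?case using Suc rho2_bounds[of \<eta>] by (cases i; cases b) (auto simp: rho2_cat1)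
  qed
  then show "\<omega> n = const_seq b n" by (simp add: const_seq_def)
qed

lemma val_bounds: "0 \<le> val u" "val u + 1 / 2 ^ length u \<le> 1"
  using rho2_cat[of u "const_seq d0"] rho2_cat[of u "const_seq d1"]
    rho2_bounds[of "cat u (const_seq d0)"] rho2_bounds[of "cat u (const_seq d1)"] by auto

lemma val_dyadic_int: "\<exists>j::nat. val u = real j / 2 ^ length u"
proof (induction u)
  case Nil then show ?case by (auto intro: exI[of _ 0])
next
  case (Cons i u)
  then obtain j where "val u = real j / 2 ^ length u" by auto
  then have "val (i # u) = real (of_bool i * 2 ^ length u + j) / 2 ^ length (i # u)"
    by (simp add: field_simps)
  then show ?case by blast
qed

lemma val_surj: "j < 2 ^ n \<Longrightarrow> \<exists>u. length u = n \<and> val u = real j / 2 ^ n"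
proof (induction n arbitrary: j)
  case 0 then show ?case by auto
next
  case (Suc n)
  define i where "i = (j \<ge> 2 ^ n)"
  define j' where "j' = (if i then j - 2 ^ n else j)"
  have "j' < 2 ^ n" using Suc.prems by (auto simp: j'_def i_def)
  then obtain u where u: "length u = n" "val u = real j' / 2 ^ n" using Suc.IH by blast
  have "val (i # u) = real j / 2 ^ Suc n"
    using u by (auto simp: j'_def i_def field_simps of_nat_diff)
  then show ?case using u by (intro exI[of _ "i # u"]) auto
qed

lemma val_inj: "length u = length v \<Longrightarrow> val u = val v \<Longrightarrow> u = v"
proof (induction u v rule: list_induct2)
  case Nil then show ?case by simp
next
  case (Cons i u k v)
  have a: "val w < 1" for w
    by (rule less_le_trans[OF _ val_bounds(2)[of w]]) simp
  have "i = k" using Cons.prems a[of u] a[of v] val_bounds(1)[of u] val_bounds(1)[of v]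
    by (cases i; cases k) auto
  then show ?case using Cons by auto
qed

lemma rho2_surj: assumes "t \<in> {0..1}" obtains \<omega> where "rho2 \<omega> = t"
proof -
  \<comment> \<open>The doubling map; digit \<open>n\<close> records whether the orbit of
    \<open>t\<close> is in the right half at time \<open>n\<close>.\<close>
  define f where "f = (\<lambda>s::real. if s \<ge> 1/2 then 2 * s - 1 else 2 * s)"
  define \<omega> where "\<omega> = (\<lambda>n. (f ^^ n) t \<ge> 1/2)"
  have fb: "(f ^^ n) t \<in> {0..1}" for n
    using assms by (induction n) (auto simp: f_def)
  have ps: "(\<Sum>j<n. of_bool (\<omega> j) / 2 ^ Suc j) = t - (f ^^ n) t / 2 ^ n" for n
  proof (induction n)
    case 0 then show ?case by simp
  next
    case (Suc n)
    have "(f ^^ Suc n) t = 2 * (f ^^ n) t - of_bool (\<omega> n)"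
      by (auto simp: f_def \<omega>_def)
    then show ?case using Suc by (simp add: field_simps)
  qed
  have "(\<lambda>n. (f ^^ n) t / 2 ^ n) \<longlonglongrightarrow> 0"
  proof (rule real_tendsto_sandwich)
    show "eventually (\<lambda>n. 0 \<le> (f ^^ n) t / 2 ^ n) sequentially"
      using fb by (auto intro: always_eventually)
    show "eventually (\<lambda>n. (f ^^ n) t / 2 ^ n \<le> (1/2) ^ n) sequentially"
      using fb by (auto intro!: always_eventually simp: power_divide divide_right_mono)
  qed (auto intro: LIMSEQ_power_zero)
  then have "(\<lambda>n. t - (f ^^ n) t / 2 ^ n) \<longlonglongrightarrow> t - 0"
    by (intro tendsto_diff tendsto_const)
  then have "(\<lambda>j. of_bool (\<omega> j) / 2 ^ Suc j) sums t"
    unfolding sums_def ps by simp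
  then have "rho2 \<omega> = t" unfolding rho2_def by (simp add: sums_iff)
  then show ?thesis by (rule that)
qed

section \<open>The lexicographic order and the fibres of \<open>rho2\<close>\<close>

lemma less_fun_cantorE:
  fixes \<omega> \<eta> :: cantor
  assumes "less_fun \<omega> \<eta>"
  obtains u \<omega>' \<eta>' where "\<omega> = cat u (cat [d0] \<omega>')" "\<eta> = cat u (cat [d1] \<eta>')"
proof -
  obtain k where k: "\<omega> k < \<eta> k" "\<And>j. j < k \<Longrightarrow> \<omega> j = \<eta> j"
    using assms unfolding less_fun_def by blast
  have k': "\<omega> k = d0" "\<eta> k = d1" using k(1) by auto
  have *: "cat (map \<theta> [0..<k]) (cat [\<theta> k] (\<lambda>n. \<theta> (Suc k + n))) = \<theta>" for \<theta> :: cantor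
    using cat_map_upt[of \<theta> "Suc k"] by (simp add: cat_append)
  have "map \<omega> [0..<k] = map \<eta> [0..<k]" using k(2) by simp
  then show ?thesis using *[of \<omega>] *[of \<eta>] k' that by metis
qed

lemma less_fun_cat:
  fixes \<omega> \<eta> :: cantor
  assumes "less_fun \<omega> \<eta>" shows "less_fun (cat u \<omega>) (cat u \<eta>)"
proof -
  obtain k where k: "\<omega> k < \<eta> k" "\<And>j. j < k \<Longrightarrow> \<omega> j = \<eta> j"
    using assms unfolding less_fun_def by blast
  show ?thesis
    by (rule less_funI, rule exI[of _ "length u + k"]) (use k in \<open>auto simp: cat_def\<close>)
qed

lemma less_fun_01: "less_fun (cat [d0] \<omega>) (cat [d1] \<eta>)"
  by (rule less_funI, rule exI[of _ 0]) (auto simp: cat_def)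

lemma less_fun_linear:
  fixes \<omega> \<eta> :: cantor
  shows "less_fun \<omega> \<eta> \<or> \<omega> = \<eta> \<or> less_fun \<eta> \<omega>"
proof (cases "\<omega> = \<eta>")
  case False
  define k where "k = (LEAST k. \<omega> k \<noteq> \<eta> k)"
  have "\<exists>k. \<omega> k \<noteq> \<eta> k" using False by auto
  then have k: "\<omega> k \<noteq> \<eta> k" "\<And>j. j < k \<Longrightarrow> \<omega> j = \<eta> j"
    unfolding k_def by (rule LeastI_ex) (use not_less_Least k_def in blast)
  show ?thesis
  proof (cases "\<omega> k")
    case True
    then have "less_fun \<eta> \<omega>" using k by (intro less_funI exI[of _ k]) auto
    then show ?thesis by simp
  next
    case False
    then have "less_fun \<omega> \<eta>" using k by (intro less_funI exI[of _ k]) auto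
    then show ?thesis by simp
  qed
qed simp

lemma rho2_mono: assumes "less_fun \<omega> \<eta>" shows "rho2 \<omega> \<le> rho2 \<eta>"
proof -
  obtain u \<omega>' \<eta>' where *: "\<omega> = cat u (cat [d0] \<omega>')" "\<eta> = cat u (cat [d1] \<eta>')"
    using assms by (rule less_fun_cantorE)
  have "(0 + rho2 \<omega>') / 2 \<le> (1 + rho2 \<eta>') / 2"
    using rho2_bounds[of \<omega>'] rho2_bounds[of \<eta>'] by simp
  then show ?thesis
    unfolding * rho2_cat rho2_cat1 of_bool_eq by (intro add_left_mono divide_right_mono) simp_all
qed

text \<open>After the first difference the tails must have the extreme values 1 and 0, which leaves
  the two expansions of a dyadic number.\<close>

lemma rho2_eqE:
  assumes "less_fun \<omega> \<eta>" "rho2 \<omega> = rho2 \<eta>"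
  obtains u where "\<omega> = cat u (cat [d0] (const_seq d1))" "\<eta> = cat u (cat [d1] (const_seq d0))"
proof -
  obtain u \<omega>' \<eta>' where *: "\<omega> = cat u (cat [d0] \<omega>')" "\<eta> = cat u (cat [d1] \<eta>')"
    using assms(1) by (rule less_fun_cantorE)
  have "rho2 \<omega>' = 1 + rho2 \<eta>'" using assms(2) by (simp add: * rho2_cat rho2_cat1 divide_simps)
  then have "rho2 \<omega>' = 1" "rho2 \<eta>' = 0"
    using rho2_bounds[of \<omega>'] rho2_bounds[of \<eta>'] by auto
  then show ?thesis
    using * rho2_eq_of_bool[of \<omega>' d1] rho2_eq_of_bool[of \<eta>' d0] by (intro that[of u]) auto
qed

lemma rho2_adjacent: "rho2 (cat u (cat [d0] (const_seq d1))) = rho2 (cat u (cat [d1] (const_seq d0)))"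
  by (simp add: rho2_cat rho2_cat1)

lemma less_const_seq: "\<not> less_fun (const_seq d1) \<omega>" "\<not> less_fun \<omega> (const_seq d0)"
  by (auto simp: less_fun_def const_seq_def)

lemma less_fun_cat1_iff:
  "less_fun (cat [i] \<omega>) (cat [k] \<eta>) \<longleftrightarrow> (\<not> i \<and> k) \<or> (i = k \<and> less_fun \<omega> \<eta>)"
proof -
  have "\<not> less_fun (cat [i] \<omega>) (cat [i] \<eta>)" if "\<not> less_fun \<omega> \<eta>"
    using that less_fun_linear[of \<omega> \<eta>] less_fun_cat[of \<eta> \<omega> "[i]"]
    by (auto dest: less_fun_asym simp: less_fun_irrefl)
  then show ?thesis
    using less_fun_01 less_fun_asym[OF less_fun_01] less_fun_cat[of \<omega> \<eta> "[i]"]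
    by (cases i; cases k) auto
qed

text \<open>The two points of a two-point fibre of \<^const>\<open>rho2\<close> are order-theoretic neighbours.\<close>

lemma no_between:
  "\<not> (less_fun (cat u (cat [d0] (const_seq d1))) \<omega> \<and> less_fun \<omega> (cat u (cat [d1] (const_seq d0))))"
proof
  assume "less_fun (cat u (cat [d0] (const_seq d1))) \<omega> \<and> less_fun \<omega> (cat u (cat [d1] (const_seq d0)))"
  then show False
  proof (induction u arbitrary: \<omega>)
    case Nil
    obtain i \<eta> where "\<omega> = cat [i] \<eta>" by (rule cantor_cases)
    then show ?case using Nil by (auto simp: less_fun_cat1_iff less_const_seq)
  next
    case (Cons k u)
    obtain i \<eta> where w: "\<omega> = cat [i] \<eta>" by (rule cantor_cases)
    show ?case using Cons.IH[of \<eta>] Cons.prems unfolding w cat_Cons[of k u]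
      by (auto simp: less_fun_cat1_iff)
  qed
qed

text \<open>Converse of \<open>no_between\<close>: unless the tails after the first difference are
  all ones and all zeros, one of the two expansions of the dyadic point at this place lies strictly
  between.\<close>

lemma less_between:
  assumes "less_fun \<omega> \<eta>" "rho2 \<omega> \<noteq> rho2 \<eta>"
  obtains \<theta> where "less_fun \<omega> \<theta>" "less_fun \<theta> \<eta>"
proof -
  obtain u \<omega>' \<eta>' where *: "\<omega> = cat u (cat [d0] \<omega>')" "\<eta> = cat u (cat [d1] \<eta>')"
    using assms(1) by (rule less_fun_cantorE)
  have "\<omega>' \<noteq> const_seq d1 \<or> \<eta>' \<noteq> const_seq d0"
    using assms(2) rho2_adjacent by (auto simp: *)
  then consider "less_fun \<omega>' (const_seq d1)" | "less_fun (const_seq d0) \<eta>'"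
    using less_fun_linear less_const_seq by metis
  then show ?thesis
  proof cases
    case 1
    show ?thesis by (rule that[of "cat u (cat [d0] (const_seq d1))"])
        (auto simp: * intro!: less_fun_cat less_fun_01 1)
  next
    case 2
    show ?thesis by (rule that[of "cat u (cat [d1] (const_seq d0))"])
        (auto simp: * intro!: less_fun_cat less_fun_01 2)
  qed
qed


section \<open>The homeomorphism group of the interval\<close>

lemma Homeo_simps [simp]:
  "f \<otimes>\<^bsub>Homeo\<^esub> g = g \<circ> f" "\<one>\<^bsub>Homeo\<^esub> = id"
  by (simp_all add: Homeo_def)

text \<open>With maps of the whole line the topological conditions come for free: a strictly
  increasing surjection of the line is continuous, and a continuous bijection of a compact interval
  is a homeomorphism.\<close>

lemma Homeo_memI:
  fixes f :: "real \<Rightarrow> real"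
  assumes "strict_mono f" "surj f" "\<And>t. t \<notin> {0..1} \<Longrightarrow> f t = t"
  shows "f \<in> carrier Homeo"
proof -
  have im: "f ` {0..1} = {0..1}"
  proof -
    have mem: "f t \<in> {0..1} \<longleftrightarrow> t \<in> {0..1}" for t
    proof (rule ccontr)
      assume *: "\<not> ?thesis"
      show False
      proof (cases "t \<in> {0..1}")
        case True
        then have "f t \<notin> {0..1}" using * by simp
        then have "f (f t) = f t" using assms(3) by blast
        then have "f t = t" using strict_mono_eq[OF assms(1)] by blast
        then show False using True * by simp
      qed (use * assms(3) in auto)
    qed
    show ?thesis
    proof
      show "f ` {0..1} \<subseteq> {0..1}" using mem by blast
      show "{0..1} \<subseteq> f ` {0..1}"
      proof
        fix s :: real assume "s \<in> {0..1}"
        moreover obtain t where "s = f t" using assms(2) by (rule surjE)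
        ultimately show "s \<in> f ` {0..1}" using mem[of t] by simp
      qed
    qed
  qed
  have co: "continuous_on UNIV f"
    by (rule continuous_onI_mono) (use assms in \<open>auto simp: strict_mono_less_eq\<close>)
  have "\<exists>g. homeomorphism {0..1} {0..1} f g"
    by (rule homeomorphism_compact)
      (use assms(1) co im in \<open>auto intro: continuous_on_subset strict_mono_imp_inj_on\<close>)
  then show ?thesis
    using assms by (auto simp: Homeo_def strict_mono_on_def strict_mono_def)
qed

lemma Homeo_memD:
  assumes "f \<in> carrier Homeo"
  shows "strict_mono f" "surj f" "\<And>t. t \<notin> {0<..<1} \<Longrightarrow> f t = t"
proof -
  have sm: "strict_mono_on {0..1} f" and o: "\<And>t. t \<notin> {0..1} \<Longrightarrow> f t = t"
    and im: "f ` {0..1} = {0..1}"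
    using assms by (auto simp: Homeo_def homeomorphism_def)
  have b: "f t \<in> {0..1}" if "t \<in> {0..1}" for t using im that by blast
  have "f 0 = 0"
  proof -
    obtain s where s: "s \<in> {0..1}" "f s = 0" using im by (metis atLeastAtMost_iff image_iff order_refl zero_le_one)
    then have "s = 0" using sm b[of 0] by (force simp: strict_mono_on_def)
    then show ?thesis using s by simp
  qed
  moreover have "f 1 = 1"
  proof -
    obtain s where s: "s \<in> {0..1}" "f s = 1" using im by (metis atLeastAtMost_iff image_iff order_refl zero_le_one)
    then have "s = 1" using sm b[of 1] strict_mono_onD[OF sm, of s 1] by (cases "s < 1") auto
    then show ?thesis using s by simp
  qed
  ultimately show fx: "f t = t" if "t \<notin> {0<..<1}" for t
    using o that by (cases "t = 0 \<or> t = 1") auto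
  show "strict_mono f"
  proof (rule strict_monoI)
    fix s t :: real assume "s < t"
    consider "s \<in> {0..1}" "t \<in> {0..1}" | "s \<notin> {0..1}" "t \<notin> {0..1}"
      | "s \<in> {0..1}" "t \<notin> {0..1}" | "s \<notin> {0..1}" "t \<in> {0..1}" by blast
    then show "f s < f t"
    proof cases
      case 1 then show ?thesis using sm \<open>s < t\<close> by (auto simp: strict_mono_on_def)
    next
      case 2 then show ?thesis using o \<open>s < t\<close> by simp
    next
      case 3 then show ?thesis using o[of t] b[of s] \<open>s < t\<close> by auto
    next
      case 4 then show ?thesis using o[of s] b[of t] \<open>s < t\<close> by auto
    qed
  qed
  show "surj f"
    unfolding surj_def using im o by (metis image_iff)
qed

lemma Homeo_comp:
  assumes "f \<in> carrier Homeo" "g \<in> carrier Homeo" shows "g \<circ> f \<in> carrier Homeo"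
proof (rule Homeo_memI)
  note f = Homeo_memD[OF assms(1)] and g = Homeo_memD[OF assms(2)]
  show "strict_mono (g \<circ> f)" using f(1) g(1) by (simp add: strict_mono_def)
  show "surj (g \<circ> f)" by (rule comp_surj[OF f(2) g(2)])
  show "(g \<circ> f) t = t" if "t \<notin> {0..1}" for t using f(3)[of t] g(3)[of t] that by auto
qed

lemma Homeo_inv_mem: assumes "f \<in> carrier Homeo" shows "inv_into UNIV f \<in> carrier Homeo"
proof (rule Homeo_memI)
  note f = Homeo_memD[OF assms]
  have bij: "bij f" using f by (simp add: bij_def strict_mono_imp_inj_on)
  show "strict_mono (inv_into UNIV f)"
    by (rule strict_monoI) (metis bij bij_inv_eq_iff f(1) strict_mono_less)
  show "surj (inv_into UNIV f)" using bij by (simp add: bij_imp_bij_inv bij_is_surj)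
  show "inv_into UNIV f t = t" if "t \<notin> {0..1}" for t
    using f(3)[of t] that inv_f_eq[OF bij_is_inj[OF bij], of t t] by auto
qed

lemma Homeo_inv_inverse:
  assumes "f \<in> carrier Homeo" shows "f (inv_into UNIV f t) = t" "inv_into UNIV f (f t) = t"
  using Homeo_memD[OF assms] by (simp_all add: surj_f_inv_f strict_mono_imp_inj_on inv_f_f)

lemma Homeo_id: "id \<in> carrier Homeo"
  by (rule Homeo_memI) (simp_all add: strict_mono_def)

interpretation Homeo: group Homeo
proof (rule groupI)
  show "\<exists>g\<in>carrier Homeo. g \<otimes>\<^bsub>Homeo\<^esub> f = \<one>\<^bsub>Homeo\<^esub>" if "f \<in> carrier Homeo" for f
    using Homeo_inv_mem[OF that] Homeo_inv_inverse[OF that] by (intro bexI[of _ "inv_into UNIV f"]) auto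
qed (auto simp: Homeo_comp Homeo_id comp_assoc)

lemma Homeo_inv: assumes "f \<in> carrier Homeo" shows "inv\<^bsub>Homeo\<^esub> f = inv_into UNIV f"
proof (rule Homeo.inv_equality)
  show "inv_into UNIV f \<otimes>\<^bsub>Homeo\<^esub> f = \<one>\<^bsub>Homeo\<^esub>"
    using Homeo_inv_inverse[OF assms] by auto
qed (auto simp: assms Homeo_inv_mem)

abbreviation hinv :: "(real \<Rightarrow> real) \<Rightarrow> real \<Rightarrow> real" where
  "hinv \<equiv> m_inv Homeo"

lemma Homeo_inv_apply [simp]:
  assumes "f \<in> carrier Homeo"
  shows "f ((hinv f) t) = t" "(hinv f) (f t) = t"
  using Homeo_inv_inverse[OF assms] by (simp_all add: Homeo_inv[OF assms])

lemma Homeo_less_iff: "f \<in> carrier Homeo \<Longrightarrow> f s < f t \<longleftrightarrow> s < t"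
  using Homeo_memD(1) strict_mono_less by blast

lemma Homeo_le_iff: "f \<in> carrier Homeo \<Longrightarrow> f s \<le> f t \<longleftrightarrow> s \<le> t"
  using Homeo_memD(1) strict_mono_less_eq by blast

lemma Homeo_eq_iff: "f \<in> carrier Homeo \<Longrightarrow> f s = f t \<longleftrightarrow> s = t"
  using Homeo_memD(1) strict_mono_eq by blast

lemma Homeo_0_1: assumes "f \<in> carrier Homeo" shows "f 0 = 0" "f 1 = 1"
  using Homeo_memD(3)[OF assms] by auto

lemma Homeo_Icc: assumes "f \<in> carrier Homeo"
  shows "0 \<le> f t \<longleftrightarrow> 0 \<le> t" "f t \<le> 1 \<longleftrightarrow> t \<le> 1" "0 < f t \<longleftrightarrow> 0 < t" "f t < 1 \<longleftrightarrow> t < 1"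
  using Homeo_le_iff[OF assms, of 0 t] Homeo_le_iff[OF assms, of t 1]
    Homeo_less_iff[OF assms, of 0 t] Homeo_less_iff[OF assms, of t 1] Homeo_0_1[OF assms] by auto

lemma (in group) subgroup_conj_image:
  assumes H: "subgroup H G" and g: "g \<in> carrier G"
  shows "subgroup {inv g \<otimes> h \<otimes> g | h. h \<in> H} G"
    and "G\<lparr>carrier := {inv g \<otimes> h \<otimes> g | h. h \<in> H}\<rparr> \<cong> G\<lparr>carrier := H\<rparr>"
proof -
  let ?K = "{inv g \<otimes> h \<otimes> g | h. h \<in> H}"
  let ?c = "\<lambda>h. inv g \<otimes> h \<otimes> g"
  interpret H: subgroup H G by (rule H)
  have K_image: "?K = ?c ` H" by (auto simp: image_iff)
  have mult: "?c a \<otimes> ?c b = ?c (a \<otimes> b)" if "a \<in> H" "b \<in> H" for a b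
  proof -
    have "g \<otimes> (inv g \<otimes> z) = z" if "z \<in> carrier G" for z
      using that g by (simp flip: m_assoc)
    then show ?thesis using that g by (simp add: m_assoc)
  qed
  show "subgroup ?K G"
    unfolding K_image
  proof (rule subgroupI)
    show "?c ` H \<subseteq> carrier G" using g by auto
    show "?c ` H \<noteq> {}" using H subgroup_nonempty by auto
    show "inv a \<in> ?c ` H" if a: "a \<in> ?c ` H" for a
    proof -
      obtain h where h: "h \<in> H" "a = ?c h" using a by auto
      then have "inv a = ?c (inv h)" using g by (simp add: inv_mult_group m_assoc)
      then show ?thesis using H.m_inv_closed[OF h(1)] by (rule image_eqI)
    qed
    show "a \<otimes> b \<in> ?c ` H" if "a \<in> ?c ` H" "b \<in> ?c ` H" for a b
      using that by (auto simp: mult intro!: imageI)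
  qed
  have "?c \<in> iso (G\<lparr>carrier := H\<rparr>) (G\<lparr>carrier := ?K\<rparr>)"
    unfolding K_image
  proof (rule isoI)
    show "?c \<in> hom (G\<lparr>carrier := H\<rparr>) (G\<lparr>carrier := ?c ` H\<rparr>)"
      by (rule homI) (auto simp: mult)
    show "bij_betw ?c (carrier (G\<lparr>carrier := H\<rparr>)) (carrier (G\<lparr>carrier := ?c ` H\<rparr>))"
      using g by (auto simp: bij_betw_def inj_on_def)
  qed
  then have "G\<lparr>carrier := H\<rparr> \<cong> G\<lparr>carrier := ?K\<rparr>" by (auto simp: is_iso_def)
  then show "G\<lparr>carrier := ?K\<rparr> \<cong> G\<lparr>carrier := H\<rparr>"
    by (rule group.iso_sym[OF subgroup_imp_group[OF H]])
qed

section \<open>Dyadic piecewise linear homeomorphisms\<close>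

text \<open>The breakpoint condition of \<open>Thompson_F\<close>, detached from finiteness of
  \<open>S\<close>: it is used later with the infinite sets \<open>low m\<close>.\<close>

definition affine_off :: "real set \<Rightarrow> (real \<Rightarrow> real) \<Rightarrow> bool" where
  "affine_off S f \<longleftrightarrow>
     (\<forall>p q. 0 \<le> p \<and> p < q \<and> q \<le> 1 \<and> {p<..<q} \<inter> S = {} \<longrightarrow>
           (\<exists>(k::int) c. \<forall>t\<in>{p..q}. f t = 2 powi k * t + c))"

lemma Thompson_F_iff:
  "f \<in> Thompson_F \<longleftrightarrow> f \<in> carrier Homeo \<and> (\<exists>S. finite S \<and> S \<subseteq> dyadic \<and> affine_off S f)"
  unfolding Thompson_F_def affine_off_def by auto

lemma Thompson_F_Homeo: "f \<in> Thompson_F \<Longrightarrow> f \<in> carrier Homeo"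
  by (simp add: Thompson_F_iff)

lemma affine_offE:
  assumes "affine_off S f" "0 \<le> p" "p < q" "q \<le> 1" "{p<..<q} \<inter> S = {}"
  obtains k :: int where "\<And>s t. s \<in> {p..q} \<Longrightarrow> t \<in> {p..q} \<Longrightarrow> f t = f s + 2 powi k * (t - s)"
proof -
  obtain k :: int and c where "\<forall>t\<in>{p..q}. f t = 2 powi k * t + c"
    using assms unfolding affine_off_def by blast
  then show ?thesis by (intro that[of k]) (auto simp: algebra_simps)
qed

lemma affine_offI:
  assumes "\<And>p q. 0 \<le> p \<Longrightarrow> p < q \<Longrightarrow> q \<le> 1 \<Longrightarrow> {p<..<q} \<inter> S = {} \<Longrightarrow>
     \<exists>(k::int). \<forall>t\<in>{p..q}. f t = f p + 2 powi k * (t - p)"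
  shows "affine_off S f"
  unfolding affine_off_def
proof (intro allI impI, elim conjE)
  fix p q assume "0 \<le> p" "p < q" "q \<le> 1" "{p<..<q} \<inter> S = {}"
  then obtain k :: int where "\<forall>t\<in>{p..q}. f t = f p + 2 powi k * (t - p)"
    using assms by blast
  then have "\<forall>t\<in>{p..q}. f t = 2 powi k * t + (f p - 2 powi k * p)"
    by (auto simp: algebra_simps)
  then show "\<exists>(k::int) c. \<forall>t\<in>{p..q}. f t = 2 powi k * t + c" by blast
qed

lemma affine_off_mono: "affine_off S f \<Longrightarrow> S \<subseteq> T \<Longrightarrow> affine_off T f"
  unfolding affine_off_def by blast

lemma affine_off_comp:
  assumes f: "f \<in> carrier Homeo" "affine_off S f" and g: "affine_off T g"
  shows "affine_off (S \<union> f -` T) (g \<circ> f)"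
proof (rule affine_offI)
  fix p q :: real assume *: "0 \<le> p" "p < q" "q \<le> 1" "{p<..<q} \<inter> (S \<union> f -` T) = {}"
  then obtain k :: int where k: "\<And>s t. s \<in> {p..q} \<Longrightarrow> t \<in> {p..q} \<Longrightarrow> f t = f s + 2 powi k * (t - s)"
    using affine_offE[OF f(2), of p q] by blast
  have "{f p<..<f q} \<inter> T = {}"
  proof -
    have False if "r \<in> {f p<..<f q}" "r \<in> T" for r
    proof -
      obtain t where t: "r = f t" using Homeo_memD(2)[OF f(1)] by (metis surj_def)
      then have "t \<in> {p<..<q}" using that Homeo_less_iff[OF f(1)] by auto
      then show False using * t that by auto
    qed
    then show ?thesis by blast
  qed
  then obtain l :: int where l:
    "\<And>s t. s \<in> {f p..f q} \<Longrightarrow> t \<in> {f p..f q} \<Longrightarrow> g t = g s + 2 powi l * (t - s)"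
    using affine_offE[OF g, of "f p" "f q"] * Homeo_less_iff[OF f(1)] Homeo_Icc[OF f(1)] by blast
  have "(g \<circ> f) t = (g \<circ> f) p + 2 powi (k + l) * (t - p)" if "t \<in> {p..q}" for t
  proof -
    have "f t \<in> {f p..f q}" "f p \<in> {f p..f q}" using that Homeo_le_iff[OF f(1)] *(2) by auto
    then have "g (f t) = g (f p) + 2 powi l * (f t - f p)" using l by blast
    also have "f t - f p = 2 powi k * (t - p)" using k[of p t] that by auto
    finally show ?thesis by (simp add: power_int_add mult_ac)
  qed
  then show "\<exists>k::int. \<forall>t\<in>{p..q}. (g \<circ> f) t = (g \<circ> f) p + 2 powi k * (t - p)" by blast
qed

lemma affine_off_inv:
  assumes f: "f \<in> carrier Homeo" "affine_off S f"
  shows "affine_off (f ` S) (hinv f)"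
proof (rule affine_offI)
  let ?h = "hinv f"
  have h: "?h \<in> carrier Homeo" using f by simp
  fix p q :: real assume *: "0 \<le> p" "p < q" "q \<le> 1" "{p<..<q} \<inter> f ` S = {}"
  have "{?h p<..<?h q} \<inter> S = {}"
  proof -
    have False if "t \<in> {?h p<..<?h q}" "t \<in> S" for t
    proof -
      have "f t \<in> {p<..<q}" using that Homeo_less_iff[OF h, of p "f t"] Homeo_less_iff[OF h, of "f t" q] f(1) by auto
      then show False using * that by blast
    qed
    then show ?thesis by blast
  qed
  then obtain k :: int where k: "\<And>s t. s \<in> {?h p..?h q} \<Longrightarrow> t \<in> {?h p..?h q} \<Longrightarrow> f t = f s + 2 powi k * (t - s)"
    using affine_offE[OF f(2), of "?h p" "?h q"] * Homeo_less_iff[OF h] Homeo_Icc[OF h] by blast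
  have "?h t = ?h p + 2 powi (-k) * (t - p)" if "t \<in> {p..q}" for t
  proof -
    have "?h t \<in> {?h p..?h q}" "?h p \<in> {?h p..?h q}" using that Homeo_le_iff[OF h] *(2) by auto
    then have "f (?h t) = f (?h p) + 2 powi k * (?h t - ?h p)" using k by blast
    then have "t = p + 2 powi k * (?h t - ?h p)" using f(1) by simp
    then have "t - p = 2 powi k * (?h t - ?h p)" by linarith
    then have "2 powi (-k) * (t - p) = (2 powi (-k) * 2 powi k) * (?h t - ?h p)"
      by (metis mult.assoc)
    also have "2 powi (-k) * 2 powi k = (1::real)" by (simp add: power_int_minus)
    finally show ?thesis by simp
  qed
  then show "\<exists>k::int. \<forall>t\<in>{p..q}. ?h t = ?h p + 2 powi k * (t - p)" by blast
qed

section \<open>Dyadic points under elements of \<open>F\<close>\<close>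

lemma dyadic_frac [intro]: "of_int m / 2 ^ n \<in> dyadic"
  unfolding dyadic_def by blast

lemma dyadic_0_1 [simp]: "0 \<in> dyadic" "1 \<in> dyadic"
  using dyadic_frac[of 0 0] dyadic_frac[of 1 0] by simp_all

lemma dyadic_add: assumes "s \<in> dyadic" "t \<in> dyadic" shows "s + t \<in> dyadic"
proof -
  obtain m n m' n' where "s = of_int m / 2 ^ n" "t = of_int m' / 2 ^ n'"
    using assms unfolding dyadic_def by blast
  then have "s + t = of_int (m * 2 ^ n' + m' * 2 ^ n) / 2 ^ (n + n')"
    by (simp add: add_divide_distrib power_add)
  then show ?thesis by (metis dyadic_frac)
qed

lemma dyadic_uminus: "t \<in> dyadic \<Longrightarrow> - t \<in> dyadic"
proof -
  assume "t \<in> dyadic"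
  then obtain m n where "t = of_int m / 2 ^ n" unfolding dyadic_def by blast
  then have "- t = of_int (- m) / 2 ^ n" by simp
  then show ?thesis by (metis dyadic_frac)
qed

lemma dyadic_diff: "s \<in> dyadic \<Longrightarrow> t \<in> dyadic \<Longrightarrow> s - t \<in> dyadic"
  using dyadic_add[of s "-t"] dyadic_uminus[of t] by simp

lemma dyadic_powi_mult: assumes "t \<in> dyadic" shows "2 powi k * t \<in> dyadic"
proof -
  obtain m n where t: "t = of_int m / 2 ^ n" using assms unfolding dyadic_def by blast
  show ?thesis
  proof (cases "k \<ge> 0")
    case True
    then have "2 powi k * t = of_int (m * 2 ^ nat k) / 2 ^ n" by (simp add: t power_int_def)
    then show ?thesis by (metis dyadic_frac)
  next
    case False
    then have "2 powi k * t = of_int m / 2 ^ (n + nat (-k))"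
      by (simp add: t power_int_def power_add field_simps)
    then show ?thesis by (metis dyadic_frac)
  qed
qed

text \<open>Induction on the number of breakpoints in (0, t). From the last of them (or from 0) to
  \<open>t\<close> the slope is a power of 2, and the value at that breakpoint is dyadic by
  induction.\<close>

lemma affine_off_dyadic:
  assumes f: "f \<in> carrier Homeo" "affine_off S f" "finite S" "S \<subseteq> dyadic"
  shows "t \<in> dyadic \<Longrightarrow> t \<in> {0..1} \<Longrightarrow> f t \<in> dyadic"
proof (induction "card (S \<inter> {0<..<t})" arbitrary: t rule: less_induct)
  case less
  define m where "m = Max (insert 0 (S \<inter> {0<..<t}))"
  have fin: "finite (insert 0 (S \<inter> {0<..<t}))" using f by simp
  have m_in: "m \<in> insert 0 (S \<inter> {0<..<t})" unfolding m_def by (rule Max_in[OF fin]) simp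
  show ?case
  proof (cases "t = 0")
    case True then show ?thesis using Homeo_0_1[of f] f by simp
  next
    case False
    have "f m \<in> dyadic"
    proof (cases "m = 0")
      case True then show ?thesis using Homeo_0_1[of f] f by simp
    next
      case False
      then have m: "m \<in> S" "m \<in> {0<..<t}" using m_in by auto
      have "S \<inter> {0<..<m} \<subset> S \<inter> {0<..<t}" using m by auto
      then have "card (S \<inter> {0<..<m}) < card (S \<inter> {0<..<t})"
        using f(3) by (intro psubset_card_mono) auto
      then show ?thesis using less.hyps[of m] m f(4) less.prems by auto
    qed
    moreover have "{m<..<t} \<inter> S = {}"
    proof -
      have False if "r \<in> S" "m < r" "r < t" for r
      proof -
        have "0 \<le> m" using m_in by auto
        then have "r \<in> insert 0 (S \<inter> {0<..<t})" using that by auto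
        then have "r \<le> m" unfolding m_def using fin by (intro Max_ge)
        then show False using that by simp
      qed
      then show ?thesis by auto
    qed
    moreover have "0 \<le> m" "m < t" "t \<le> 1" using m_in False less.prems by auto
    ultimately obtain k :: int where "f t = f m + 2 powi k * (t - m)"
      using affine_offE[OF f(2), of m t] by (metis atLeastAtMost_iff less_imp_le order_refl)
    moreover have "m \<in> dyadic" using m_in f(4) by auto
    ultimately show ?thesis
      using \<open>f m \<in> dyadic\<close> less.prems by (simp add: dyadic_add dyadic_powi_mult dyadic_diff)
  qed
qed

lemma Homeo_dyadic_outside: "f \<in> carrier Homeo \<Longrightarrow> t \<notin> {0..1} \<Longrightarrow> f t = t"
  using Homeo_memD(3)[of f t] by auto

lemma Thompson_F_dyadic1:
  assumes "f \<in> Thompson_F" "t \<in> dyadic" shows "f t \<in> dyadic"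
  using assms affine_off_dyadic[of f _ t] Homeo_dyadic_outside[of f t]
  unfolding Thompson_F_iff by (cases "t \<in> {0..1}") auto

lemma Thompson_F_inv: assumes "f \<in> Thompson_F" shows "hinv f \<in> Thompson_F"
proof -
  obtain S where S: "finite S" "S \<subseteq> dyadic" "affine_off S f" and f: "f \<in> carrier Homeo"
    using assms unfolding Thompson_F_iff by blast
  have "f ` S \<subseteq> dyadic" using S Thompson_F_dyadic1[OF assms] by auto
  then show ?thesis
    unfolding Thompson_F_iff using affine_off_inv[OF f S(3)] S(1) f by (auto intro: exI[of _ "f ` S"])
qed

lemma Thompson_F_dyadic_iff:
  assumes "f \<in> Thompson_F" shows "f t \<in> dyadic \<longleftrightarrow> t \<in> dyadic"
  using Thompson_F_dyadic1[OF assms, of t] Thompson_F_dyadic1[OF Thompson_F_inv[OF assms], of "f t"]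
    Thompson_F_Homeo[OF assms] by auto

lemma Thompson_F_comp: assumes "f \<in> Thompson_F" "g \<in> Thompson_F" shows "g \<circ> f \<in> Thompson_F"
proof -
  obtain S where S: "finite S" "S \<subseteq> dyadic" "affine_off S f" and f: "f \<in> carrier Homeo"
    using assms unfolding Thompson_F_iff by blast
  obtain T where T: "finite T" "T \<subseteq> dyadic" "affine_off T g" and g: "g \<in> carrier Homeo"
    using assms unfolding Thompson_F_iff by blast
  have "inj f" using Homeo_eq_iff[OF f] by (auto simp: inj_def)
  then have "finite (S \<union> f -` T)" using S T by (simp add: finite_vimageI)
  moreover have "S \<union> f -` T \<subseteq> dyadic" using S T Thompson_F_dyadic_iff[OF assms(1)] by auto
  ultimately show ?thesis
    unfolding Thompson_F_iff using affine_off_comp[OF f S(3) T(3)] Homeo_comp[OF f g] by blast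
qed

lemma subgroup_Thompson_F: "subgroup Thompson_F Homeo"
proof (rule Homeo.subgroupI)
  have "affine_off {} id"
    by (rule affine_offI) (auto intro: exI[of _ "0::int"])
  then have "id \<in> Thompson_F" unfolding Thompson_F_iff using Homeo.one_closed by auto
  then show "Thompson_F \<noteq> {}" by blast
qed (auto simp: Thompson_F_inv Thompson_F_comp Thompson_F_Homeo)

text \<open>Take a level at which no interval has a breakpoint inside. On each of its intervals the
  map is affine with slope \<open>2 powi k\<close> and dyadic value at the left end, so sufficiently
  small standard subintervals go to standard intervals. Finitely many intervals give a uniform
  level.\<close>

lemma Thompson_F_prefix_replacement:
  assumes "f \<in> Thompson_F"
  obtains N where "\<And>u. length u \<ge> N \<Longrightarrow> \<exists>v. \<forall>\<eta>. f (rho2 (cat u \<eta>)) = rho2 (cat v \<eta>)"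
proof -
  obtain S where S: "finite S" "S \<subseteq> dyadic" "affine_off S f" and f: "f \<in> carrier Homeo"
    using assms unfolding Thompson_F_iff by blast
  have "\<exists>N. \<forall>s\<in>S. \<exists>m::int. s = of_int m / 2 ^ N"
    using S(1,2)
  proof (induction S)
    case empty then show ?case by simp
  next
    case (insert s S)
    then obtain N where N: "\<forall>s\<in>S. \<exists>m::int. s = of_int m / 2 ^ N" by auto
    obtain m n where mn: "s = of_int m / 2 ^ n" using insert unfolding dyadic_def by auto
    have "\<exists>m::int. r = of_int m / 2 ^ (n + N)" if r: "r \<in> insert s S" for r
    proof (cases "r = s")
      case True
      then have "r = of_int (m * 2 ^ N) / 2 ^ (n + N)" using mn by (simp add: power_add)
      then show ?thesis by blast
    next
      case False
      then obtain m' where "r = of_int m' / 2 ^ N" using N r False by blast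
      then have "r = of_int (m' * 2 ^ n) / 2 ^ (n + N)" by (simp add: power_add)
      then show ?thesis by blast
    qed
    then show ?case by blast
  qed
  then obtain N where N: "\<forall>s\<in>S. \<exists>m::int. s = of_int m / 2 ^ N" by blast
  have loc: "\<exists>M. \<forall>w. length w \<ge> M \<longrightarrow> (\<exists>v. \<forall>\<eta>. f (rho2 (cat (u @ w) \<eta>)) = rho2 (cat v \<eta>))"
    if u: "length u = N" for u
  proof -
    let ?p = "val u" and ?q = "val u + 1 / 2 ^ N"
    obtain j :: nat where j: "?p = real j / 2 ^ N" using val_dyadic_int[of u] u by auto
    have "{?p<..<?q} \<inter> S = {}"
    proof -
      have False if s: "s \<in> S" "?p < s" "s < ?q" for s
      proof -
        obtain m where "s = of_int m / 2 ^ N" using N s(1) by blast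
        then have "of_int (int j) < real_of_int m" "real_of_int m < of_int (int j + 1)"
          using s(2,3) j by (auto simp: field_simps)
        then have "int j < m" "m < int j + 1" by (simp_all only: of_int_less_iff)
        then show False by simp
      qed
      then show ?thesis by auto
    qed
    then obtain k :: int where k:
      "\<And>s t. s \<in> {?p..?q} \<Longrightarrow> t \<in> {?p..?q} \<Longrightarrow> f t = f s + 2 powi k * (t - s)"
      using affine_offE[OF S(3), of ?p ?q] val_bounds[of u] u by (metis less_add_same_cancel1 zero_less_divide_1_iff zero_less_numeral zero_less_power)
    have "?p \<in> dyadic" unfolding j by (metis dyadic_frac of_int_of_nat_eq)
    then obtain a :: int and b :: nat where ab: "f ?p = of_int a / 2 ^ b"
      using Thompson_F_dyadic1[OF assms] unfolding dyadic_def by blast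
    have "\<exists>v. \<forall>\<eta>. f (rho2 (cat (u @ w) \<eta>)) = rho2 (cat v \<eta>)" if w: "length w \<ge> b + nat \<bar>k\<bar>" for w
    proof -
      obtain i :: nat where i: "val w = real i / 2 ^ length w" using val_dyadic_int by blast
      \<comment> \<open>The level of the image interval: slope \<open>2 powi k\<close> lowers the
        level by \<open>k\<close>. The bound on \<open>length w\<close> makes it at least
        \<open>b\<close>, so that \<open>f ?p\<close> is a multiple of
        \<open>1 / 2 ^ n\<close>.\<close>
      define n where "n = nat (int (N + length w) - k)"
      have n: "int n = int (N + length w) - k" using w by (simp add: n_def)
      have nb: "n \<ge> b" using w n by linarith
      have p2: "2 powi k / 2 ^ (N + length w) = 1 / (2::real) ^ n"
      proof -
        have "(2::real) ^ n = 2 powi (int (N + length w) - k)"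
          unfolding n[symmetric] by simp
        also have "\<dots> = 2 ^ (N + length w) / 2 powi k"
          by (simp add: power_int_diff del: of_nat_add)
        finally show ?thesis by simp
      qed
      have eq: "f (rho2 (cat (u @ w) \<eta>)) = of_int (a * 2 ^ (n - b) + int i) / 2 ^ n + rho2 \<eta> / 2 ^ n" for \<eta>
      proof -
        have *: "rho2 (cat (u @ w) \<eta>) = ?p + (real i + rho2 \<eta>) / 2 ^ (N + length w)"
          using u i by (simp add: cat_append rho2_cat field_simps power_add)
        have "rho2 (cat (u @ w) \<eta>) \<in> {?p..?q}"
          using rho2_bounds[of "cat w \<eta>"] u by (auto simp: cat_append rho2_cat[of u] divide_right_mono)
        then have "f (rho2 (cat (u @ w) \<eta>)) = f ?p + 2 powi k * ((real i + rho2 \<eta>) / 2 ^ (N + length w))"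
          using k[of ?p "rho2 (cat (u @ w) \<eta>)"] * by auto
        also have "\<dots> = f ?p + (real i + rho2 \<eta>) * (2 powi k / 2 ^ (N + length w))" by simp
        also have "\<dots> = f ?p + (real i + rho2 \<eta>) / 2 ^ n" unfolding p2 by simp
        also have "f ?p = of_int (a * 2 ^ (n - b)) / 2 ^ n"
        proof -
          have "(2::real) ^ n = 2 ^ (n - b) * 2 ^ b" using nb by (simp flip: power_add)
          then show ?thesis by (simp add: ab)
        qed
        finally show ?thesis by (simp add: add_divide_distrib)
      qed
      \<comment> \<open>The image interval is [J / 2^n, (J + 1) / 2^n]. As it lies in [0, 1],
        \<open>?J\<close> is the numerator of a word of length \<open>n\<close>.\<close>
      let ?J = "a * 2 ^ (n - b) + int i"
      have "0 \<le> f (rho2 (cat (u @ w) (const_seq d0)))" "f (rho2 (cat (u @ w) (const_seq d1))) \<le> 1"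
        using Homeo_Icc[OF f] rho2_bounds by blast+
      then have "0 \<le> real_of_int ?J / 2 ^ n" "real_of_int ?J / 2 ^ n + 1 / 2 ^ n \<le> 1"
        unfolding eq by auto
      moreover have "0 \<le> x \<and> x + 1 \<le> 2 ^ n" if "0 \<le> x / 2 ^ n" "x / 2 ^ n + 1 / 2 ^ n \<le> 1" for x :: real
        using that by (simp add: pos_le_divide_eq flip: add_divide_distrib)
      ultimately have "0 \<le> real_of_int ?J" "real_of_int ?J + 1 \<le> 2 ^ n" by blast+
      then have "of_int 0 \<le> real_of_int ?J" "real_of_int (?J + 1) \<le> of_int (2 ^ n)" by simp_all
      then have "0 \<le> ?J" "?J + 1 \<le> 2 ^ n" by (simp_all only: of_int_le_iff)
      then have J: "0 \<le> ?J" "?J < 2 ^ n" by simp_all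
      then have "nat ?J < 2 ^ n" by (simp add: nat_less_iff)
      then obtain v where v: "length v = n" "val v = real (nat ?J) / 2 ^ n" using val_surj by blast
      have "f (rho2 (cat (u @ w) \<eta>)) = rho2 (cat v \<eta>)" for \<eta>
        unfolding eq rho2_cat[of v] v using J by simp
      then show ?thesis by blast
    qed
    then show ?thesis by blast
  qed
  then obtain M where M: "\<And>u w. length u = N \<Longrightarrow> length w \<ge> M u \<Longrightarrow>
      \<exists>v. \<forall>\<eta>. f (rho2 (cat (u @ w) \<eta>)) = rho2 (cat v \<eta>)" by metis
  have fin: "finite (M ` {u. length u = N})"
    using finite_lists_length_eq[of "UNIV :: bool set" N] by simp
  have Mle: "M u \<le> Max (M ` {u. length u = N})" if "length u = N" for u
    using fin that by (intro Max_ge) auto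
  show ?thesis
  proof (rule that[of "N + Max (M ` {u. length u = N})"])
    fix u :: "bool list" assume u: "N + Max (M ` {u. length u = N}) \<le> length u"
    have "length (take N u) = N" "M (take N u) \<le> length (drop N u)"
      using u Mle[of "take N u"] by auto
    from M[OF this] show "\<exists>v. \<forall>\<eta>. f (rho2 (cat u \<eta>)) = rho2 (cat v \<eta>)" by simp
  qed
qed


section \<open>The maps computed by the states of the transducer\<close>

fun final :: "state \<Rightarrow> bool list \<Rightarrow> state" where
  "final s [] = s"
| "final s (i # w) = final (snd (transition s i)) w"

lemma emitted_Cons: "emitted s (i # w) = fst (transition s i) @ emitted (snd (transition s i)) w"
  by (simp add: case_prod_unfold)

lemma emitted_append: "emitted s (u @ w) = emitted s u @ emitted (final s u) w"
  by (induction u arbitrary: s) (auto simp: case_prod_unfold)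

lemma final_append: "final s (u @ w) = final (final s u) w"
  by (induction u arbitrary: s) auto

text \<open>The output is read off as in \<open>psi_cantor\<close>, but from any initial state,
  because after a prefix the transducer goes on from the state reached.\<close>

definition run :: "state \<Rightarrow> cantor \<Rightarrow> cantor" where
  "run s \<omega> n =
     emitted s (map \<omega> [0..<(LEAST k. n < length (emitted s (map \<omega> [0..<k])))]) ! n"

lemma psi_cantor_run: "psi_cantor = run Rho"
  by (auto simp: psi_cantor_def run_def Let_def fun_eq_iff)

text \<open>The only silent transition leads from \<open>StC\<close> to \<open>StD\<close>, and
  \<open>StD\<close> always writes. So two consecutive steps write at least one letter; one silent
  step may be pending at the end, except that a run from \<open>StD\<close> has paid for it in
  advance.\<close>

lemma length_emitted: "length u \<le> 2 * length (emitted s u) + (if s = StD then 0 else 1)"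
proof (induction u arbitrary: s)
  case (Cons i u)
  show ?case using Cons[of "snd (transition s i)"] by (cases s; cases i) auto
qed simp

lemma emitted_prefix:
  assumes "k \<le> l"
  obtains w where "emitted s (map \<omega> [0..<l]) = emitted s (map \<omega> [0..<k]) @ w"
proof -
  have "map \<omega> [0..<l] = map \<omega> [0..<k] @ map \<omega> [k..<l]"
    using assms by (metis le_add_diff_inverse map_append upt_add_eq_append zero_le)
  then show ?thesis using that by (metis emitted_append)
qed

lemma run_nth:
  assumes "n < length (emitted s (map \<omega> [0..<k]))"
  shows "run s \<omega> n = emitted s (map \<omega> [0..<k]) ! n"
proof -
  let ?P = "\<lambda>k. n < length (emitted s (map \<omega> [0..<k]))"
  have P: "?P (Least ?P)" and le: "Least ?P \<le> k" using assms by (auto intro: LeastI Least_le)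
  obtain w where "emitted s (map \<omega> [0..<k]) = emitted s (map \<omega> [0..<Least ?P]) @ w"
    using le by (rule emitted_prefix)
  then show ?thesis using P by (simp add: run_def nth_append)
qed

lemma emitted_long: "n < length (emitted s (map \<omega> [0..<2 * n + 3]))"
  using length_emitted[of "map \<omega> [0..<2 * n + 3]" s] by (simp split: if_splits)

lemma run_cat1: "run s (cat [i] \<omega>) = cat (fst (transition s i)) (run (snd (transition s i)) \<omega>)"
proof
  fix n
  let ?v = "fst (transition s i)" and ?s = "snd (transition s i)" and ?u = "map \<omega> [0..<2 * n + 3]"
  have e: "emitted s (map (cat [i] \<omega>) [0..<Suc (2 * n + 3)]) = ?v @ emitted ?s ?u"
    unfolding map_cat_single emitted_Cons ..
  have n: "n < length (emitted ?s ?u)" by (rule emitted_long)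
  have "run s (cat [i] \<omega>) n = (?v @ emitted ?s ?u) ! n"
    using run_nth[of n s "cat [i] \<omega>" "Suc (2 * n + 3)"] n unfolding e by simp
  also have "\<dots> = cat ?v (run ?s \<omega>) n"
    using n by (auto simp: cat_def nth_append intro!: run_nth[symmetric])
  finally show "run s (cat [i] \<omega>) n = cat ?v (run ?s \<omega>) n" .
qed

lemma run_cat: "run s (cat u \<omega>) = cat (emitted s u) (run (final s u) \<omega>)"
proof (induction u arbitrary: s)
  case (Cons i u)
  show ?case unfolding cat_Cons[of i u] run_cat1 Cons.IH emitted_Cons by (simp add: cat_append)
qed simp

text \<open>In \<open>StC\<close> the letter 1 writes nothing, so one more letter has to be read:
  the output then starts with 01 or 1, which is above the output 00 on the letter 0.\<close>

lemma less_fun_run01: "less_fun (run s (cat [d0] \<omega>)) (run s (cat [d1] \<eta>))"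
proof (cases s)
  case StC
  obtain i \<theta> where "\<eta> = cat [i] \<theta>" by (rule cantor_cases)
  then show ?thesis
    using StC by (cases i) (simp_all add: run_cat1 cat_Cons[of _ "[_]"] less_fun_cat1_iff)
next
  case StD
  then show ?thesis by (simp add: run_cat1 cat_Cons[of _ "[_]"] less_fun_cat1_iff)
qed (simp_all add: run_cat1 less_fun_cat1_iff)

lemma run_less_fun: assumes "less_fun \<omega> \<eta>" shows "less_fun (run s \<omega>) (run s \<eta>)"
proof -
  obtain u \<omega>' \<eta>' where *: "\<omega> = cat u (cat [d0] \<omega>')" "\<eta> = cat u (cat [d1] \<eta>')"
    using assms by (rule less_fun_cantorE)
  show ?thesis unfolding * run_cat[of s u] by (intro less_fun_cat less_fun_run01)
qed

lemma open_cylinder: "open {\<omega> :: cantor. \<forall>i\<in>{..<k}. \<omega> i \<in> {\<theta> i}}"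
  by (rule product_topology_basis') (simp_all add: open_discrete)

text \<open>By \<open>emitted_long\<close>, output digit \<open>n\<close> depends on the first
  \<open>2 * n + 3\<close> input digits only.\<close>

lemma continuous_run: "continuous_on UNIV (run s)"
proof (rule continuous_on_coordinatewise_then_product)
  fix n
  have "open ((\<lambda>\<omega>. run s \<omega> n) -` U)" for U
  proof (subst open_subopen, rule ballI)
    fix \<theta> assume \<theta>: "\<theta> \<in> (\<lambda>\<omega>. run s \<omega> n) -` U"
    let ?C = "{\<omega> :: cantor. \<forall>i\<in>{..<2 * n + 3}. \<omega> i \<in> {\<theta> i}}"
    have eq: "run s \<omega> n = run s \<theta> n" if "\<omega> \<in> ?C" for \<omega>
    proof -
      have "map \<omega> [0..<2 * n + 3] = map \<theta> [0..<2 * n + 3]" using that by simp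
      then show ?thesis by (metis emitted_long run_nth)
    qed
    have "?C \<subseteq> (\<lambda>\<omega>. run s \<omega> n) -` U"
    proof
      fix \<omega> assume "\<omega> \<in> ?C"
      then show "\<omega> \<in> (\<lambda>\<omega>. run s \<omega> n) -` U" using eq[of \<omega>] \<theta> by (simp only: vimage_eq)
    qed
    moreover have "\<theta> \<in> ?C" by simp
    ultimately show "\<exists>T. open T \<and> \<theta> \<in> T \<and> T \<subseteq> (\<lambda>\<omega>. run s \<omega> n) -` U"
      by (intro exI[of _ ?C] conjI open_cylinder)
  qed
  then show "continuous_on UNIV (\<lambda>\<omega>. run s \<omega> n)"
    by (simp add: continuous_on_open_vimage)
qed

lemma compact_UNIV_cantor: "compact (UNIV :: cantor set)"
proof -
  have "compact_space (euclidean :: bool topology)"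
    by (simp add: compact_space_def finite_imp_compact)
  then have "compact_space (product_topology (\<lambda>_::nat. euclidean :: bool topology) UNIV)"
    using compact_space_product_topology by blast
  then show ?thesis by (simp add: euclidean_product_topology compact_space_def)
qed

text \<open>Greedy choice of input: \<open>StC\<close> produces 00, 01 or 1 by reading 0, 10 or 11,
  the other states produce single letters. From \<open>StD\<close> no output starts with 00.\<close>

lemma run_dense:
  "s \<noteq> StD \<Longrightarrow> \<exists>u w. emitted s u = v @ w"
proof (induction "length v" arbitrary: s v rule: less_induct)
  case less
  have ext: "\<exists>u w. emitted s u = (x @ v') @ w"
    if *: "v = x @ v'" "emitted s y = x" "final s y \<noteq> StD" "length v' < length v" for x y v'
  proof -
    obtain u w where "emitted (final s y) u = v' @ w" using less.hyps[OF *(4,3)] by blast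
    then show ?thesis using * by (intro exI[of _ "y @ u"] exI[of _ w]) (simp add: emitted_append)
  qed
  consider "v = []" | "s = StC" "v = [d0]" | v' where "s = StC" "v = d0 # d0 # v'"
    | v' where "s = StC" "v = d0 # d1 # v'" | v' where "s = StC" "v = d1 # v'"
    | i v' where "s \<noteq> StC" "v = i # v'"
    by (metis (full_types) list.exhaust)
  then show ?case
  proof cases
    case 1 then show ?thesis by auto
  next
    case 2 then show ?thesis by (intro exI[of _ "[d0]"]) auto
  next
    case 3 then show ?thesis using ext[of "[d0, d0]" v' "[d0]"] by simp
  next
    case 4 then show ?thesis using ext[of "[d0, d1]" v' "[d1, d0]"] by simp
  next
    case 5 then show ?thesis using ext[of "[d1]" v' "[d1, d1]"] by simp
  next
    case 6 then show ?thesis using ext[of "[i]" v' "[i]"] less.prems by (cases s; cases i) auto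
  qed
qed

text \<open>By \<open>run_dense\<close> any finite set of digit conditions can be met; these
  conditions are closed, so compactness meets all of them at once.\<close>

lemma run_surj: assumes "s \<noteq> StD" shows "range (run s) = UNIV"
proof -
  have "\<exists>\<omega>. run s \<omega> = \<eta>" for \<eta>
  proof -
    have "UNIV \<inter> (\<Inter>n\<in>UNIV. {\<omega>. run s \<omega> n = \<eta> n}) \<noteq> {}"
    proof (rule compact_imp_fip_image[OF compact_UNIV_cantor])
      show "closed {\<omega>. run s \<omega> n = \<eta> n}" for n
        using continuous_on_product_then_coordinatewise[OF continuous_run]
        by (intro closed_Collect_eq) auto
      fix I :: "nat set" assume "finite I"
      then obtain k where k: "I \<subseteq> {..<k}" by (auto dest: finite_nat_bounded)
      obtain u w where u: "emitted s u = map \<eta> [0..<k] @ w" using run_dense[OF assms] by blast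
      have "run s (cat u (const_seq d0)) n = \<eta> n" if "n < k" for n
        using that by (simp add: run_cat u cat_append cat_def[of "map _ _"])
      then show "UNIV \<inter> (\<Inter>n\<in>I. {\<omega>. run s \<omega> n = \<eta> n}) \<noteq> {}" using k by blast
    qed
    then show ?thesis by (auto simp: fun_eq_iff)
  qed
  then show ?thesis by (auto simp: surj_def) metis
qed

lemma order_homeo_run: assumes "s \<noteq> StD" shows "order_homeo (run s)"
proof -
  have inj: "inj (run s)"
    using run_less_fun less_fun_linear less_fun_irrefl by (metis injI)
  have "\<exists>U V. open U \<and> open V \<and> x \<in> U \<and> y \<in> V \<and> disjnt U V" if "x \<noteq> y" for x y :: bool
    using that by (intro exI[of _ "{x}"] exI[of _ "{y}"]) (simp add: open_discrete)
  then have "Hausdorff_space (euclidean :: bool topology)"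
    by (simp add: Hausdorff_space_def)
  then have "Hausdorff_space (product_topology (\<lambda>_::nat. euclidean :: bool topology) UNIV)"
    by (simp add: Hausdorff_space_product_topology)
  then have "Hausdorff_space (euclidean :: cantor topology)"
    by (simp add: euclidean_product_topology)
  then have "homeomorphic_map euclidean euclidean (run s)"
    using compact_UNIV_cantor continuous_run[of s] run_surj[OF assms] inj
    by (intro continuous_imp_homeomorphic_map) (auto simp: compact_space_def)
  then obtain g where "homeomorphic_maps euclidean euclidean (run s) g"
    by (auto simp: homeomorphic_map_maps)
  then have "homeomorphism UNIV UNIV (run s) g"
    using surjI[of "run s" g] surjI[of g "run s"]
    by (simp add: homeomorphic_maps_def homeomorphism_def)
  then show ?thesis using run_less_fun by (auto simp: order_homeo_def)
qed

section \<open>Induced maps\<close>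

text \<open>Evaluates an induced map from any compatible formula, without a proof that
  \<open>\<phi>\<close> is an order homeomorphism; in this way the prefix tables of
  \<open>x0\<close> and \<open>x1\<close> become piecewise linear formulas.\<close>

lemma induced_eqI:
  assumes "\<And>\<omega>. rho2 (\<phi> \<omega>) = h (rho2 \<omega>)" and "t \<in> {0..1}"
  shows "induced \<phi> t = h t"
proof -
  obtain \<omega> where w: "rho2 \<omega> = t" using assms(2) by (rule rho2_surj)
  have "(THE s. \<exists>\<omega>. rho2 \<omega> = t \<and> s = rho2 (\<phi> \<omega>)) = h t"
    by (rule the_equality) (use assms w in auto)
  then show ?thesis using assms(2) by (simp add: induced_def)
qed

lemma order_homeo_less_iff:
  assumes "order_homeo \<phi>" shows "less_fun (\<phi> \<omega>) (\<phi> \<eta>) \<longleftrightarrow> less_fun \<omega> \<eta>"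
  using assms less_fun_linear[of \<omega> \<eta>] unfolding order_homeo_def
  by (metis less_fun_asym less_fun_irrefl)

text \<open>Distinct points have the same \<open>rho2\<close> value exactly when nothing lies
  between them, and this is a property of the order alone.\<close>

lemma order_homeo_rho2_eq_iff:
  assumes "order_homeo \<phi>" shows "rho2 (\<phi> \<omega>) = rho2 (\<phi> \<eta>) \<longleftrightarrow> rho2 \<omega> = rho2 \<eta>"
proof -
  have surj: "surj \<phi>" using assms by (auto simp: order_homeo_def homeomorphism_def)
  have *: "rho2 (\<phi> \<omega>) = rho2 (\<phi> \<eta>) \<longleftrightarrow> rho2 \<omega> = rho2 \<eta>" if less: "less_fun \<omega> \<eta>" for \<omega> \<eta>
  proof
    assume eq: "rho2 (\<phi> \<omega>) = rho2 (\<phi> \<eta>)"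
    show "rho2 \<omega> = rho2 \<eta>"
    proof (rule ccontr)
      assume "rho2 \<omega> \<noteq> rho2 \<eta>"
      then obtain \<theta> where "less_fun \<omega> \<theta>" "less_fun \<theta> \<eta>" using less_between less by blast
      then have t: "less_fun (\<phi> \<omega>) (\<phi> \<theta>)" "less_fun (\<phi> \<theta>) (\<phi> \<eta>)"
        by (simp_all add: order_homeo_less_iff[OF assms])
      have "less_fun (\<phi> \<omega>) (\<phi> \<eta>)" using less by (simp add: order_homeo_less_iff[OF assms])
      then show False using eq t by (metis rho2_eqE no_between)
    qed
  next
    assume eq: "rho2 \<omega> = rho2 \<eta>"
    show "rho2 (\<phi> \<omega>) = rho2 (\<phi> \<eta>)"
    proof (rule ccontr)
      assume ne: "rho2 (\<phi> \<omega>) \<noteq> rho2 (\<phi> \<eta>)"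
      have "less_fun (\<phi> \<omega>) (\<phi> \<eta>)" using less by (simp add: order_homeo_less_iff[OF assms])
      then obtain \<theta> where t: "less_fun (\<phi> \<omega>) \<theta>" "less_fun \<theta> (\<phi> \<eta>)" using less_between ne by blast
      obtain \<theta>' where "\<theta> = \<phi> \<theta>'" using surj by (rule surjE)
      then have "less_fun \<omega> \<theta>'" "less_fun \<theta>' \<eta>" using t by (simp_all add: order_homeo_less_iff[OF assms])
      then show False using less eq by (metis rho2_eqE no_between)
    qed
  qed
  show ?thesis using *[of \<omega> \<eta>] *[of \<eta> \<omega>] less_fun_linear[of \<omega> \<eta>] by auto
qed

lemma induced_rho2:
  assumes "order_homeo \<phi>" shows "induced \<phi> (rho2 \<omega>) = rho2 (\<phi> \<omega>)"
proof -
  have "(THE s. \<exists>\<eta>. rho2 \<eta> = rho2 \<omega> \<and> s = rho2 (\<phi> \<eta>)) = rho2 (\<phi> \<omega>)"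
    by (rule the_equality) (use order_homeo_rho2_eq_iff[OF assms] in auto)
  then show ?thesis using rho2_bounds by (simp add: induced_def)
qed

lemma induced_Homeo:
  assumes "order_homeo \<phi>" shows "induced \<phi> \<in> carrier Homeo"
proof -
  have surj: "surj \<phi>" using assms by (auto simp: order_homeo_def homeomorphism_def)
  have out: "induced \<phi> t = t" if "t \<notin> {0..1}" for t
    using that unfolding induced_def by (rule if_not_P)
  have into: "induced \<phi> t \<in> {0..1}" if t: "t \<in> {0..1}" for t
    using rho2_surj[OF t] induced_rho2[OF assms] rho2_bounds by (metis atLeastAtMost_iff)
  have mono: "induced \<phi> s < induced \<phi> t" if st: "s < t" "s \<in> {0..1}" "t \<in> {0..1}" for s t
  proof -
    obtain \<omega> \<eta> where w: "rho2 \<omega> = s" "rho2 \<eta> = t" using st rho2_surj by metis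
    have "less_fun \<omega> \<eta>"
      using less_fun_linear[of \<omega> \<eta>] rho2_mono[of \<eta> \<omega>] w st by auto
    then have "rho2 (\<phi> \<omega>) \<le> rho2 (\<phi> \<eta>)"
      by (intro rho2_mono) (simp add: order_homeo_less_iff[OF assms])
    moreover have "rho2 (\<phi> \<omega>) \<noteq> rho2 (\<phi> \<eta>)"
      using order_homeo_rho2_eq_iff[OF assms] w st by simp
    ultimately show ?thesis using induced_rho2[OF assms] w by (metis order_less_le)
  qed
  show ?thesis
  proof (rule Homeo_memI)
    show "strict_mono (induced \<phi>)"
    proof (rule strict_monoI)
      fix s t :: real assume "s < t"
      then show "induced \<phi> s < induced \<phi> t"
        using mono[of s t] into[of s] into[of t] out[of s] out[of t]
        by (cases "s \<in> {0..1}"; cases "t \<in> {0..1}") auto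
    qed
    show "surj (induced \<phi>)"
    proof -
      have "\<exists>s. t = induced \<phi> s" for t
      proof (cases "t \<in> {0..1}")
        case True
        then obtain \<omega> where w: "rho2 \<omega> = t" by (rule rho2_surj)
        obtain \<eta> where "\<omega> = \<phi> \<eta>" using surj by (rule surjE)
        then show ?thesis using w induced_rho2[OF assms] by metis
      next
        case False
        then show ?thesis using out by metis
      qed
      then show ?thesis by (simp add: surj_def)
    qed
  qed (rule out)
qed

lemma order_homeo_psi_cantor: "order_homeo psi_cantor"
  unfolding psi_cantor_run by (rule order_homeo_run) simp

lemma psi_Homeo: "psi \<in> carrier Homeo"
  unfolding psi_def by (rule induced_Homeo[OF order_homeo_psi_cantor])

lemma psi_rho2: "psi (rho2 \<omega>) = rho2 (run Rho \<omega>)"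
  unfolding psi_def using induced_rho2[OF order_homeo_psi_cantor] by (simp add: psi_cantor_run)

lemma subgroup_conj_F: "subgroup (conj_F psi) Homeo"
  unfolding conj_F_def by (rule Homeo.subgroup_conj_image[OF subgroup_Thompson_F psi_Homeo])

lemma conj_F_iso: "Homeo\<lparr>carrier := conj_F psi\<rparr> \<cong> Homeo\<lparr>carrier := Thompson_F\<rparr>"
  unfolding conj_F_def by (rule Homeo.subgroup_conj_image[OF subgroup_Thompson_F psi_Homeo])

text \<open>Conjugacy as an intertwining relation, which avoids any computation with the inverse of
  \<open>psi\<close>.\<close>

lemma conj_F_iff:
  "g \<in> conj_F psi \<longleftrightarrow> g \<in> carrier Homeo \<and> (\<exists>f\<in>Thompson_F. \<forall>t. psi (f t) = g (psi t))"
proof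
  assume "g \<in> conj_F psi"
  then obtain f where f: "f \<in> Thompson_F"
    and g: "g = hinv psi \<otimes>\<^bsub>Homeo\<^esub> f \<otimes>\<^bsub>Homeo\<^esub> psi"
    unfolding conj_F_def by blast
  have "g \<in> carrier Homeo"
    unfolding g using psi_Homeo Thompson_F_Homeo[OF f] by (intro Homeo.m_closed Homeo.inv_closed)
  moreover have "\<forall>t. psi (f t) = g (psi t)" by (simp add: g psi_Homeo)
  ultimately show "g \<in> carrier Homeo \<and> (\<exists>f\<in>Thompson_F. \<forall>t. psi (f t) = g (psi t))"
    using f by blast
next
  assume "g \<in> carrier Homeo \<and> (\<exists>f\<in>Thompson_F. \<forall>t. psi (f t) = g (psi t))"
  then obtain f where f: "f \<in> Thompson_F" "\<And>t. psi (f t) = g (psi t)" by blast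
  have "g = hinv psi \<otimes>\<^bsub>Homeo\<^esub> f \<otimes>\<^bsub>Homeo\<^esub> psi"
    by (rule ext) (simp add: f(2) psi_Homeo)
  then show "g \<in> conj_F psi" unfolding conj_F_def using f(1) by blast
qed


section \<open>The generators\<close>

lemma cat_Cons2: "cat (i # j # u) \<eta> = cat [i] (cat (j # u) \<eta>)"
  by (rule cat_Cons)

lemma cat_single_eq_iff: "cat [i] \<omega> = cat [j] \<eta> \<longleftrightarrow> i = j \<and> \<omega> = \<eta>"
proof
  assume eq: "cat [i] \<omega> = cat [j] \<eta>"
  have "\<omega> n = \<eta> n" for n using fun_cong[OF eq, of "Suc n"] by simp
  then show "i = j \<and> \<omega> = \<eta>" using fun_cong[OF eq, of 0] by auto
qed simp

lemma cantor_cases3: obtains i j k \<eta> where "\<omega> = cat [i, j, k] \<eta>"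
proof -
  obtain i \<eta>1 where 1: "\<omega> = cat [i] \<eta>1" by (rule cantor_cases)
  obtain j \<eta>2 where 2: "\<eta>1 = cat [j] \<eta>2" by (rule cantor_cases)
  obtain k \<eta>3 where 3: "\<eta>2 = cat [k] \<eta>3" by (rule cantor_cases)
  show ?thesis by (rule that[of i j k \<eta>3]) (simp add: 1 2 3 cat_Cons2)
qed

lemma x0_eq:
  assumes "t \<in> {0..1}"
  shows "x0 t = (if t \<le> 1/4 then 2 * t else if t \<le> 1/2 then t + 1/4 else (t + 1) / 2)"
  unfolding x0_def
proof (rule induced_eqI[OF _ assms])
  fix \<omega>
  obtain i j k \<eta> where w: "\<omega> = cat [i, j, k] \<eta>" by (rule cantor_cases3)
  show "rho2 (prefix_replacement [([d0, d0], [d0]), ([d0, d1], [d1, d0]), ([d1], [d1, d1])] \<omega>) =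
      (if rho2 \<omega> \<le> 1/4 then 2 * rho2 \<omega> else if rho2 \<omega> \<le> 1/2 then rho2 \<omega> + 1/4 else (rho2 \<omega> + 1) / 2)"
    using rho2_bounds[of \<eta>] unfolding w
    by (cases i; cases j; cases k)
      (auto simp: prefix_replacement_def cat_Cons2 cat_single_eq_iff rho2_cat1 add_divide_distrib)
qed

lemma x1_eq:
  assumes "t \<in> {0..1}"
  shows "x1 t = (if t \<le> 1/2 then t else if t \<le> 5/8 then 2 * t - 1/2
     else if t \<le> 3/4 then t + 1/8 else (t + 1) / 2)"
  unfolding x1_def
proof (rule induced_eqI[OF _ assms])
  fix \<omega>
  obtain i j k \<eta> where w: "\<omega> = cat [i, j, k] \<eta>" by (rule cantor_cases3)
  show "rho2 (prefix_replacement [([d0], [d0]), ([d1, d0, d0], [d1, d0]), ([d1, d0, d1], [d1, d1, d0]),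
      ([d1, d1], [d1, d1, d1])] \<omega>) =
      (if rho2 \<omega> \<le> 1/2 then rho2 \<omega> else if rho2 \<omega> \<le> 5/8 then 2 * rho2 \<omega> - 1/2
     else if rho2 \<omega> \<le> 3/4 then rho2 \<omega> + 1/8 else (rho2 \<omega> + 1) / 2)"
    using rho2_bounds[of \<eta>] unfolding w
    by (cases i; cases j; cases k)
      (auto simp: prefix_replacement_def cat_Cons2 cat_single_eq_iff rho2_cat1 add_divide_distrib)
qed

lemma induced_outside: "t \<notin> {0..1} \<Longrightarrow> induced \<phi> t = t"
  unfolding induced_def by (rule if_not_P)

lemma Homeo_mem_strict_monoI:
  assumes "\<And>s t. s < t \<Longrightarrow> s \<in> {0..1} \<Longrightarrow> t \<in> {0..1} \<Longrightarrow> f s < f t"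
    and "f 0 = 0" "f 1 = 1"
    and "\<And>t. t \<in> {0..1} \<Longrightarrow> g t \<in> {0..1} \<and> f (g t) = t"
    and "\<And>t. t \<notin> {0..1} \<Longrightarrow> f t = (t::real)"
  shows "f \<in> carrier Homeo"
proof (rule Homeo_memI)
  have into: "f t \<in> {0..1}" if "t \<in> {0..1}" for t
    using assms(1)[of 0 t] assms(1)[of t 1] assms(2,3) that
    by (cases "t = 0"; cases "t = 1") auto
  show "strict_mono f"
  proof (rule strict_monoI)
    fix s t :: real assume "s < t"
    then show "f s < f t"
      using assms(1)[of s t] into[of s] into[of t] assms(5)[of s] assms(5)[of t]
      by (cases "s \<in> {0..1}"; cases "t \<in> {0..1}") auto
  qed
  show "surj f" unfolding surj_def using assms(4,5) by metis
qed (rule assms(5))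

lemma x0_Homeo: "x0 \<in> carrier Homeo"
proof (rule Homeo_mem_strict_monoI[where g = "\<lambda>t. if t \<le> 1/2 then t / 2 else if t \<le> 3/4 then t - 1/4 else 2 * t - 1"])
  show "x0 t = t" if "t \<notin> {0..1}" for t using that unfolding x0_def by (rule induced_outside)
qed (auto simp: x0_eq)

lemma x1_Homeo: "x1 \<in> carrier Homeo"
proof (rule Homeo_mem_strict_monoI[where g = "\<lambda>t. if t \<le> 1/2 then t else if t \<le> 3/4 then t / 2 + 1/4
      else if t \<le> 7/8 then t - 1/8 else 2 * t - 1"])
  show "x1 t = t" if "t \<notin> {0..1}" for t using that unfolding x1_def by (rule induced_outside)
qed (auto simp: x1_eq)

lemma x2_Homeo: "x2 \<in> carrier Homeo"
  unfolding x2_def by (intro Homeo.m_closed Homeo.inv_closed x0_Homeo x1_Homeo)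

section \<open>Explicit formulas for \<open>x\<close> and \<open>y\<close>\<close>

definition gx :: "real \<Rightarrow> real" where
  "gx = x0 \<otimes>\<^bsub>Homeo\<^esub> x1 \<otimes>\<^bsub>Homeo\<^esub> hinv x2 \<otimes>\<^bsub>Homeo\<^esub> hinv x0"

definition gy :: "real \<Rightarrow> real" where
  "gy = x0 \<otimes>\<^bsub>Homeo\<^esub> x1 [^]\<^bsub>Homeo\<^esub> (-2::int)"

lemma B_eq: "B = generate Homeo {gx, gy}"
  by (simp only: B_def gx_def gy_def)

lemma gx_Homeo: "gx \<in> carrier Homeo"
  unfolding gx_def by (intro Homeo.m_closed Homeo.inv_closed x0_Homeo x1_Homeo x2_Homeo)

lemma gy_Homeo: "gy \<in> carrier Homeo"
  unfolding gy_def by (intro Homeo.m_closed Homeo.int_pow_closed x0_Homeo x1_Homeo)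

text \<open>No inverse is computed: \<open>x0 (x1 (gx t)) = x1 (x0 t)\<close> characterises
  \<open>gx t\<close>, and the claimed value satisfies this relation. For \<open>gy\<close> the
  relation is \<open>x1 (x1 (gy t)) = x0 t\<close>.\<close>

lemma gx_eq:
  assumes "t \<in> {0..1}"
  shows "gx t = (if t \<le> 1/4 then t else if t \<le> 3/8 then 2 * t - 1/4 else if t \<le> 1/2 then t + 1/8
     else if t \<le> 3/4 then t / 2 + 3/8 else t)" (is "_ = ?g")
proof -
  have "x0 (x1 ((hinv x0) s)) = x2 s" for s
    by (simp add: x2_def)
  then have "x0 (x1 (gx t)) = x2 (x0 (gx t))"
    using x0_Homeo by (metis Homeo_inv_apply(2))
  also have "\<dots> = x1 (x0 t)"
    using x0_Homeo x2_Homeo by (simp add: gx_def)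
  also have "\<dots> = x0 (x1 ?g)"
    using assms by (auto simp: x0_eq x1_eq)
  finally show ?thesis using x0_Homeo x1_Homeo by (simp add: Homeo_eq_iff)
qed

lemma gy_eq:
  assumes "t \<in> {0..1}"
  shows "gy t = (if t \<le> 1/4 then 2 * t else if t \<le> 3/4 then t / 4 + 7/16
     else if t \<le> 7/8 then t - 1/8 else 2 * t - 1)" (is "_ = ?g")
proof -
  have pow: "x1 [^]\<^bsub>Homeo\<^esub> (2::int) = x1 \<circ> x1"
    using x1_Homeo by (simp add: Homeo.int_pow_mult[of x1 1 1, simplified] Homeo.int_pow_1)
  have "x1 (x1 (gy t)) = x0 t"
  proof -
    have "(x1 [^]\<^bsub>Homeo\<^esub> (2::int)) (gy t) = x0 t"
      using x1_Homeo unfolding gy_def Homeo.int_pow_neg[OF x1_Homeo]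
      by (simp del: Homeo.int_pow_closed add: Homeo.int_pow_closed[OF x1_Homeo])
    then show ?thesis unfolding pow by simp
  qed
  also have "\<dots> = x1 (x1 ?g)"
    using assms by (auto simp: x0_eq x1_eq)
  finally show ?thesis using x1_Homeo by (simp add: Homeo_eq_iff)
qed

text \<open>The formula is that of \<open>\<psi>\<inverse> \<circ> y \<circ> \<psi>\<close>; the same conjugation leaves \<open>x\<close> unchanged.\<close>

definition fy :: "real \<Rightarrow> real" where
  "fy t = (if t \<notin> {0..1} then t else if t \<le> 1/4 then 2 * t else if t \<le> 3/8 then t / 2 + 3/8
     else if t \<le> 1/2 then t / 4 + 15/32 else if t \<le> 3/4 then t / 8 + 17/32
     else if t \<le> 7/8 then t - 1/8 else 2 * t - 1)"

lemma fy_Homeo: "fy \<in> carrier Homeo"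
  by (rule Homeo_mem_strict_monoI[where g = "\<lambda>t. if t \<le> 1/2 then t / 2 else if t \<le> 9/16 then 2 * t - 3/4
      else if t \<le> 19/32 then 4 * t - 15/8 else if t \<le> 5/8 then 8 * t - 17/4
      else if t \<le> 3/4 then t + 1/8 else t / 2 + 1/2"])
    (auto simp: fy_def field_simps)

lemma interval_insert_disjoint:
  "p < q \<Longrightarrow> {p<..<q} \<inter> insert a S = {} \<longleftrightarrow> (q \<le> a \<or> a \<le> p) \<and> {p<..<q} \<inter> S = {}" for p q :: real
  by auto

text \<open>A version of \<open>affine_off\<close> on a subinterval, so that a formula can be
  checked piece by piece from left to right.\<close>

definition affine_between :: "real \<Rightarrow> real \<Rightarrow> real set \<Rightarrow> (real \<Rightarrow> real) \<Rightarrow> bool" where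
  "affine_between a b S f \<longleftrightarrow> (\<forall>p q. a \<le> p \<and> p < q \<and> q \<le> b \<and> {p<..<q} \<inter> S = {} \<longrightarrow>
     (\<exists>(k::int) c. \<forall>t\<in>{p..q}. f t = 2 powi k * t + c))"

lemma affine_between_piece:
  assumes "\<And>t. a \<le> t \<Longrightarrow> t \<le> b \<Longrightarrow> f t = 2 powi k * t + c" shows "affine_between a b S f"
  unfolding affine_between_def using assms by (metis atLeastAtMost_iff order_trans)

lemma affine_between_insert:
  assumes "\<And>t. a \<le> t \<Longrightarrow> t \<le> b \<Longrightarrow> f t = 2 powi k * t + c" "affine_between b d S f"
  shows "affine_between a d (insert b S) f"
  unfolding affine_between_def
proof (intro allI impI, elim conjE)
  fix p q assume *: "a \<le> p" "p < q" "q \<le> d" "{p<..<q} \<inter> insert b S = {}"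
  then consider "q \<le> b" | "b \<le> p" by (auto simp: interval_insert_disjoint)
  then show "\<exists>(k::int) c. \<forall>t\<in>{p..q}. f t = 2 powi k * t + c"
  proof cases
    case 1
    then have "\<forall>t\<in>{p..q}. f t = 2 powi k * t + c" using * assms(1) by simp
    then show ?thesis by blast
  next
    case 2
    then show ?thesis using * assms(2) unfolding affine_between_def by blast
  qed
qed

lemma gx_affine_off: "affine_off {1/4, 3/8, 1/2, 3/4} gx"
  unfolding affine_off_def affine_between_def[symmetric]
  by (rule affine_between_insert[of _ _ _ 0 0] affine_between_insert[of _ _ _ 1 "-1/4"]
      affine_between_insert[of _ _ _ 0 "1/8"] affine_between_insert[of _ _ _ "-1" "3/8"]
      affine_between_piece[of _ _ _ 0 0], force simp: gx_eq power_int_minus)+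

lemma gy_affine_off: "affine_off {1/4, 3/4, 7/8} gy"
  unfolding affine_off_def affine_between_def[symmetric]
  by (rule affine_between_insert[of _ _ _ 1 0] affine_between_insert[of _ _ _ "-2" "7/16"]
      affine_between_insert[of _ _ _ 0 "-1/8"] affine_between_piece[of _ _ _ 1 "-1"],
      force simp: gy_eq power_int_minus)+

lemma fy_affine_off: "affine_off {1/4, 3/8, 1/2, 3/4, 7/8} fy"
  unfolding affine_off_def affine_between_def[symmetric]
  by (rule affine_between_insert[of _ _ _ 1 0] affine_between_insert[of _ _ _ "-1" "3/8"]
      affine_between_insert[of _ _ _ "-2" "15/32"] affine_between_insert[of _ _ _ "-3" "17/32"]
      affine_between_insert[of _ _ _ 0 "-1/8"] affine_between_piece[of _ _ _ 1 "-1"],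
      force simp: fy_def power_int_minus)+

lemma eighths_dyadic: "1/4 \<in> dyadic" "3/8 \<in> dyadic" "1/2 \<in> dyadic" "3/4 \<in> dyadic" "7/8 \<in> dyadic"
  using dyadic_frac[of 1 2] dyadic_frac[of 3 3] dyadic_frac[of 1 1] dyadic_frac[of 3 2] dyadic_frac[of 7 3]
  by simp_all

lemma gx_F: "gx \<in> Thompson_F"
  unfolding Thompson_F_iff using gx_Homeo gx_affine_off eighths_dyadic
  by (intro conjI exI[of _ "{1/4, 3/8, 1/2, 3/4}"]) auto

lemma gy_F: "gy \<in> Thompson_F"
  unfolding Thompson_F_iff using gy_Homeo gy_affine_off eighths_dyadic
  by (intro conjI exI[of _ "{1/4, 3/4, 7/8}"]) auto

lemma fy_F: "fy \<in> Thompson_F"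
  unfolding Thompson_F_iff using fy_Homeo fy_affine_off eighths_dyadic
  by (intro conjI exI[of _ "{1/4, 3/8, 1/2, 3/4, 7/8}"]) auto

text \<open>All source prefixes are refined to length three, the free letter \<open>k\<close>
  included, so that one case split on three digits covers every point.\<close>

lemma gx_cat:
  "gx (rho2 (cat [d0, d0, k] \<eta>)) = rho2 (cat [d0, d0, k] \<eta>)"
  "gx (rho2 (cat [d0, d1, d0] \<eta>)) = rho2 (cat [d0, d1] \<eta>)"
  "gx (rho2 (cat [d0, d1, d1] \<eta>)) = rho2 (cat [d1, d0, d0] \<eta>)"
  "gx (rho2 (cat [d1, d0, k] \<eta>)) = rho2 (cat [d1, d0, d1, k] \<eta>)"
  "gx (rho2 (cat [d1, d1, k] \<eta>)) = rho2 (cat [d1, d1, k] \<eta>)"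
  using rho2_bounds[of \<eta>] by (auto simp: gx_eq rho2_cat add_divide_distrib of_bool_def)

lemma gy_cat:
  "gy (rho2 (cat [d0, d0, k] \<eta>)) = rho2 (cat [d0, k] \<eta>)"
  "gy (rho2 (cat [d0, d1, k] \<eta>)) = rho2 (cat [d1, d0, d0, d0, k] \<eta>)"
  "gy (rho2 (cat [d1, d0, k] \<eta>)) = rho2 (cat [d1, d0, d0, d1, k] \<eta>)"
  "gy (rho2 (cat [d1, d1, d0] \<eta>)) = rho2 (cat [d1, d0, d1] \<eta>)"
  "gy (rho2 (cat [d1, d1, d1] \<eta>)) = rho2 (cat [d1, d1] \<eta>)"
  using rho2_bounds[of \<eta>] by (auto simp: gy_eq rho2_cat add_divide_distrib of_bool_def)

lemma fy_cat:
  "fy (rho2 (cat [d0, d0, k] \<eta>)) = rho2 (cat [d0, k] \<eta>)"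
  "fy (rho2 (cat [d0, d1, d0] \<eta>)) = rho2 (cat [d1, d0, d0, d0] \<eta>)"
  "fy (rho2 (cat [d0, d1, d1] \<eta>)) = rho2 (cat [d1, d0, d0, d1, d0] \<eta>)"
  "fy (rho2 (cat [d1, d0, k] \<eta>)) = rho2 (cat [d1, d0, d0, d1, d1, k] \<eta>)"
  "fy (rho2 (cat [d1, d1, d0] \<eta>)) = rho2 (cat [d1, d0, d1] \<eta>)"
  "fy (rho2 (cat [d1, d1, d1] \<eta>)) = rho2 (cat [d1, d1] \<eta>)"
  using rho2_bounds[of \<eta>] by (auto simp: fy_def rho2_cat add_divide_distrib of_bool_def)

text \<open>In every row of the table the two prefixes drive the transducer to the same state, and
  their outputs again form a row of the table. For \<open>psi_fy\<close> the outputs of a row of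
  \<open>fy\<close> match a row of \<open>gy\<close>.\<close>

lemma psi_gx: "psi (gx t) = gx (psi t)"
proof (cases "t \<in> {0..1}")
  case True
  then obtain \<omega> where w: "rho2 \<omega> = t" by (rule rho2_surj)
  obtain i j k \<eta> where ijk: "\<omega> = cat [i, j, k] \<eta>" by (rule cantor_cases3)
  show ?thesis
    unfolding w[symmetric] ijk
    by (cases i; cases j; cases k) (simp_all add: gx_cat psi_rho2 run_cat)
next
  case False
  then show ?thesis
    using Homeo_dyadic_outside[OF gx_Homeo] Homeo_dyadic_outside[OF psi_Homeo] by simp
qed

lemma psi_fy: "psi (fy t) = gy (psi t)"
proof (cases "t \<in> {0..1}")
  case True
  then obtain \<omega> where w: "rho2 \<omega> = t" by (rule rho2_surj)
  obtain i j k \<eta> where ijk: "\<omega> = cat [i, j, k] \<eta>" by (rule cantor_cases3)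
  show ?thesis
    unfolding w[symmetric] ijk
    by (cases i; cases j; cases k) (simp_all add: gy_cat fy_cat psi_rho2 run_cat)
next
  case False
  then show ?thesis
    using Homeo_dyadic_outside[OF gy_Homeo] Homeo_dyadic_outside[OF psi_Homeo]
      Homeo_dyadic_outside[OF fy_Homeo] by simp
qed

lemma gx_conj_F: "gx \<in> conj_F psi" and gy_conj_F: "gy \<in> conj_F psi"
  unfolding conj_F_iff using gx_Homeo gx_F psi_gx gy_Homeo fy_F psi_fy by blast+

lemma B_subset: "B \<subseteq> Thompson_F \<inter> conj_F psi"
proof -
  have "subgroup (Thompson_F \<inter> conj_F psi) Homeo"
    by (intro Homeo.subgroups_Inter_pair subgroup_Thompson_F subgroup_conj_F)
  then show ?thesis
    unfolding B_eq using gx_F gy_F gx_conj_F gy_conj_F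
    by (intro Homeo.generate_subgroup_incl) auto
qed


section \<open>Heights of dyadic points\<close>

text \<open>The types are chosen such that the image under \<open>\<psi>\<close> of an interval with state \<open>s\<close> has type \<open>s\<close>. The type
  \<^const>\<open>StD\<close> does not occur; its values here and below merely keep the formulas uniform.\<close>

fun child :: "state \<Rightarrow> bool \<Rightarrow> state" where
  "child Rho i = (if i then R else L)"
| "child L i = (if i then StA else L)"
| "child R i = (if i then R else StB)"
| "child StA i = (if i then StC else StA)"
| "child StB i = (if i then StB else StC)"
| "child StC i = (if i then StB else StA)"
| "child StD i = (if i then StB else StC)"

text \<open>Reading \<^const>\<open>StA\<close> as an opening bracket, \<^const>\<open>StB\<close> as a closing one and \<^const>\<open>StC\<close> as
  a balanced word, the height of a dyadic point is the bracket depth there, normalised to \<open>0\<close> at \<open>1/2\<close>.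
  Passing to a half changes the height of the midpoint by \<open>incr\<close>.\<close>

fun incr :: "state \<Rightarrow> bool \<Rightarrow> int" where
  "incr Rho i = -1"
| "incr L i = (if i then 1 else -1)"
| "incr R i = (if i then -1 else 1)"
| "incr StA i = (if i then 1 else 0)"
| "incr StB i = (if i then 0 else 1)"
| "incr StC i = 0"
| "incr StD i = (if i then 0 else 1)"

fun ctype :: "state \<Rightarrow> bool list \<Rightarrow> state" where
  "ctype s [] = s"
| "ctype s (i # u) = ctype (child s i) u"

fun hgt :: "state \<Rightarrow> bool list \<Rightarrow> int" where
  "hgt s [] = 0"
| "hgt s (i # u) = incr s i + hgt (child s i) u"

lemma ctype_append: "ctype s (u @ w) = ctype (ctype s u) w"
  by (induction u arbitrary: s) auto

lemma hgt_append: "hgt s (u @ w) = hgt s u + hgt (ctype s u) w"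
  by (induction u arbitrary: s) auto

text \<open>The midpoint of the standard interval of a word. Each dyadic point of (0, 1) is the
  midpoint for exactly one word, so words serve as coordinates of these points.\<close>

fun mp :: "bool list \<Rightarrow> real" where
  "mp [] = 1 / 2"
| "mp (i # u) = (of_bool i + mp u) / 2"

lemma mp_bounds: "0 < mp u" "mp u < 1"
  by (induction u) (auto simp: of_bool_def)

lemma mp_append: "mp (u @ w) = val u + mp w / 2 ^ length u"
  by (induction u) (auto simp: field_simps)

lemma mp_eq: "mp u = val u + 1 / 2 ^ Suc (length u)"
  using mp_append[of u "[]"] by simp

lemma mp_inj: "mp u = mp v \<Longrightarrow> u = v"
proof (induction u arbitrary: v)
  case Nil
  show ?case
  proof (cases v)
    case (Cons i w)
    then show ?thesis using Nil mp_bounds[of w] by (cases i) auto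
  qed simp
next
  case (Cons i u)
  obtain j w where v: "v = j # w"
    using Cons.prems mp_bounds[of u] by (cases v) (auto simp: of_bool_def split: if_splits)
  have "i = j"
    using Cons.prems mp_bounds[of u] mp_bounds[of w] unfolding v by (cases i; cases j) auto
  then show ?case using Cons.prems Cons.IH unfolding v by auto
qed

definition inner_dyadic :: "real set" where
  "inner_dyadic = dyadic \<inter> {0<..<1}"

lemma val_dyadic: "val u \<in> dyadic"
  using val_dyadic_int[of u] by (metis dyadic_frac of_int_of_nat_eq)

lemma half_power_dyadic: "1 / 2 ^ n \<in> dyadic"
  using dyadic_frac[of 1 n] by simp

lemma mp_inner: "mp u \<in> inner_dyadic"
  unfolding inner_dyadic_def using mp_bounds by (auto simp: mp_eq intro!: dyadic_add val_dyadic half_power_dyadic simp del: power_Suc)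

lemma inner_dyadicE:
  assumes "t \<in> inner_dyadic" obtains u where "t = mp u"
proof -
  have "\<exists>u. of_int m / 2 ^ n = mp u" if "0 < real_of_int m / 2 ^ n" "real_of_int m / 2 ^ n < 1" for m n
    using that
  proof (induction n arbitrary: m)
    case 0 then show ?case by simp
  next
    case (Suc n)
    let ?t = "real_of_int m / 2 ^ Suc n"
    consider "?t = 1/2" | "?t < 1/2" | "?t > 1/2" by linarith
    then show ?case
    proof cases
      case 1 then show ?thesis by (metis mp.simps(1))
    next
      case 2
      then have "0 < real_of_int m / 2 ^ n" "real_of_int m / 2 ^ n < 1" using Suc.prems by auto
      then obtain u where "real_of_int m / 2 ^ n = mp u" using Suc.IH by blast
      then have "?t = mp (d0 # u)" by simp
      then show ?thesis by blast
    next
      case 3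
      have eq: "real_of_int (m - 2 ^ n) / 2 ^ n = 2 * ?t - 1" by (simp add: diff_divide_distrib)
      have "0 < real_of_int (m - 2 ^ n) / 2 ^ n" "real_of_int (m - 2 ^ n) / 2 ^ n < 1"
        unfolding eq using 3 Suc.prems by linarith+
      then obtain u where "real_of_int (m - 2 ^ n) / 2 ^ n = mp u" using Suc.IH by blast
      then have "?t = mp (d1 # u)" using eq by simp
      then show ?thesis by blast
    qed
  qed
  moreover obtain m n where "t = of_int m / 2 ^ n" "0 < t" "t < 1"
    using assms unfolding inner_dyadic_def dyadic_def by auto
  ultimately show ?thesis using that by blast
qed

definition height :: "real \<Rightarrow> int" where
  "height t = hgt Rho (THE u. mp u = t)"

lemma height_mp [simp]: "height (mp u) = hgt Rho u"
proof -
  have "(THE v. mp v = mp u) = u" using mp_inj by blast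
  then show ?thesis by (simp add: height_def)
qed

text \<open>The tail that turns a prefix into an expansion of its midpoint, so that prefix
  replacements act on midpoints by replacing the same prefixes.\<close>

definition mid_seq :: cantor where
  "mid_seq = cat [d1] (const_seq d0)"

lemma rho2_mid_seq: "rho2 (cat u mid_seq) = mp u"
  by (simp add: rho2_cat mid_seq_def rho2_cat1 mp_eq)

lemma prefix_replacement_mp:
  assumes "\<And>\<eta>. g (rho2 (cat v \<eta>)) = rho2 (cat v' \<eta>)"
  shows "g (mp (v @ w)) = mp (v' @ w)"
  using assms[of "cat w mid_seq"] by (simp add: rho2_mid_seq flip: cat_append)

lemma inner_dyadic_Thompson_F:
  assumes "g \<in> Thompson_F" shows "g t \<in> inner_dyadic \<longleftrightarrow> t \<in> inner_dyadic"
  using Thompson_F_dyadic_iff[OF assms] Homeo_Icc[OF Thompson_F_Homeo[OF assms]]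
  by (auto simp: inner_dyadic_def)

lemma list_cases3:
  obtains "u = []" | i where "u = [i]" | i j where "u = [i, j]" | i j k w where "u = [i, j, k] @ w"
proof (cases u)
  case (Cons i v)
  then show ?thesis using that
  proof (cases v)
    case (Cons j v')
    then show ?thesis using that \<open>u = i # v\<close> by (cases v') auto
  qed auto
qed

lemma height_gx: assumes "t \<in> inner_dyadic" shows "height (gx t) = height t"
proof -
  obtain u where t: "t = mp u" using assms by (rule inner_dyadicE)
  \<comment> \<open>Words shorter than the prefixes of the table are not covered by it and are
    checked one by one.\<close>
  have small: "gx (mp []) = mp [d1, d0]" "gx (mp [d0]) = mp [d0]" "gx (mp [d1]) = mp [d1]"
    "gx (mp [d0, d0]) = mp [d0, d0]" "gx (mp [d0, d1]) = mp []" "gx (mp [d1, d0]) = mp [d1, d0, d1]"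
    "gx (mp [d1, d1]) = mp [d1, d1]"
    by (simp_all add: gx_eq)
  show ?thesis
  proof (cases u rule: list_cases3)
    case (4 i j k w)
    show ?thesis
      unfolding t 4 by (cases i; cases j; cases k)
        (simp_all only: prefix_replacement_mp[OF gx_cat(1)] prefix_replacement_mp[OF gx_cat(2)]
          prefix_replacement_mp[OF gx_cat(3)] prefix_replacement_mp[OF gx_cat(4)]
          prefix_replacement_mp[OF gx_cat(5)] height_mp, simp_all)
  next
    case (2 i)
    show ?thesis unfolding t 2 by (cases i) (simp_all only: small height_mp)
  next
    case (3 i j)
    show ?thesis unfolding t 3 by (cases i; cases j) (simp_all only: small height_mp, simp_all)
  qed (simp only: t small height_mp, simp)
qed

lemma height_gy: assumes "t \<in> inner_dyadic" shows "height (gy t) = height t + 1"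
proof -
  obtain u where t: "t = mp u" using assms by (rule inner_dyadicE)
  have small: "gy (mp []) = mp [d1, d0, d0]" "gy (mp [d0]) = mp []" "gy (mp [d1]) = mp [d1, d0]"
    "gy (mp [d0, d0]) = mp [d0]" "gy (mp [d0, d1]) = mp [d1, d0, d0, d0]"
    "gy (mp [d1, d0]) = mp [d1, d0, d0, d1]" "gy (mp [d1, d1]) = mp [d1]"
    by (simp_all add: gy_eq)
  show ?thesis
  proof (cases u rule: list_cases3)
    case (4 i j k w)
    show ?thesis
      unfolding t 4 by (cases i; cases j; cases k)
        (simp_all only: prefix_replacement_mp[OF gy_cat(1)] prefix_replacement_mp[OF gy_cat(2)]
          prefix_replacement_mp[OF gy_cat(3)] prefix_replacement_mp[OF gy_cat(4)]
          prefix_replacement_mp[OF gy_cat(5)] height_mp, simp_all)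
  next
    case (2 i)
    show ?thesis unfolding t 2 by (cases i) (simp_all only: small height_mp, simp_all)
  next
    case (3 i j)
    show ?thesis unfolding t 3 by (cases i; cases j) (simp_all only: small height_mp, simp_all)
  qed (simp only: t small height_mp, simp)
qed

section \<open>Elements of the intersection shift heights by a constant\<close>

text \<open>Heights at the two ends of an interval, relative to its midpoint; only the outer end of an
  interval of type \<^const>\<open>Rho\<close>, \<^const>\<open>L\<close> or \<^const>\<open>R\<close> has none.\<close>

fun left_hgt :: "state \<Rightarrow> int" where
  "left_hgt R = 1" | "left_hgt StA = -1" | "left_hgt StC = -1" | "left_hgt _ = 0"

fun right_hgt :: "state \<Rightarrow> int" where
  "right_hgt L = 1" | "right_hgt StB = -1" | "right_hgt StC = -1" | "right_hgt StD = -1" | "right_hgt _ = 0"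

lemma typ_outer_left: "ctype Rho u \<in> {Rho, L} \<Longrightarrow> val u = 0"
proof (induction u rule: rev_induct)
  case (snoc i u)
  then show ?case by (cases "ctype Rho u"; cases i) (auto simp: ctype_append val_append)
qed simp

lemma typ_outer_right: "ctype Rho u \<in> {Rho, R} \<Longrightarrow> val u + 1 / 2 ^ length u = 1"
proof (induction u rule: rev_induct)
  case (snoc i u)
  then show ?case by (cases "ctype Rho u"; cases i) (auto simp: ctype_append val_append field_simps)
qed simp

lemma height_left_end:
  "ctype Rho u \<notin> {Rho, L} \<Longrightarrow> height (val u) = hgt Rho u + left_hgt (ctype Rho u)"
proof (induction u rule: rev_induct)
  case (snoc i u)
  show ?case
  proof (cases i)
    case True
    then have "val (u @ [i]) = mp u" by (simp add: mp_eq val_append)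
    then show ?thesis using snoc.prems True by (cases "ctype Rho u") (simp_all add: ctype_append hgt_append)
  next
    case False
    then have "val (u @ [i]) = val u" by (simp add: val_append)
    then show ?thesis using snoc False by (cases "ctype Rho u") (simp_all add: ctype_append hgt_append)
  qed
qed simp

lemma height_right_end:
  "ctype Rho u \<notin> {Rho, R} \<Longrightarrow> height (val u + 1 / 2 ^ length u) = hgt Rho u + right_hgt (ctype Rho u)"
proof (induction u rule: rev_induct)
  case (snoc i u)
  show ?case
  proof (cases i)
    case False
    then have "val (u @ [i]) + 1 / 2 ^ length (u @ [i]) = mp u" by (simp add: mp_eq val_append)
    then show ?thesis using snoc.prems False by (cases "ctype Rho u") (simp_all add: ctype_append hgt_append)
  next
    case True
    then have "val (u @ [i]) + 1 / 2 ^ length (u @ [i]) = val u + 1 / 2 ^ length u"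
      by (simp add: val_append field_simps)
    then show ?thesis using snoc True by (cases "ctype Rho u") (simp_all add: ctype_append hgt_append)
  qed
qed simp

definition shifts_on :: "(real \<Rightarrow> real) \<Rightarrow> bool list \<Rightarrow> int \<Rightarrow> bool" where
  "shifts_on g u k \<longleftrightarrow>
     (\<forall>\<eta>. rho2 (cat u \<eta>) \<in> inner_dyadic \<longrightarrow> height (g (rho2 (cat u \<eta>))) = height (rho2 (cat u \<eta>)) + k)"

text \<open>By \<open>hgt_append\<close>, heights relative to the midpoint of an interval depend
  only on its type; at the two ends this is the content of \<open>left_hgt\<close> and
  \<open>right_hgt\<close>.\<close>

lemma shifts_on_prefix_replacement:
  assumes g: "\<And>\<eta>. g (rho2 (cat v \<eta>)) = rho2 (cat v' \<eta>)" and ctype: "ctype Rho v' = ctype Rho v"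
  shows "shifts_on g v (hgt Rho v' - hgt Rho v)"
  unfolding shifts_on_def
proof (intro allI impI)
  fix \<eta> assume t: "rho2 (cat v \<eta>) \<in> inner_dyadic"
  have r: "rho2 (cat v \<eta>) = val v + rho2 \<eta> / 2 ^ length v" by (rule rho2_cat)
  have gr: "g (rho2 (cat v \<eta>)) = val v' + rho2 \<eta> / 2 ^ length v'" unfolding g by (rule rho2_cat)
  consider "rho2 \<eta> = 0" | "rho2 \<eta> = 1" | "rho2 \<eta> \<in> {0<..<1}" using rho2_bounds[of \<eta>] by fastforce
  then show "height (g (rho2 (cat v \<eta>))) = height (rho2 (cat v \<eta>)) + (hgt Rho v' - hgt Rho v)"
  proof cases
    case 1
    \<comment> \<open>Those types touch 0, and 0 has no height.\<close>
    then have "ctype Rho v \<notin> {Rho, L}" using typ_outer_left[of v] t unfolding r inner_dyadic_def by auto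
    then show ?thesis unfolding gr unfolding r 1 using ctype by (simp add: height_left_end)
  next
    case 2
    then have "ctype Rho v \<notin> {Rho, R}" using typ_outer_right[of v] t unfolding r inner_dyadic_def by auto
    then show ?thesis unfolding gr unfolding r 2 using ctype by (simp add: height_right_end)
  next
    case 3
    have "rho2 \<eta> = 2 powi (int (length v)) * (rho2 (cat v \<eta>) - val v)" unfolding r by simp
    then have "rho2 \<eta> \<in> dyadic"
      using t val_dyadic unfolding inner_dyadic_def by (metis Int_iff dyadic_diff dyadic_powi_mult)
    then obtain w where w: "rho2 \<eta> = mp w" using 3 inner_dyadicE unfolding inner_dyadic_def by blast
    show ?thesis unfolding gr unfolding r w mp_append[symmetric] using ctype by (simp add: hgt_append)
  qed
qed

text \<open>The midpoint belongs to both halves, so the two constants agree.\<close>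

lemma shifts_on_children:
  assumes "shifts_on g (u @ [d0]) k0" "shifts_on g (u @ [d1]) k1"
  shows "\<exists>k. shifts_on g u k"
proof -
  have 0: "rho2 (cat (u @ [d0]) (const_seq d1)) = mp u" and 1: "rho2 (cat (u @ [d1]) (const_seq d0)) = mp u"
    by (simp_all add: rho2_cat val_append mp_eq)
  have "height (g (mp u)) = height (mp u) + k0" "height (g (mp u)) = height (mp u) + k1"
    using assms unfolding shifts_on_def by (metis 0 mp_inner, metis 1 mp_inner)
  then have k: "k1 = k0" by simp
  have "shifts_on g u k0"
    unfolding shifts_on_def
  proof (intro allI impI)
    fix \<eta> assume *: "rho2 (cat u \<eta>) \<in> inner_dyadic"
    obtain i \<theta> where "\<eta> = cat [i] \<theta>" by (rule cantor_cases)
    then have "cat u \<eta> = cat (u @ [i]) \<theta>" by (simp add: cat_append)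
    then show "height (g (rho2 (cat u \<eta>))) = height (rho2 (cat u \<eta>)) + k0"
      using assms * unfolding shifts_on_def k by (cases i) auto
  qed
  then show ?thesis by blast
qed

lemma shifts_on_everywhere:
  assumes "\<And>u. length u \<ge> N \<Longrightarrow> \<exists>k. shifts_on g u k"
  shows "\<exists>k. shifts_on g u k"
proof (induction "N - length u" arbitrary: u)
  case 0
  then show ?case using assms by simp
next
  case (Suc n)
  then have "n = N - length (u @ [i])" for i by simp
  then have "\<exists>k. shifts_on g (u @ [i]) k" for i using Suc.hyps(1) by blast
  then show ?case using shifts_on_children by blast
qed

section \<open>Recovering a state from the map that it computes\<close>

lemma run_zeros: "s \<noteq> StD \<Longrightarrow> run s (const_seq d0) = const_seq d0"
proof
  fix n
  assume "s \<noteq> StD"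
  then show "run s (const_seq d0) n = const_seq d0 n"
  proof (induction n arbitrary: s rule: less_induct)
    case (less n)
    define s' where "s' = snd (transition s d0)"
    have s': "s' \<noteq> StD" using less.prems by (cases s) (auto simp: s'_def)
    have v: "fst (transition s d0) \<in> {[d0], [d0, d0]}" using less.prems by (cases s) auto
    have "run s (const_seq d0) n = cat (fst (transition s d0)) (run s' (const_seq d0)) n"
      using run_cat1[of s d0 "const_seq d0"] by (simp add: s'_def)
    also have "\<dots> = d0"
      using v less.IH[of "n - 1" s'] less.IH[of "n - 2" s'] s'
      by (cases n; cases "n - 1") (auto simp: cat_def const_seq_def nth_Cons')
    finally show ?case by (simp add: const_seq_def)
  qed
qed

lemma run_ones: "run s (const_seq d1) = const_seq d1"
proof
  fix n
  show "run s (const_seq d1) n = const_seq d1 n"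
  proof (induction n arbitrary: s)
    case 0
    have c: "const_seq d1 = cat [d1, d1] (const_seq d1)" by (simp add: cat_Cons2)
    show ?case by (subst c, subst run_cat) (cases s; simp add: cat_def const_seq_def)
  next
    case (Suc n)
    show ?case
    proof (cases "s = StC")
      case True
      have c: "const_seq d1 = cat [d1, d1] (const_seq d1)" by (simp add: cat_Cons2)
      have "run s (const_seq d1) = cat [d1] (run StB (const_seq d1))"
        by (subst c, subst run_cat) (simp add: True)
      then show ?thesis using Suc[of StB] by (simp add: const_seq_def)
    next
      case False
      have "run s (const_seq d1) = cat (fst (transition s d1)) (run (snd (transition s d1)) (const_seq d1))"
        using run_cat1[of s d1 "const_seq d1"] by simp
      moreover have "fst (transition s d1) = [d1]" using False by (cases s) auto
      ultimately show ?thesis using Suc by (simp add: const_seq_def)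
    qed
  qed
qed

lemma run_StD_zeros: "run StD (const_seq d0) = cat [d0, d1] (const_seq d0)"
  using run_cat1[of StD d0 "const_seq d0"] by (simp add: run_zeros)

lemma rho2_run_zeros:
  "rho2 (run s (const_seq d0)) = (if s = StD then 1 / 4 else 0)"
  by (simp add: run_zeros run_StD_zeros rho2_cat)

lemma rho2_run_determines_state:
  assumes "s \<noteq> StD" "s' \<noteq> StD" and eq: "\<And>\<eta>. rho2 (run s \<eta>) = rho2 (run s' \<eta>)"
  shows "s = s'"
proof -
  have "val (emitted s u) + rho2 (run (final s u) (const_seq d0)) / 2 ^ length (emitted s u) =
      val (emitted s' u) + rho2 (run (final s' u) (const_seq d0)) / 2 ^ length (emitted s' u)" for u
    using eq[of "cat u (const_seq d0)"] by (simp add: run_cat rho2_cat)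
  \<comment> \<open>Two test points suffice: at 001000... the value is 1/8 for \<open>Rho\<close>,
    \<open>L\<close>, \<open>StA\<close> and 1/16 for \<open>R\<close>, \<open>StB\<close>,
    \<open>StC\<close>; at 1011000... the values within each group are distinct.\<close>
  from this[of "[d0, d0, d1]"] this[of "[d1, d0, d1, d1]"] show ?thesis
    using assms(1,2) by (cases s; cases s'; simp add: rho2_run_zeros)
qed

text \<open>Comparison of the ends of the images. If \<open>s'\<close> were \<open>StD\<close>, the
  image would have 3/4 of the length of a standard interval, which is never a power of 2. Otherwise
  both images are standard intervals, hence the words agree, and then the maps and the
  states.\<close>

lemma run_cat_determines_state:
  assumes "s \<noteq> StD" and eq: "\<And>\<eta>. rho2 (cat w (run s' \<eta>)) = rho2 (cat v (run s \<eta>))"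
  shows "w = v \<and> s' = s"
proof -
  define z :: real where "z = (if s' = StD then 1/4 else 0)"
  have e0: "val w + z / 2 ^ length w = val v"
    using eq[of "const_seq d0"] assms(1) by (simp add: rho2_cat rho2_run_zeros z_def)
  have e1: "val w + 1 / 2 ^ length w = val v + 1 / 2 ^ length v"
    using eq[of "const_seq d1"] by (simp add: rho2_cat run_ones)
  have "(1 - z) / 2 ^ length w = 1 / 2 ^ length v"
    using e0 e1 by (simp add: diff_divide_distrib)
  then have *: "(1 - z) * 2 ^ length v = 2 ^ length w" by (simp add: field_simps)
  have s': "s' \<noteq> StD"
  proof
    assume "s' = StD"
    then have "3 * 2 ^ length v = (4 * 2 ^ length w :: real)" using * by (simp add: z_def)
    then have "real (3 * 2 ^ length v) = real (2 ^ (length w + 2))" by simp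
    then have "3 * 2 ^ length v = (2 ^ (length w + 2) :: nat)" by (simp only: of_nat_eq_iff)
    then have "(3::nat) dvd 2 ^ (length w + 2)" by (metis dvd_triv_left)
    then have "(3::nat) dvd 2" by (rule prime_dvd_power[rotated]) simp
    then show False by simp
  qed
  then have z: "z = 0" by (simp add: z_def)
  then have len: "length v = length w" using * by simp
  then have v: "w = v" using e0 z val_inj by simp
  have "rho2 (run s' \<eta>) = rho2 (run s \<eta>)" for \<eta>
    using eq[of \<eta>] v by (simp add: rho2_cat)
  then show ?thesis using v s' assms(1) rho2_run_determines_state by blast
qed

text \<open>In \<open>StD\<close> the letter 1 read in \<open>StC\<close> has written nothing yet,
  so the output is still the word of the interval of type \<open>StC\<close>.\<close>

lemma typ_emitted:
  "ctype Rho (emitted Rho u) = (if final Rho u = StD then StC else final Rho u)"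
proof (induction u rule: rev_induct)
  case (snoc i u)
  then show ?case
    by (cases "final Rho u"; cases i) (auto simp: emitted_append final_append ctype_append)
qed simp

text \<open>State \<open>StD\<close> is excluded because its map is not onto: the image of such a
  cylinder is only a part of the interval of its output.\<close>

definition is_image :: "bool list \<Rightarrow> bool" where
  "is_image v \<longleftrightarrow> (\<exists>u. emitted Rho u = v \<and> final Rho u \<noteq> StD)"

text \<open>The only standard intervals that are not the image of a standard interval are the left halves of
  intervals of type \<^const>\<open>StC\<close>.\<close>

lemma is_image_or_children:
  "is_image v \<or> (is_image (v @ [d0]) \<and> is_image (v @ [d1]))"
proof -
  have ext: "is_image (emitted Rho u @ emitted (final Rho u) w)" if "final (final Rho u) w \<noteq> StD" for u w
    unfolding is_image_def using that by (intro exI[of _ "u @ w"]) (simp add: emitted_append final_append)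
  have "is_image v \<or> (\<exists>u. v = emitted Rho u @ [d0] \<and> final Rho u = StC)"
  proof (induction v rule: rev_induct)
    case Nil
    then show ?case unfolding is_image_def by (auto intro: exI[of _ "[]"])
  next
    case (snoc i v)
    then consider u where "v = emitted Rho u" "final Rho u \<noteq> StD"
      | u where "v = emitted Rho u @ [d0]" "final Rho u = StC" unfolding is_image_def by auto
    then show ?case
    proof cases
      case 1
      show ?thesis
      proof (cases "final Rho u = StC")
        case True
        show ?thesis
        proof (cases i)
          case True
          then show ?thesis using 1 \<open>final Rho u = StC\<close> ext[of u "[d1, d1]"] by simp
        next
          case False
          then show ?thesis using 1 \<open>final Rho u = StC\<close> by auto
        qed
      next
        case False
        then show ?thesis using 1 ext[of u "[i]"] by (cases "final Rho u"; cases i) auto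
      qed
    next
      case 2
      show ?thesis using 2 ext[of u "[d0]"] ext[of u "[d1, d0]"] by (cases i) auto
    qed
  qed
  then show ?thesis
  proof
    assume "\<exists>u. v = emitted Rho u @ [d0] \<and> final Rho u = StC"
    then obtain u where "v = emitted Rho u @ [d0]" "final Rho u = StC" by blast
    \<comment> \<open>The halves 00 and 01 of the missed interval are the outputs of
      \<open>StC\<close> on the inputs 0 and 10.\<close>
    then show ?thesis using ext[of u "[d0]"] ext[of u "[d1, d0]"] by simp
  qed simp
qed

lemma length_emitted_le: "length (emitted s u) \<le> 2 * length u"
proof (induction u arbitrary: s)
  case (Cons i u)
  show ?case using Cons[of "snd (transition s i)"] by (cases s; cases i) auto
qed simp

theorem shifts_height:
  assumes "g \<in> Thompson_F \<inter> conj_F psi"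
  obtains k where "\<And>t. t \<in> inner_dyadic \<Longrightarrow> height (g t) = height t + k"
proof -
  have g: "g \<in> Thompson_F" using assms by blast
  have "\<exists>f\<in>Thompson_F. \<forall>t. psi (f t) = g (psi t)"
    using assms conj_F_iff by simp
  then obtain f where f: "f \<in> Thompson_F" and "\<forall>t. psi (f t) = g (psi t)" by (rule bexE)
  then have fg: "psi (f t) = g (psi t)" for t by simp
  obtain Ng where Ng: "\<And>u. length u \<ge> Ng \<Longrightarrow> \<exists>v. \<forall>\<eta>. g (rho2 (cat u \<eta>)) = rho2 (cat v \<eta>)"
    using Thompson_F_prefix_replacement[OF g] by blast
  obtain Nf where Nf: "\<And>u. length u \<ge> Nf \<Longrightarrow> \<exists>v. \<forall>\<eta>. f (rho2 (cat u \<eta>)) = rho2 (cat v \<eta>)"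
    using Thompson_F_prefix_replacement[OF f] by blast
  \<comment> \<open>A letter of input writes at most two letters, so an output of length
    \<open>2 * Nf\<close> comes from an input of length at least \<open>Nf\<close>.\<close>
  let ?N = "max Ng (2 * Nf)"
  have image: "\<exists>k. shifts_on g v k" if len: "length v \<ge> ?N" and im: "is_image v" for v
  proof -
    obtain u where u: "emitted Rho u = v" "final Rho u \<noteq> StD" using im unfolding is_image_def by blast
    obtain v' where v': "\<And>\<eta>. g (rho2 (cat v \<eta>)) = rho2 (cat v' \<eta>)" using Ng[of v] len by auto
    have "length u \<ge> Nf" using length_emitted_le[of Rho u] u(1) len by simp
    then obtain u' where u': "\<And>\<eta>. f (rho2 (cat u \<eta>)) = rho2 (cat u' \<eta>)" using Nf by blast
    \<comment> \<open>Two descriptions of \<open>g\<close> on the image of the cylinder of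
      \<open>u\<close>: through the prefix replacement of \<open>f\<close>, and through that of
      \<open>g\<close> itself.\<close>
    have "rho2 (cat (emitted Rho u') (run (final Rho u') \<eta>)) = rho2 (cat v' (run (final Rho u) \<eta>))" for \<eta>
    proof -
      have "rho2 (cat (emitted Rho u') (run (final Rho u') \<eta>)) = psi (f (rho2 (cat u \<eta>)))"
        by (simp add: u' psi_rho2 run_cat)
      also have "\<dots> = g (rho2 (cat v (run (final Rho u) \<eta>)))"
        by (simp add: fg psi_rho2 run_cat u(1))
      finally show ?thesis by (simp add: v')
    qed
    then have "emitted Rho u' = v' \<and> final Rho u' = final Rho u"
      using u(2) by (intro run_cat_determines_state)
    then have "ctype Rho v' = ctype Rho v" using typ_emitted[of u] typ_emitted[of u'] u by simp
    then show ?thesis using shifts_on_prefix_replacement[OF v'] by blast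
  qed
  have "\<exists>k. shifts_on g v k" if "length v \<ge> ?N" for v
    using is_image_or_children[of v]
  proof
    assume "is_image v" then show ?thesis using image that by blast
  next
    assume *: "is_image (v @ [d0]) \<and> is_image (v @ [d1])"
    have "length (v @ [i]) \<ge> ?N" for i using that by simp
    then show ?thesis using image * shifts_on_children by meson
  qed
  then have "\<exists>k. shifts_on g [] k" by (rule shifts_on_everywhere)
  then obtain k where k: "shifts_on g [] k" by blast
  show ?thesis
  proof (rule that[of k])
    fix t assume t: "t \<in> inner_dyadic"
    then obtain \<omega> where "rho2 \<omega> = t" using rho2_surj[of t] unfolding inner_dyadic_def by auto
    then show "height (g t) = height t + k" using k t unfolding shifts_on_def by auto
  qed
qed


section \<open>Height shifting maps belong to \<open>B\<close>\<close>

definition height_shift :: "int \<Rightarrow> (real \<Rightarrow> real) set" where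
  "height_shift k = {g \<in> Thompson_F. \<forall>t\<in>inner_dyadic. height (g t) = height t + k}"

lemma height_shiftD:
  assumes "g \<in> height_shift k"
  shows "g \<in> Thompson_F" "g \<in> carrier Homeo" "t \<in> inner_dyadic \<Longrightarrow> height (g t) = height t + k"
    "g t \<in> inner_dyadic \<longleftrightarrow> t \<in> inner_dyadic"
  using assms Thompson_F_Homeo inner_dyadic_Thompson_F by (auto simp: height_shift_def)

lemma height_shift_comp:
  assumes "f \<in> height_shift k" "g \<in> height_shift l" shows "g \<circ> f \<in> height_shift (k + l)"
  using height_shiftD[OF assms(1)] height_shiftD[OF assms(2)]
  by (simp add: height_shift_def Thompson_F_comp)

lemma height_shift_inv:
  assumes "f \<in> height_shift k" shows "hinv f \<in> height_shift (- k)"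
proof -
  have F: "hinv f \<in> Thompson_F" using height_shiftD(1)[OF assms] by (rule Thompson_F_inv)
  have "height ((hinv f) t) = height t - k" if "t \<in> inner_dyadic" for t
  proof -
    have "(hinv f) t \<in> inner_dyadic" using that inner_dyadic_Thompson_F[OF F] by simp
    then have "height (f ((hinv f) t)) = height ((hinv f) t) + k"
      by (rule height_shiftD(3)[OF assms])
    then show ?thesis using height_shiftD(2)[OF assms] by simp
  qed
  then show ?thesis using F by (simp add: height_shift_def)
qed

lemma gx_shift: "gx \<in> height_shift 0" and gy_shift: "gy \<in> height_shift 1"
  using gx_F gy_F height_gx height_gy by (auto simp: height_shift_def)

lemma id_shift: "id \<in> height_shift 0"
  using subgroup.one_closed[OF subgroup_Thompson_F] by (simp add: height_shift_def)

text \<open>The property is graded by an integer that adds up under composition. One induction thus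
  serves height shifts, slopes at 1/4, translations along the chain and plain membership.\<close>

lemma Homeo_int_pow_induct:
  fixes n k :: int
  assumes f: "f \<in> carrier Homeo" "P k f" and "P 0 id"
    and comp: "\<And>i j a b. a \<in> carrier Homeo \<Longrightarrow> b \<in> carrier Homeo \<Longrightarrow> P i a \<Longrightarrow> P j b \<Longrightarrow> P (i + j) (b \<circ> a)"
    and inv: "\<And>i a. a \<in> carrier Homeo \<Longrightarrow> P i a \<Longrightarrow> P (- i) (hinv a)"
  shows "P (n * k) (f [^]\<^bsub>Homeo\<^esub> n)"
proof -
  have nat: "P (int m * k) (f [^]\<^bsub>Homeo\<^esub> m)" for m
  proof (induction m)
    case 0 then show ?case using assms(3) by (simp add: id_def)
  next
    case (Suc m)
    then have "P (int m * k + k) (f \<circ> f [^]\<^bsub>Homeo\<^esub> m)"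
      using f by (intro comp Homeo.nat_pow_closed)
    then show ?case by (simp add: algebra_simps comp_def)
  qed
  show ?thesis
  proof (cases n rule: int_cases2)
    case (nonneg m) then show ?thesis using nat[of m] by (simp add: int_pow_int)
  next
    case (nonpos m)
    have "P (- (int m * k)) (hinv (f [^]\<^bsub>Homeo\<^esub> m))"
      using f nat by (intro inv Homeo.nat_pow_closed)
    then show ?thesis unfolding nonpos Homeo.int_pow_neg[OF f(1)] by (simp add: int_pow_int)
  qed
qed

lemma height_shift_int_pow: "f \<in> height_shift k \<Longrightarrow> f [^]\<^bsub>Homeo\<^esub> (n::int) \<in> height_shift (n * k)"
  by (rule Homeo_int_pow_induct[where P = "\<lambda>i a. a \<in> height_shift i"])
    (auto intro: height_shift_comp height_shift_inv id_shift dest: height_shiftD(2))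

lemma subgroup_B: "subgroup B Homeo"
  unfolding B_eq by (rule Homeo.generate_is_subgroup) (simp add: gx_Homeo gy_Homeo)

lemma gx_B: "gx \<in> B" and gy_B: "gy \<in> B"
  unfolding B_eq by (auto intro: generate.incl)

lemma B_comp: "f \<in> B \<Longrightarrow> g \<in> B \<Longrightarrow> g \<circ> f \<in> B"
  using subgroup.m_closed[OF subgroup_B, of f g] by simp

lemma B_inv: "f \<in> B \<Longrightarrow> hinv f \<in> B"
  by (rule subgroup.m_inv_closed[OF subgroup_B])

lemma B_int_pow: "f \<in> B \<Longrightarrow> f [^]\<^bsub>Homeo\<^esub> (n::int) \<in> B"
  using Homeo_int_pow_induct[where P = "\<lambda>i a. a \<in> B" and f = f and n = n]
    subgroup.one_closed[OF subgroup_B] subgroup.mem_carrier[OF subgroup_B]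
  by (simp add: B_comp B_inv)

subsection \<open>Germs\<close>

lemma finite_avoid_half_powers:
  fixes a d :: real
  assumes "finite S" "0 < d"
  shows "\<exists>n. {a<..<a + 1 / 2 ^ n} \<inter> S = {} \<and> {a - 1 / 2 ^ n<..<a} \<inter> S = {} \<and> 1 / 2 ^ n < d"
proof -
  obtain e where e: "e > 0" "\<forall>x\<in>S. x \<noteq> a \<longrightarrow> e \<le> dist a x"
    using finite_set_avoid[OF assms(1)] by blast
  have "min d e > 0" using e(1) assms(2) by simp
  then obtain n where "(1/2) ^ n < min d e" using real_arch_pow_inv[of "min d e" "1/2"] by auto
  then have n: "1 / 2 ^ n < d" "1 / 2 ^ n < e" by (simp_all add: power_divide)
  have "x \<notin> S" if "\<bar>x - a\<bar> < 1 / 2 ^ n" "x \<noteq> a" for x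
    using e(2) n(2) that by (force simp: dist_real_def)
  then show ?thesis using n(1) by (intro exI[of _ n]) force
qed

lemma affine_off_ex:
  assumes "affine_off S f" "0 \<le> p" "p < q" "q \<le> 1" "{p<..<q} \<inter> S = {}"
  shows "\<exists>k::int. \<forall>s\<in>{p..q}. \<forall>t\<in>{p..q}. f t = f s + 2 powi k * (t - s)"
  by (rule affine_offE[OF assms]) blast

lemma germ_right:
  assumes "g \<in> Thompson_F" "0 \<le> a" "a < 1"
  shows "\<exists>n (k::int). \<forall>s\<in>{0..1 / 2 ^ n}. g (a + s) = g a + 2 powi k * s"
proof -
  obtain S where S: "finite S" "affine_off S g" using assms(1) unfolding Thompson_F_iff by blast
  obtain n where n: "{a<..<a + 1 / 2 ^ n} \<inter> S = {}" "1 / 2 ^ n < 1 - a"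
    using finite_avoid_half_powers[OF S(1), of "1 - a" a] assms(3) by auto
  have "a < a + 1 / 2 ^ n" "a + 1 / 2 ^ n \<le> 1" using n(2) assms(3) by auto
  then obtain k :: int where
    k: "\<forall>s\<in>{a..a + 1 / 2 ^ n}. \<forall>t\<in>{a..a + 1 / 2 ^ n}. g t = g s + 2 powi k * (t - s)"
    using affine_off_ex[OF S(2) assms(2) _ _ n(1)] by blast
  have "g (a + s) = g a + 2 powi k * s" if "s \<in> {0..1 / 2 ^ n}" for s
    using k[rule_format, of a "a + s"] that by simp
  then show ?thesis by blast
qed

lemma germ_left:
  assumes "g \<in> Thompson_F" "0 < a" "a \<le> 1"
  shows "\<exists>n (k::int). \<forall>s\<in>{0..1 / 2 ^ n}. g (a - s) = g a - 2 powi k * s"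
proof -
  obtain S where S: "finite S" "affine_off S g" using assms(1) unfolding Thompson_F_iff by blast
  obtain n where n: "{a - 1 / 2 ^ n<..<a} \<inter> S = {}" "1 / 2 ^ n < a"
    using finite_avoid_half_powers[OF S(1), of a a] assms(2) by auto
  have "a - 1 / 2 ^ n < a" "0 \<le> a - 1 / 2 ^ n" using n(2) assms(2) by auto
  then obtain k :: int where
    k: "\<forall>s\<in>{a - 1 / 2 ^ n..a}. \<forall>t\<in>{a - 1 / 2 ^ n..a}. g t = g s + 2 powi k * (t - s)"
    using affine_off_ex[OF S(2) _ _ assms(3) n(1)] by blast
  have "g (a - s) = g a - 2 powi k * s" if "s \<in> {0..1 / 2 ^ n}" for s
    using k[rule_format, of a "a - s"] that by simp
  then show ?thesis by blast
qed

lemma mp_zeros: "mp (replicate m d0) = 1 / 2 ^ Suc m" and mp_ones: "mp (replicate m d1) = 1 - 1 / 2 ^ Suc m"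
  by (induction m) (auto simp: field_simps)

lemma hgt_outer_left: "hgt L (replicate m d0) = - int m" "hgt Rho (replicate m d0) = - int m"
proof -
  show L: "hgt L (replicate m d0) = - int m" for m by (induction m) auto
  show "hgt Rho (replicate m d0) = - int m" using L by (cases m) auto
qed

lemma hgt_outer_right: "hgt R (replicate m d1) = - int m" "hgt Rho (replicate m d1) = - int m"
proof -
  show L: "hgt R (replicate m d1) = - int m" for m by (induction m) auto
  show "hgt Rho (replicate m d1) = - int m" using L by (cases m) auto
qed

lemma powi_div_power:
  assumes "int m \<ge> k" shows "2 powi k * (1 / 2 ^ Suc m) = (1 / 2 ^ Suc (nat (int m - k)) :: real)"
proof -
  have "(2::real) ^ Suc m = 2 powi (k + int (Suc (nat (int m - k))))" using assms by (simp flip: power_int_of_nat add: add.commute)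
  also have "\<dots> = 2 powi k * 2 ^ Suc (nat (int m - k))" by (subst power_int_add) (simp_all del: of_nat_Suc power_Suc)
  finally show ?thesis by simp
qed

text \<open>Near 0 the map is multiplication by \<open>2 powi k\<close>, which sends the midpoint of
  \<open>m\<close> zeros to that of \<open>m - k\<close> zeros. Their heights are \<open>- m\<close>
  and \<open>k - m\<close>, so \<open>k = 0\<close>; the argument at 1 is symmetric.\<close>

lemma height_shift_0_germs:
  assumes "g \<in> height_shift 0"
  obtains n where "\<And>t. t \<le> 1 / 2 ^ n \<Longrightarrow> g t = t" "\<And>t. t \<ge> 1 - 1 / 2 ^ n \<Longrightarrow> g t = t"
proof -
  note g = height_shiftD[OF assms]
  have g01: "g 0 = 0" "g 1 = 1" using Homeo_0_1[OF g(2)] by auto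
  have "\<exists>n (k::int). \<forall>s\<in>{0..1 / 2 ^ n}. g (0 + s) = g 0 + 2 powi k * s"
    by (rule germ_right[OF g(1)]) simp_all
  then obtain n and k :: int where nk: "\<And>s. s \<in> {0..1 / 2 ^ n} \<Longrightarrow> g (0 + s) = g 0 + 2 powi k * s" by blast
  have "\<exists>n (k::int). \<forall>s\<in>{0..1 / 2 ^ n}. g (1 - s) = g 1 - 2 powi k * s"
    by (rule germ_left[OF g(1)]) simp_all
  then obtain n' and k' :: int where nk': "\<And>s. s \<in> {0..1 / 2 ^ n'} \<Longrightarrow> g (1 - s) = g 1 - 2 powi k' * s" by blast
  have small: "1 / 2 ^ Suc (i + j) \<le> (1 / 2 ^ i :: real)" for i j :: nat
    by (intro divide_left_mono power_increasing) auto
  have k: "k = 0"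
  proof -
    \<comment> \<open>The first summand puts the point into the linear range of the germ, the second
      keeps \<open>?m - k\<close> nonnegative.\<close>
    let ?m = "n + nat \<bar>k\<bar>"
    have "g (mp (replicate ?m d0)) = 2 powi k * (1 / 2 ^ Suc ?m)"
      using nk[of "1 / 2 ^ Suc ?m"] small[of n] g01 by (simp add: mp_zeros)
    also have "\<dots> = mp (replicate (nat (int ?m - k)) d0)"
      unfolding mp_zeros by (rule powi_div_power) simp
    finally have e: "g (mp (replicate ?m d0)) = mp (replicate (nat (int ?m - k)) d0)" .
    have "height (g (mp (replicate ?m d0))) = height (mp (replicate ?m d0))"
      using g(3)[OF mp_inner] by simp
    then have "- int (nat (int ?m - k)) = - int ?m"
      by (simp only: e height_mp hgt_outer_left)
    then show ?thesis by linarith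
  qed
  have k': "k' = 0"
  proof -
    let ?m = "n' + nat \<bar>k'\<bar>"
    have "g (mp (replicate ?m d1)) = 1 - 2 powi k' * (1 / 2 ^ Suc ?m)"
      using nk'[of "1 / 2 ^ Suc ?m"] small[of n'] g01 by (simp add: mp_ones)
    also have "2 powi k' * (1 / 2 ^ Suc ?m) = (1 / 2 ^ Suc (nat (int ?m - k')) :: real)"
      by (rule powi_div_power) simp
    finally have e: "g (mp (replicate ?m d1)) = mp (replicate (nat (int ?m - k')) d1)"
      by (simp only: mp_ones)
    have "height (g (mp (replicate ?m d1))) = height (mp (replicate ?m d1))"
      using g(3)[OF mp_inner] by simp
    then have "- int (nat (int ?m - k')) = - int ?m"
      by (simp only: e height_mp hgt_outer_right)
    then show ?thesis by linarith
  qed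
  have le: "1 / 2 ^ (n + n') \<le> (1 / 2 ^ n :: real)" "1 / 2 ^ (n + n') \<le> (1 / 2 ^ n' :: real)"
    by (auto intro!: divide_left_mono power_increasing)
  show ?thesis
  proof (rule that[of "n + n'"])
    fix t :: real assume "t \<le> 1 / 2 ^ (n + n')"
    then show "g t = t" using nk[of t] le(1) g01 k Homeo_memD(3)[OF g(2), of t] by (cases "t > 0") auto
  next
    fix t :: real assume "t \<ge> 1 - 1 / 2 ^ (n + n')"
    then show "g t = t" using nk'[of "1 - t"] le(2) g01 k' Homeo_memD(3)[OF g(2), of t] by (cases "t < 1") auto
  qed
qed

subsection \<open>The chain of the orbit of \<open>1/2\<close> under \<open>x\<close>\<close>

text \<open>The point x^j (1/2) in closed form: \<open>gx\<close> doubles the distance to 1/4 on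
  [1/4, 3/8] and halves the distance to 3/4 on [1/2, 3/4].\<close>

definition chain :: "int \<Rightarrow> real" where
  "chain j = (if j \<le> 0 then 1 / 4 + 2 powi (j - 2) else 3 / 4 - 2 powi (- j - 2))"

lemma chain_0_1: "chain 0 = 1 / 2" "chain 1 = 5 / 8"
  by (simp_all add: chain_def power_int_def power_divide)

lemma chain_neg: "chain (- int (Suc n)) = mp ([d0, d1] @ replicate n d0)"
proof -
  have "- int (Suc n) - 2 = - int (n + 3)" by simp
  then have "(2::real) powi (- int (Suc n) - 2) = 1 / 2 ^ (n + 3)"
    by (simp only: power_int_minus power_int_of_nat inverse_eq_divide)
  then show ?thesis unfolding mp_append mp_zeros by (simp add: chain_def power_add)
qed

lemma chain_pos: "chain (int (Suc n)) = mp ([d1, d0] @ replicate n d1)"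
proof -
  have "- int (Suc n) - 2 = - int (n + 3)" by simp
  then have "(2::real) powi (- int (Suc n) - 2) = 1 / 2 ^ (n + 3)"
    by (simp only: power_int_minus power_int_of_nat inverse_eq_divide)
  then show ?thesis unfolding mp_append mp_ones by (simp add: chain_def power_add diff_divide_distrib)
qed

lemma int_cases_chain: obtains "j = 0" | n where "j = - int (Suc n)" | n where "j = int (Suc n)"
  by (metis int_cases3 Suc_pred')

lemma hgt_inner_zero: "hgt StA (replicate n d0) = 0" "hgt StB (replicate n d1) = 0"
  by (induction n) auto

lemma chain_inner: "chain j \<in> inner_dyadic" and height_chain: "height (chain j) = 0"
proof -
  have "chain j \<in> inner_dyadic \<and> height (chain j) = 0"
  proof (cases j rule: int_cases_chain)
    case 1
    have "chain j = mp []" by (simp add: 1 chain_0_1)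
    then show ?thesis by (simp only: mp_inner height_mp hgt.simps)
  next
    case (2 n)
    show ?thesis unfolding 2 chain_neg by (simp only: mp_inner height_mp) (simp add: hgt_inner_zero)
  next
    case (3 n)
    show ?thesis unfolding 3 chain_pos by (simp only: mp_inner height_mp) (simp add: hgt_inner_zero)
  qed
  then show "chain j \<in> inner_dyadic" "height (chain j) = 0" by auto
qed

lemma chain_bounds: "1 / 4 < chain j" "chain j < 3 / 4"
proof -
  have pos: "(0::real) < 2 powi i" for i :: int by simp
  have le: "(2::real) powi i \<le> 1 / 4" if "i \<le> -2" for i :: int
  proof -
    have "(2::real) powi i \<le> 2 powi (-2)" using that by (intro power_int_increasing) auto
    moreover have "(2::real) powi (-2) = 1 / 4" by (simp add: power_int_def power_divide)
    ultimately show ?thesis by simp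
  qed
  have "1 / 4 < chain j \<and> chain j < 3 / 4"
  proof (cases "j \<le> 0")
    case True
    then show ?thesis using pos[of "j - 2"] le[of "j - 2"] unfolding chain_def if_P[OF True] by linarith
  next
    case False
    then have "(2::real) powi (- j - 2) \<le> 1 / 4" by (intro le) simp
    then show ?thesis using pos[of "- j - 2"] unfolding chain_def if_not_P[OF False] by linarith
  qed
  then show "1 / 4 < chain j" "chain j < 3 / 4" by auto
qed

lemma gx_chain: "gx (chain j) = chain (j + 1)"
proof -
  have t: "chain j \<in> {0..1}" using chain_bounds[of j] by auto
  have sm: "(2::real) powi i \<le> 1 / 8" if "i \<le> -3" for i :: int
  proof -
    have "(2::real) powi i \<le> 2 powi (-3)" using that by (intro power_int_increasing) auto
    moreover have "(2::real) powi (-3) = 1 / 8" by (simp add: power_int_def power_divide)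
    ultimately show ?thesis by simp
  qed
  have pos: "(0::real) < 2 powi i" for i :: int by simp
  consider "j = 0" | "j \<le> -1" | "j \<ge> 1" by linarith
  then show ?thesis
  proof cases
    case 1 then show ?thesis by (simp add: chain_0_1 gx_eq)
  next
    case 2
    have "(2::real) powi (j + 1 - 2) = 2 * 2 powi (j - 2)"
      using power_int_add[of "2::real" "j - 2" 1] by (simp add: algebra_simps)
    then show ?thesis
      using 2 sm[of "j - 2"] pos[of "j - 2"] unfolding gx_eq[OF t] by (simp add: chain_def not_le)
  next
    case 3
    have e: "(2::real) powi (- (j + 1) - 2) = 2 powi (- j - 2) / 2"
      using power_int_add[of "2::real" "- j - 2" "-1"] by (simp add: algebra_simps power_int_minus)
    have "chain (j + 1) = 3 / 4 - 2 powi (- (j + 1) - 2)" using 3 by (simp add: chain_def)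
    then have c1: "chain (j + 1) = 3 / 4 - 2 powi (- j - 2) / 2" unfolding e .
    have c: "chain j = 3 / 4 - 2 powi (- j - 2)" using 3 by (simp add: chain_def)
    have "2 powi (- j - 2) \<le> (1 / 8 :: real)" using 3 by (intro sm) simp
    then have "gx (chain j) = chain j / 2 + 3 / 8"
      using pos[of "- j - 2"] unfolding gx_eq[OF t] by (simp add: c)
    then show ?thesis by (simp add: c c1 diff_divide_distrib)
  qed
qed

lemma chain_less_Suc: "chain j < chain (j + 1)"
proof -
  have lt: "(2::real) powi i < 2 powi (i + 1)" for i :: int
    by (simp add: power_int_add)
  consider "j = 0" | "j \<le> -1" | "j \<ge> 1" by linarith
  then show ?thesis
  proof cases
    case 2 then show ?thesis using lt[of "j - 2"] by (simp add: chain_def algebra_simps)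
  next
    case 3 then show ?thesis using lt[of "- j - 3"] by (simp add: chain_def algebra_simps)
  qed (simp add: chain_0_1)
qed

lemma chain_less: "i < j \<Longrightarrow> chain i < chain j"
proof (induction j rule: int_gr_induct)
  case (step j) then show ?case using chain_less_Suc[of j] by linarith
qed (rule chain_less_Suc)

lemma chain_less_iff: "chain i < chain j \<longleftrightarrow> i < j"
  using chain_less[of i j] chain_less[of j i] by (cases i j rule: linorder_cases) auto

lemma hgt_inner_nonneg: "0 \<le> hgt StA w \<and> 0 \<le> hgt StB w \<and> 0 \<le> hgt StC w"
  by (induction w) auto

text \<open>Entering the right half of an interval of type \<open>StA\<close> costs 1, and later
  increments cannot compensate for it.\<close>

lemma hgt_StA_zero: "hgt StA w = 0 \<Longrightarrow> w = replicate (length w) d0"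
proof (induction w)
  case (Cons i w)
  then show ?case using hgt_inner_nonneg[of w] by (cases i) auto
qed simp

lemma hgt_StB_zero: "hgt StB w = 0 \<Longrightarrow> w = replicate (length w) d1"
proof (induction w)
  case (Cons i w)
  then show ?case using hgt_inner_nonneg[of w] by (cases i) auto
qed simp

lemma inner_mp_cases:
  assumes "1 / 4 < mp u" "mp u < 3 / 4"
  obtains "u = []" | w where "u = [d0, d1] @ w" | w where "u = [d1, d0] @ w"
proof (cases u)
  case (Cons i v)
  note u = this
  show ?thesis
  proof (cases v)
    case Nil then show ?thesis using assms u by (cases i) auto
  next
    case (Cons j w)
    then show ?thesis using assms u that mp_bounds[of w] by (cases i; cases j) auto
  qed
qed

lemma height_inner_nonneg:
  assumes "t \<in> inner_dyadic" "1 / 4 < t" "t < 3 / 4" shows "0 \<le> height t"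
proof -
  obtain u where t: "t = mp u" using assms(1) by (rule inner_dyadicE)
  show ?thesis unfolding t height_mp
    using assms(2,3)[unfolded t] hgt_inner_nonneg by (cases u rule: inner_mp_cases) auto
qed

text \<open>Besides 1/2 there are only the intervals 01 and 10, of types \<open>StA\<close> and
  \<open>StB\<close>, to consider. Height 0 leaves the words 010...0 and 101...1 there, whose
  midpoints form the chain.\<close>

lemma height_zero_chain:
  assumes "t \<in> inner_dyadic" "1 / 4 < t" "t < 3 / 4" "height t = 0"
  obtains j where "t = chain j"
proof -
  obtain u where t: "t = mp u" using assms(1) by (rule inner_dyadicE)
  have h: "hgt Rho u = 0" using assms(4) by (simp add: t)
  show ?thesis
    using assms(2,3)[unfolded t]
  proof (cases rule: inner_mp_cases)
    case 1 then show ?thesis using t chain_0_1 that[of 0] by simp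
  next
    case (2 w)
    then have "w = replicate (length w) d0" using h hgt_StA_zero by simp
    then show ?thesis using 2 t chain_neg[of "length w"] that by metis
  next
    case (3 w)
    then have "w = replicate (length w) d1" using h hgt_StB_zero by simp
    then show ?thesis using 3 t chain_pos[of "length w"] that by metis
  qed
qed

lemma chain_near_ends: "chain (- int n) \<le> 1 / 4 + 1 / 2 ^ n" "3 / 4 - chain (int (Suc n)) = 1 / 2 ^ (n + 3)"
proof -
  have "- int n - 2 = - int (n + 2)" by simp
  then have "(2::real) powi (- int n - 2) = 1 / 2 ^ (n + 2)"
    by (simp only: power_int_minus power_int_of_nat inverse_eq_divide)
  moreover have "1 / 2 ^ (n + 2) \<le> (1 / 2 ^ n :: real)"
    by (intro divide_left_mono power_increasing) auto
  ultimately show "chain (- int n) \<le> 1 / 4 + 1 / 2 ^ n" by (simp add: chain_def)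
  show "3 / 4 - chain (int (Suc n)) = 1 / 2 ^ (n + 3)"
    unfolding chain_pos mp_append mp_ones by (simp add: power_add diff_divide_distrib)
qed


subsection \<open>Induction on the heights of the breakpoints\<close>

text \<open>Serves as a set of admissible breakpoints. All dyadic points up to a height are taken,
  so that a map shifting heights by \<open>k\<close> carries \<open>low m\<close> exactly onto
  \<open>low (m + k)\<close>.\<close>

definition low :: "int \<Rightarrow> real set" where
  "low m = {t \<in> inner_dyadic. height t \<le> m}"

lemma low_mono: "m \<le> n \<Longrightarrow> low m \<subseteq> low n"
  by (auto simp: low_def)

lemma vimage_low:
  assumes "f \<in> height_shift k" shows "f -` low (m + k) = low m"
  using height_shiftD(3,4)[OF assms] by (auto simp: low_def)

lemma affine_off_low_comp:
  assumes "f \<in> height_shift k" "affine_off (low m) f" "affine_off (low (m + k)) g"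
  shows "affine_off (low m) (g \<circ> f)"
  using affine_off_comp[OF height_shiftD(2)[OF assms(1)] assms(2,3)] vimage_low[OF assms(1)] by simp

lemma affine_off_low_inv:
  assumes "f \<in> height_shift k" "affine_off (low m) f"
  shows "affine_off (low (m + k)) (hinv f)"
proof -
  have "f ` low m = low (m + k)"
    using vimage_low[OF assms(1), of m] Homeo_memD(2)[OF height_shiftD(2)[OF assms(1)]]
    by (metis surj_image_vimage_eq)
  then show ?thesis using affine_off_inv[OF height_shiftD(2)[OF assms(1)] assms(2)] by simp
qed

definition fixes_outside :: "real \<Rightarrow> real \<Rightarrow> (real \<Rightarrow> real) \<Rightarrow> bool" where
  "fixes_outside a b f \<longleftrightarrow> (\<forall>t. t \<le> a \<or> b \<le> t \<longrightarrow> f t = t)"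

lemma fixes_outside_comp: "fixes_outside a b f \<Longrightarrow> fixes_outside a b g \<Longrightarrow> fixes_outside a b (g \<circ> f)"
  by (simp add: fixes_outside_def)

lemma fixes_outside_inv:
  assumes "f \<in> carrier Homeo" "fixes_outside a b f" shows "fixes_outside a b (hinv f)"
  unfolding fixes_outside_def
proof (intro allI impI)
  fix t assume "t \<le> a \<or> b \<le> t"
  then have "f t = t" using assms(2) unfolding fixes_outside_def by blast
  then show "(hinv f) t = t" using Homeo_inv_apply(2)[OF assms(1), of t] by simp
qed

lemma fixes_outside_conj:
  assumes q: "q \<in> carrier Homeo" and h: "fixes_outside (q a) (q b) h"
  shows "fixes_outside a b (hinv q \<circ> h \<circ> q)"
  using h Homeo_le_iff[OF q] q by (auto simp: fixes_outside_def)

text \<open>The stages of the induction: stage \<open>-1\<close> is trivial, and every height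
  preserving map supported in [1/4, 3/4] belongs to some stage.\<close>

definition core_group :: "int \<Rightarrow> (real \<Rightarrow> real) set" where
  "core_group m = {g \<in> height_shift 0. affine_off (low m) g \<and> fixes_outside (1 / 4) (3 / 4) g}"

lemma core_groupD:
  assumes "g \<in> core_group m"
  shows "g \<in> height_shift 0" "affine_off (low m) g" "fixes_outside (1 / 4) (3 / 4) g"
    "g \<in> Thompson_F" "g \<in> carrier Homeo"
  using assms height_shiftD(1,2) by (auto simp: core_group_def)

lemma core_group_comp: "f \<in> core_group m \<Longrightarrow> g \<in> core_group m \<Longrightarrow> g \<circ> f \<in> core_group m"
  using height_shift_comp[of f 0 g 0] affine_off_low_comp[of f 0 m g]
  by (auto simp: core_group_def fixes_outside_comp)

lemma core_group_inv: "f \<in> core_group m \<Longrightarrow> hinv f \<in> core_group m"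
  using height_shift_inv[of f 0] affine_off_low_inv[of f 0 m] core_groupD(5)[of f m]
  by (auto simp: core_group_def fixes_outside_inv)

lemma id_core: "id \<in> core_group m"
proof -
  have "affine_off (low m) id"
    by (rule affine_offI) (auto intro: exI[of _ "0::int"])
  then show ?thesis using id_shift by (simp add: core_group_def fixes_outside_def)
qed

lemma height_eighths: "height (1 / 4) = -1" "height (3 / 8) = 0" "height (1 / 2) = 0" "height (3 / 4) = -1"
    "height (7 / 8) = -2"
  using height_mp[of "[d0]"] height_mp[of "[d0, d1]"] height_mp[of "[]"] height_mp[of "[d1]"] height_mp[of "[d1, d1]"]
  by simp_all

lemma eighths_inner: "1 / 4 \<in> inner_dyadic" "3 / 8 \<in> inner_dyadic" "1 / 2 \<in> inner_dyadic" "3 / 4 \<in> inner_dyadic"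
    "7 / 8 \<in> inner_dyadic"
  using eighths_dyadic by (simp_all add: inner_dyadic_def)

lemma gx_core: assumes "0 \<le> m" shows "gx \<in> core_group m"
proof -
  have "{1/4, 3/8, 1/2, 3/4} \<subseteq> low m"
    using assms by (simp add: low_def height_eighths eighths_inner)
  then have "affine_off (low m) gx" by (rule affine_off_mono[OF gx_affine_off])
  moreover have "fixes_outside (1 / 4) (3 / 4) gx"
    unfolding fixes_outside_def
  proof (intro allI impI)
    fix t :: real assume "t \<le> 1 / 4 \<or> 3 / 4 \<le> t"
    then show "gx t = t"
      using Homeo_dyadic_outside[OF gx_Homeo, of t] by (cases "t \<in> {0..1}") (auto simp: gx_eq)
  qed
  ultimately show ?thesis using gx_shift by (simp add: core_group_def)
qed

lemma gx_int_pow_core: "0 \<le> m \<Longrightarrow> gx [^]\<^bsub>Homeo\<^esub> (j::int) \<in> core_group m"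
  using Homeo_int_pow_induct[where P = "\<lambda>i a. a \<in> core_group m" and f = gx and n = j]
  by (simp add: gx_Homeo gx_core id_core core_group_comp core_group_inv)

lemma gx_int_pow_chain: "(gx [^]\<^bsub>Homeo\<^esub> (j::int)) (chain i) = chain (i + j)"
proof -
  have "\<forall>i. (gx [^]\<^bsub>Homeo\<^esub> j) (chain i) = chain (i + j * 1)"
  proof (rule Homeo_int_pow_induct[where P = "\<lambda>k a. \<forall>i. a (chain i) = chain (i + k)"])
    show "\<forall>i. (hinv a) (chain i) = chain (i + - k)"
      if a: "a \<in> carrier Homeo" "\<forall>i. a (chain i) = chain (i + k)" for k a
    proof
      fix i
      have "a (chain (i - k)) = chain i" using a(2) by simp
      then show "(hinv a) (chain i) = chain (i + - k)"
        using Homeo_inv_apply(2)[OF a(1), of "chain (i - k)"] by simp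
    qed
  qed (auto simp: gx_Homeo gx_chain algebra_simps)
  then show ?thesis by simp
qed

text \<open>The exponent of the slope on the right of 1/4. It is 1 for \<open>gx\<close>, so it
  tells which power of \<open>gx\<close> has to be divided out.\<close>

definition germ :: "int \<Rightarrow> (real \<Rightarrow> real) \<Rightarrow> bool" where
  "germ k f \<longleftrightarrow> (\<exists>n. \<forall>s\<in>{0..1 / 2 ^ n}. f (1 / 4 + s) = 1 / 4 + 2 powi k * s)"

lemma powi_mult_small:
  assumes "s \<in> {0..1 / 2 ^ (n + nat \<bar>k\<bar>)}" shows "2 powi k * s \<in> {0..1 / (2::real) ^ n}"
proof -
  have "(2::real) powi k \<le> 2 powi (int (nat \<bar>k\<bar>))" by (intro power_int_increasing) auto
  then have "(2::real) powi k \<le> 2 ^ nat \<bar>k\<bar>" unfolding power_int_of_nat .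
  then have "2 powi k * s \<le> 2 ^ nat \<bar>k\<bar> * (1 / 2 ^ (n + nat \<bar>k\<bar>))"
    using assms by (intro mult_mono) auto
  also have "\<dots> = 1 / 2 ^ n" by (simp add: power_add)
  finally show ?thesis using assms by simp
qed

lemma half_power_mono: "1 / 2 ^ (m + n) \<le> (1 / 2 ^ m :: real)" "1 / 2 ^ (m + n) \<le> (1 / 2 ^ n :: real)"
  by (auto intro!: divide_left_mono power_increasing)

lemma germ_comp: assumes "germ i f" "germ j g" shows "germ (i + j) (g \<circ> f)"
proof -
  obtain m where m: "\<forall>s\<in>{0..1 / 2 ^ m}. f (1 / 4 + s) = 1 / 4 + 2 powi i * s"
    using assms(1) unfolding germ_def by blast
  obtain n where n: "\<forall>s\<in>{0..1 / 2 ^ n}. g (1 / 4 + s) = 1 / 4 + 2 powi j * s"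
    using assms(2) unfolding germ_def by blast
  have "(g \<circ> f) (1 / 4 + s) = 1 / 4 + 2 powi (i + j) * s" if s: "s \<in> {0..1 / 2 ^ (m + (n + nat \<bar>i\<bar>))}" for s
  proof -
    have "s \<in> {0..1 / 2 ^ m}" "s \<in> {0..1 / 2 ^ (n + nat \<bar>i\<bar>)}"
      using s half_power_mono[of m "n + nat \<bar>i\<bar>"] by auto
    then have "f (1 / 4 + s) = 1 / 4 + 2 powi i * s" "2 powi i * s \<in> {0..1 / 2 ^ n}"
      using m powi_mult_small[of s n i] by auto
    then show ?thesis using n by (simp add: power_int_add)
  qed
  then show ?thesis unfolding germ_def by blast
qed

lemma germ_inv: assumes "f \<in> carrier Homeo" "germ k f" shows "germ (- k) (hinv f)"
proof -
  obtain n where n: "\<forall>s\<in>{0..1 / 2 ^ n}. f (1 / 4 + s) = 1 / 4 + 2 powi k * s"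
    using assms(2) unfolding germ_def by blast
  have "(hinv f) (1 / 4 + s) = 1 / 4 + 2 powi (- k) * s" if s: "s \<in> {0..1 / 2 ^ (n + nat \<bar>- k\<bar>)}" for s
  proof -
    have "f (1 / 4 + 2 powi (- k) * s) = 1 / 4 + 2 powi k * (2 powi (- k) * s)"
      using n powi_mult_small[OF s] by blast
    also have "\<dots> = 1 / 4 + s" by (simp add: power_int_minus)
    finally show ?thesis using Homeo_inv_apply(2)[OF assms(1), of "1 / 4 + 2 powi (- k) * s"] by simp
  qed
  then show ?thesis unfolding germ_def by blast
qed

lemma germ_gx_int_pow: "germ j (gx [^]\<^bsub>Homeo\<^esub> (j::int))"
proof -
  have "germ 1 gx" unfolding germ_def
    by (intro exI[of _ 3]) (auto simp: gx_eq)
  moreover have "germ 0 id" by (simp add: germ_def)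
  ultimately have "germ (j * 1) (gx [^]\<^bsub>Homeo\<^esub> j)"
    by (intro Homeo_int_pow_induct[where P = germ] gx_Homeo germ_comp germ_inv)
  then show ?thesis by simp
qed

text \<open>The map and its inverse are increasing and carry the chain into itself. A permutation of
  the integers of this kind is a translation, and here it fixes all sufficiently negative
  indices.\<close>

lemma height_shift_fixes_chain:
  assumes g: "g \<in> height_shift 0" "fixes_outside (1 / 4) (3 / 4) g"
    and n: "\<And>t. t \<le> 1 / 4 + 1 / 2 ^ n \<Longrightarrow> g t = t"
  shows "g (chain j) = chain j"
proof -
  have to_chain: "\<exists>i. f (chain j) = chain i"
    if f: "f \<in> height_shift 0" "fixes_outside (1 / 4) (3 / 4) f" for f j
  proof -
    have f': "f (1 / 4) = 1 / 4" "f (3 / 4) = 3 / 4" using f(2) by (simp_all add: fixes_outside_def)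
    have "1 / 4 < f (chain j)" "f (chain j) < 3 / 4"
      using chain_bounds[of j] Homeo_less_iff[OF height_shiftD(2)[OF f(1)]] f' by metis+
    moreover have "f (chain j) \<in> inner_dyadic" "height (f (chain j)) = 0"
      using height_shiftD(3,4)[OF f(1)] chain_inner height_chain by auto
    ultimately show ?thesis by (metis height_zero_chain)
  qed
  have gH: "g \<in> carrier Homeo" using g(1) by (rule height_shiftD(2))
  have start: "g (chain j) = chain j" if "j \<le> - int n" for j
  proof -
    have "chain j \<le> chain (- int n)" using that chain_less_iff[of "- int n" j] by linarith
    then show ?thesis using n chain_near_ends(1)[of n] by simp
  qed
  have "g (chain j) = chain j" if "j \<ge> - int n" for j
    using that
  proof (induction j rule: int_ge_induct)
    case base show ?case by (rule start) simp
  next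
    case (step j)
    \<comment> \<open>Applied to \<open>g\<close> and to its inverse, this bounds the new index from
      both sides.\<close>
    have up: "j + 1 \<le> i" if i: "f (chain (j + 1)) = chain i" and f: "f \<in> carrier Homeo" "f (chain j) = chain j" for f i
    proof -
      have "f (chain j) < f (chain (j + 1))" using Homeo_less_iff[OF f(1)] chain_less_Suc by simp
      then show ?thesis using i f(2) by (simp add: chain_less_iff)
    qed
    obtain i where i: "g (chain (j + 1)) = chain i" using to_chain[OF g] by blast
    let ?h = "hinv g"
    have h: "?h \<in> carrier Homeo" using gH by simp
    have "?h \<in> height_shift 0" using height_shift_inv[OF g(1)] by simp
    then obtain i' where i': "?h (chain (j + 1)) = chain i'"
      using to_chain[of ?h] fixes_outside_inv[OF gH g(2)] by blast
    have "?h (chain j) = chain j" using Homeo_inv_apply(2)[OF gH, of "chain j"] step.IH by simp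
    then have "j + 1 \<le> i'" using up[OF i' h] by simp
    then have "chain (j + 1) \<le> chain i'" using chain_less_iff[of i' "j + 1"] by linarith
    then have "g (chain (j + 1)) \<le> g (chain i')" using Homeo_le_iff[OF gH] by simp
    also have "g (chain i') = chain (j + 1)" using Homeo_inv_apply(1)[OF gH, of "chain (j + 1)"] i' by simp
    finally have "i \<le> j + 1" using i chain_less_iff[of "j + 1" i] by linarith
    then show ?case using up[OF i gH step.IH] i by simp
  qed
  then show ?thesis using start by (cases "j \<le> - int n") auto
qed

definition restr :: "real \<Rightarrow> real \<Rightarrow> (real \<Rightarrow> real) \<Rightarrow> real \<Rightarrow> real" where
  "restr a b f t = (if a \<le> t \<and> t \<le> b then f t else t)"

lemma restr_Homeo:
  assumes f: "f \<in> carrier Homeo" "f a = a" "f b = b" shows "restr a b f \<in> carrier Homeo"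
proof (rule Homeo_memI)
  have in_ab: "a \<le> f t \<longleftrightarrow> a \<le> t" "f t \<le> b \<longleftrightarrow> t \<le> b" for t
    using Homeo_le_iff[OF f(1), of a t] Homeo_le_iff[OF f(1), of t b] f by auto
  show "strict_mono (restr a b f)"
  proof (rule strict_monoI)
    fix s t :: real assume st: "s < t"
    then have "f s < f t" using Homeo_less_iff[OF f(1)] by simp
    then show "restr a b f s < restr a b f t"
      using st in_ab[of s] in_ab[of t] by (auto simp: restr_def)
  qed
  show "surj (restr a b f)"
    unfolding surj_def
  proof
    fix s
    obtain t where t: "s = f t" using Homeo_memD(2)[OF f(1)] by (rule surjE)
    show "\<exists>t. s = restr a b f t"
    proof (cases "a \<le> s \<and> s \<le> b")
      case True
      then have "s = restr a b f t" using in_ab[of t] t by (simp add: restr_def)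
      then show ?thesis by blast
    next
      case False
      then have "s = restr a b f s" by (auto simp: restr_def)
      then show ?thesis by blast
    qed
  qed
  show "restr a b f t = t" if "t \<notin> {0..1}" for t
    using Homeo_dyadic_outside[OF f(1) that] by (simp add: restr_def)
qed

lemma restr_affine_off:
  assumes "affine_off S f" "f a = a" "f b = b" shows "affine_off (insert a (insert b S)) (restr a b f)"
proof (rule affine_offI)
  fix p q :: real assume *: "0 \<le> p" "p < q" "q \<le> 1" "{p<..<q} \<inter> insert a (insert b S) = {}"
  then have S: "{p<..<q} \<inter> S = {}" and ab: "q \<le> a \<or> a \<le> p" "q \<le> b \<or> b \<le> p"
    by (auto simp: interval_insert_disjoint[OF *(2)])
  show "\<exists>k::int. \<forall>t\<in>{p..q}. restr a b f t = restr a b f p + 2 powi k * (t - p)"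
  proof (cases "a \<le> p \<and> q \<le> b")
    case True
    obtain k :: int where k: "\<forall>s\<in>{p..q}. \<forall>t\<in>{p..q}. f t = f s + 2 powi k * (t - s)"
      using affine_off_ex[OF assms(1) *(1-3) S] ..
    have e: "\<forall>t\<in>{p..q}. f t = f p + 2 powi k * (t - p)" by (rule bspec[OF k]) (use *(2) in simp)
    have "restr a b f t = restr a b f p + 2 powi k * (t - p)" if "t \<in> {p..q}" for t
      using bspec[OF e that] True *(2) that by (simp add: restr_def)
    then show ?thesis by blast
  next
    case False
    have "restr a b f t = t" if "t \<in> {p..q}" for t
      using that False ab *(2) assms(2,3) unfolding restr_def by (cases "t = a \<or> t = b") auto
    then show ?thesis using *(2) by (intro exI[of _ 0]) auto
  qed
qed

text \<open>Cutting creates breakpoints at \<open>a\<close> and \<open>b\<close>, hence the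
  condition that they lie in \<open>low m\<close>; chain points satisfy it for every
  \<open>m \<ge> 0\<close>.\<close>

lemma restr_core:
  assumes f: "f \<in> core_group m" "f a = a" "f b = b" and ab: "a \<in> low m" "b \<in> low m" "1 / 4 \<le> a" "b \<le> 3 / 4"
  shows "restr a b f \<in> core_group m"
proof -
  note D = core_groupD[OF f(1)]
  have H: "restr a b f \<in> carrier Homeo" by (rule restr_Homeo[OF D(5) f(2,3)])
  obtain S where S: "finite S" "S \<subseteq> dyadic" "affine_off S f" using D(4) unfolding Thompson_F_iff by blast
  have "{a, b} \<subseteq> dyadic" using ab by (auto simp: low_def inner_dyadic_def)
  then have "restr a b f \<in> Thompson_F"
    unfolding Thompson_F_iff using H S restr_affine_off[OF S(3) f(2,3)]
    by (intro conjI exI[of _ "insert a (insert b S)"]) auto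
  moreover have "height (restr a b f t) = height t" if "t \<in> inner_dyadic" for t
    using height_shiftD(3)[OF D(1) that] by (simp add: restr_def)
  moreover have "affine_off (low m) (restr a b f)"
    using restr_affine_off[OF D(2) f(2,3)] ab(1,2) by (simp add: insert_absorb)
  moreover have "fixes_outside (1 / 4) (3 / 4) (restr a b f)"
    using D(3) by (simp add: fixes_outside_def restr_def)
  ultimately show ?thesis by (simp add: core_group_def height_shift_def)
qed

text \<open>No point of (1/4, 3/4) has negative height, so the map is affine there and fixes both
  ends.\<close>

lemma core_group_trivial: assumes "g \<in> core_group (-1)" shows "g = id"
proof
  note D = core_groupD[OF assms]
  have ends: "g (1 / 4) = 1 / 4" "g (3 / 4) = 3 / 4" using D(3) by (simp_all add: fixes_outside_def)
  have "{1 / 4<..<3 / 4} \<inter> low (-1) = {}"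
  proof -
    have "t \<notin> low (-1)" if "t \<in> {1 / 4<..<3 / 4}" for t
      using height_inner_nonneg[of t] that by (auto simp: low_def)
    then show ?thesis by blast
  qed
  then obtain k :: int where k: "\<forall>s\<in>{1 / 4..3 / 4}. \<forall>t\<in>{1 / 4..3 / 4}. g t = g s + 2 powi k * (t - s)"
    using affine_off_ex[OF D(2), of "1 / 4" "3 / 4"] by auto
  have "2 powi k = (1::real)" using k[rule_format, of "1 / 4" "3 / 4"] ends by simp
  then have "g t = t" if "t \<in> {1 / 4..3 / 4}" for t
    using k[rule_format, of "1 / 4" t] ends that by simp
  then show "g t = id t" for t
    using D(3) by (cases "t \<in> {1 / 4..3 / 4}") (auto simp: fixes_outside_def)
qed

lemma id_B: "id \<in> B"
  using subgroup.one_closed[OF subgroup_B] unfolding Homeo_simps .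

text \<open>The map \<open>y\<close> followed by \<open>x\<^sup>j\<close> carries \<open>[1/4, 3/4]\<close> affinely onto the \<open>j\<close>-th interval of the
  chain; conjugation by it lowers the heights of breakpoints by \<open>1\<close>.\<close>

lemma chain_piece_in_B:
  assumes IH: "\<And>g. g \<in> core_group (m - 1) \<Longrightarrow> g \<in> B" and m: "0 \<le> m"
    and h: "h \<in> core_group m" "fixes_outside (chain j) (chain (j + 1)) h"
  shows "h \<in> B"
proof -
  note D = core_groupD[OF h(1)]
  define q where "q = gx [^]\<^bsub>Homeo\<^esub> j \<circ> gy"
  let ?q' = "hinv q"
  have xj: "gx [^]\<^bsub>Homeo\<^esub> j \<in> height_shift 0" "affine_off (low 0) (gx [^]\<^bsub>Homeo\<^esub> j)"
    using core_groupD[OF gx_int_pow_core[of 0 j]] by auto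
  have q: "q \<in> height_shift 1" unfolding q_def using height_shift_comp[OF gy_shift xj(1)] by simp
  have qH: "q \<in> carrier Homeo" using q by (rule height_shiftD(2))
  \<comment> \<open>The breakpoints of \<open>gy\<close> have negative height, and those of the
    power of \<open>gx\<close>, of height at most 0, are lowered by 1 when pulled back along
    \<open>gy\<close>. So \<open>q\<close> is affine off \<open>low (-1)\<close>, and conjugation
    adds no breakpoint above height \<open>m - 1\<close>.\<close>
  have "{1/4, 3/4, 7/8} \<subseteq> low (-1)" by (simp add: low_def height_eighths eighths_inner)
  then have "affine_off (low (-1)) gy" by (rule affine_off_mono[OF gy_affine_off])
  then have aq: "affine_off (low (-1)) q"
    unfolding q_def using affine_off_low_comp[OF gy_shift, of "-1"] xj(2) by simp
  have "q (1 / 4) = (gx [^]\<^bsub>Homeo\<^esub> j) (chain 0)" "q (3 / 4) = (gx [^]\<^bsub>Homeo\<^esub> j) (chain 1)"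
    by (simp_all add: q_def gy_eq chain_0_1)
  then have q_ends: "q (1 / 4) = chain j" "q (3 / 4) = chain (j + 1)"
    by (simp_all add: gx_int_pow_chain add.commute)
  have hq: "h \<circ> q \<in> height_shift 1" using height_shift_comp[OF q D(1)] by simp
  have "affine_off (low (m - 1)) q" by (rule affine_off_mono[OF aq low_mono]) (use m in simp)
  then have ahq: "affine_off (low (m - 1)) (h \<circ> q)"
    using D(2) by (intro affine_off_low_comp[OF q]) auto
  have "affine_off (low 0) ?q'" using affine_off_low_inv[OF q aq] by simp
  then have "affine_off (low m) ?q'" by (rule affine_off_mono[OF _ low_mono[OF m]])
  then have a: "affine_off (low (m - 1)) (?q' \<circ> (h \<circ> q))"
    using ahq by (intro affine_off_low_comp[OF hq]) auto
  have s: "?q' \<circ> (h \<circ> q) \<in> height_shift 0"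
    using height_shift_comp[OF hq height_shift_inv[OF q]] by simp
  have "fixes_outside (1 / 4) (3 / 4) (?q' \<circ> (h \<circ> q))"
    using fixes_outside_conj[OF qH, of "1 / 4" "3 / 4" h] h(2) unfolding q_ends by (simp add: comp_assoc)
  then have XB: "?q' \<circ> (h \<circ> q) \<in> B" using a s by (intro IH) (simp add: core_group_def)
  have qB: "q \<in> B" unfolding q_def by (intro B_comp B_int_pow gx_B gy_B)
  have "q \<circ> ((?q' \<circ> (h \<circ> q)) \<circ> ?q') \<in> B" by (rule B_comp[OF B_comp[OF B_inv[OF qB] XB] qB])
  also have "q \<circ> ((?q' \<circ> (h \<circ> q)) \<circ> ?q') = h" using qH by (simp add: fun_eq_iff)
  finally show ?thesis .
qed

text \<open>Induction on the number of chain intervals in the support: the restriction to the last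
  interval is split off as a factor.\<close>

lemma chain_product_in_B:
  assumes IH: "\<And>g. g \<in> core_group (m - 1) \<Longrightarrow> g \<in> B" and m: "0 \<le> m"
  shows "f \<in> core_group m \<Longrightarrow> (\<And>j. f (chain j) = chain j) \<Longrightarrow>
    fixes_outside (chain a) (chain (a + int n)) f \<Longrightarrow> f \<in> B"
proof (induction n arbitrary: f)
  case 0
  then have "f t = t" for t by (cases "t \<le> chain a") (auto simp: fixes_outside_def)
  then have "f = id" by (simp add: fun_eq_iff)
  then show ?case using id_B by (simp only:)
next
  case (Suc n)
  define b where "b = a + int n"
  have b: "a + int (Suc n) = b + 1" by (simp add: b_def)
  let ?h = "restr (chain b) (chain (b + 1)) f"
  let ?h' = "hinv ?h"
  have chain_low: "chain j \<in> low m" for j using m by (simp add: low_def chain_inner height_chain)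
  have ab: "chain a \<le> chain b" using chain_less_iff[of b a] by (simp add: b_def not_less[symmetric])
  have h: "?h \<in> core_group m"
    using chain_bounds[of b] chain_bounds[of "b + 1"]
    by (intro restr_core Suc.prems chain_low) auto
  have hH: "?h \<in> carrier Homeo" using h by (rule core_groupD(5))
  have inv_eq: "?h' s = t" if "?h t = s" for s t using that Homeo_inv_apply(2)[OF hH, of t] by simp
  have "fixes_outside (chain b) (chain (b + 1)) ?h"
    unfolding fixes_outside_def
  proof (intro allI impI)
    fix t assume "t \<le> chain b \<or> chain (b + 1) \<le> t"
    then show "?h t = t"
      using Suc.prems(2) by (cases "t = chain b \<or> t = chain (b + 1)") (auto simp: restr_def)
  qed
  then have hB: "?h \<in> B" using chain_piece_in_B[OF IH m h] by blast
  have "?h' \<circ> f \<in> B"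
  proof (rule Suc.IH)
    show "?h' \<circ> f \<in> core_group m" by (intro core_group_comp core_group_inv Suc.prems h)
    have hc: "?h (chain j) = chain j" for j using Suc.prems(2) by (simp add: restr_def)
    show "(?h' \<circ> f) (chain j) = chain j" for j
      using inv_eq[OF hc[of j]] Suc.prems(2) by simp
    show "fixes_outside (chain a) (chain (a + int n)) (?h' \<circ> f)"
      unfolding fixes_outside_def b_def[symmetric]
    proof (intro allI impI)
      fix t assume t: "t \<le> chain a \<or> chain b \<le> t"
      have "?h t = f t"
      proof (cases "chain b \<le> t \<and> t \<le> chain (b + 1)")
        case False
        then have "t \<le> chain a \<or> chain (b + 1) \<le> t" using t by auto
        then have "f t = t" using Suc.prems(3) unfolding b fixes_outside_def by blast
        then show ?thesis using False by (auto simp: restr_def)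
      qed (simp add: restr_def)
      from inv_eq[OF this] show "(?h' \<circ> f) t = t" by simp
    qed
  qed
  then have "?h \<circ> (?h' \<circ> f) \<in> B" by (rule B_comp[OF _ hB])
  also have "?h \<circ> (?h' \<circ> f) = f" using hH by (simp add: fun_eq_iff)
  finally show ?case .
qed

text \<open>The index is shifted by 1 so that the induction starts at the trivial stage
  \<open>-1\<close>.\<close>

lemma core_group_subset_B: "g \<in> core_group (int n - 1) \<Longrightarrow> g \<in> B"
proof (induction n arbitrary: g)
  case 0
  then have "g = id" using core_group_trivial by simp
  then show ?case using id_B by (simp only:)
next
  case (Suc n)
  have g: "g \<in> core_group (int n)" using Suc.prems by simp
  note D = core_groupD[OF g]
  have ends: "f (1 / 4) = 1 / 4" "f (3 / 4) = 3 / 4" if "f \<in> core_group m" for f m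
    using core_groupD(3)[OF that] by (simp_all add: fixes_outside_def)
  have "\<exists>n (k::int). \<forall>s\<in>{0..1 / 2 ^ n}. g (1 / 4 + s) = g (1 / 4) + 2 powi k * s"
    by (rule germ_right[OF D(4)]) simp_all
  then obtain k where k: "germ k g" unfolding germ_def ends(1)[OF g] by blast
  \<comment> \<open>This power makes the slope at 1/4 equal to 1, so that \<open>f\<close> is the
    identity on some interval to the right of 1/4.\<close>
  let ?u = "gx [^]\<^bsub>Homeo\<^esub> (- k)"
  have u: "?u \<in> core_group (int n)" by (rule gx_int_pow_core) simp
  define f where "f = ?u \<circ> g"
  have f: "f \<in> core_group (int n)" unfolding f_def by (rule core_group_comp[OF g u])
  note Df = core_groupD[OF f]
  have "germ 0 f" unfolding f_def using germ_comp[OF k germ_gx_int_pow[of "- k"]] by simp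
  then obtain n1 where n1: "\<forall>s\<in>{0..1 / 2 ^ n1}. f (1 / 4 + s) = 1 / 4 + s" unfolding germ_def by auto
  have low_fix: "f t = t" if "t \<le> 1 / 4 + 1 / 2 ^ n1" for t
  proof (cases "t \<le> 1 / 4")
    case True then show ?thesis using Df(3) by (simp add: fixes_outside_def)
  next
    case False then show ?thesis using n1[rule_format, of "t - 1 / 4"] that by simp
  qed
  have fc: "f (chain j) = chain j" for j
    by (rule height_shift_fixes_chain[OF Df(1,3) low_fix])
  have "\<exists>n (k::int). \<forall>s\<in>{0..1 / 2 ^ n}. f (3 / 4 - s) = f (3 / 4) - 2 powi k * s"
    by (rule germ_left[OF Df(4)]) simp_all
  then obtain n2 and l :: int where n2: "\<forall>s\<in>{0..1 / 2 ^ n2}. f (3 / 4 - s) = 3 / 4 - 2 powi l * s"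
    unfolding ends(2)[OF f] by blast
  define s :: real where "s = 1 / 2 ^ (n2 + 3)"
  have s: "0 < s" "s \<le> 1 / 2 ^ n2" unfolding s_def using half_power_mono(1)[of n2 3] by simp_all
  have c: "3 / 4 - s = chain (int (Suc n2))" using chain_near_ends(2)[of n2] by (simp add: s_def)
  \<comment> \<open>A fixed chain point inside the linear range at 3/4 forces slope 1 there too, so
    only finitely many chain intervals remain.\<close>
  have "f (3 / 4 - s) = 3 / 4 - 2 powi l * s" using n2 s by simp
  then have "2 powi l * s = s" using fc[of "int (Suc n2)"] unfolding c[symmetric] by simp
  then have l: "2 powi l = (1::real)" using s by simp
  have high_fix: "f t = t" if "3 / 4 - 1 / 2 ^ n2 \<le> t" for t
  proof (cases "3 / 4 \<le> t")
    case True then show ?thesis using Df(3) by (simp add: fixes_outside_def)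
  next
    case False then show ?thesis using n2[rule_format, of "3 / 4 - t"] that l by simp
  qed
  have "fixes_outside (chain (- int n1)) (chain (- int n1 + int (n1 + Suc n2))) f"
  proof -
    have "- int n1 + int (n1 + Suc n2) = int (Suc n2)" by simp
    then show ?thesis
      unfolding fixes_outside_def using low_fix high_fix chain_near_ends(1)[of n1] c s(2)
      by (metis diff_left_mono order_trans)
  qed
  then have fB: "f \<in> B"
    using chain_product_in_B[of "int n" f "- int n1" "n1 + Suc n2"] Suc.IH f fc by simp
  have uB: "?u \<in> B" by (intro B_int_pow gx_B)
  have "hinv ?u \<circ> f \<in> B" by (rule B_comp[OF fB B_inv[OF uB]])
  also have "hinv ?u \<circ> f = g" using core_groupD(5)[OF u] by (simp add: f_def fun_eq_iff)
  finally show ?case .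
qed

lemma compact_support_in_B:
  assumes "g \<in> height_shift 0" "fixes_outside (1 / 4) (3 / 4) g" shows "g \<in> B"
proof -
  obtain S where S: "finite S" "S \<subseteq> dyadic" "affine_off S g"
    using height_shiftD(1)[OF assms(1)] unfolding Thompson_F_iff by blast
  define m where "m = Max (insert 0 (height ` S))"
  have m: "height s \<le> m" if "s \<in> S" for s unfolding m_def using S(1) that by (intro Max_ge) auto
  have "0 \<le> m" unfolding m_def using S(1) by (intro Max_ge) auto
  have "affine_off (low m) g"
    unfolding affine_off_def
  proof (intro allI impI, elim conjE)
    fix p q :: real assume *: "0 \<le> p" "p < q" "q \<le> 1" "{p<..<q} \<inter> low m = {}"
    have "{p<..<q} \<inter> S = {}"
    proof -
      have False if "s \<in> S" "s \<in> {p<..<q}" for s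
      proof -
        have "s \<in> low m" using that S(2) m *(1,3) by (auto simp: low_def inner_dyadic_def)
        then show False using that * by blast
      qed
      then show ?thesis by blast
    qed
    then show "\<exists>(k::int) c. \<forall>t\<in>{p..q}. g t = 2 powi k * t + c"
      using S(3) * unfolding affine_off_def by blast
  qed
  moreover have "m = int (nat (m + 1)) - 1" using \<open>0 \<le> m\<close> by simp
  ultimately have "g \<in> core_group (int (nat (m + 1)) - 1)" using assms by (simp add: core_group_def)
  then show ?thesis by (rule core_group_subset_B)
qed

text \<open>Near 0 and 1 the map \<open>gy\<close> doubles the distance to the end point, so
  conjugation by it shrinks the support by one level, until [1/4, 3/4] is reached.\<close>

lemma outer_support_in_B:
  assumes "g \<in> height_shift 0" "fixes_outside (1 / 2 ^ (n + 2)) (1 - 1 / 2 ^ (n + 2)) g" shows "g \<in> B"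
  using assms
proof (induction n arbitrary: g)
  case 0
  then show ?case by (intro compact_support_in_B) (simp_all add: power2_eq_square)
next
  case (Suc n)
  let ?y' = "hinv gy"
  define e :: real where "e = 1 / 2 ^ (Suc n + 2)"
  have e2: "1 / 2 ^ (n + 2) = 2 * e" by (simp add: e_def)
  have "e \<le> 1 / 8" unfolding e_def by (simp add: power_add field_simps)
  moreover have "0 < e" by (simp add: e_def)
  ultimately have y: "gy e = 2 * e" "gy (1 - e) = 1 - 2 * e" by (auto simp: gy_eq)
  have y'': "hinv ?y' = gy" by (rule Homeo.inv_inv[OF gy_Homeo])
  have y'e: "?y' (2 * e) = e" "?y' (1 - 2 * e) = 1 - e"
    using Homeo_inv_apply(2)[OF gy_Homeo, of e] Homeo_inv_apply(2)[OF gy_Homeo, of "1 - e"] y by simp_all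
  have "fixes_outside (2 * e) (1 - 2 * e) (gy \<circ> g \<circ> ?y')"
    using fixes_outside_conj[of ?y' "2 * e" "1 - 2 * e" g] gy_Homeo Suc.prems(2)
    unfolding y'' y'e e_def[symmetric] by simp
  moreover have "gy \<circ> (g \<circ> ?y') \<in> height_shift 0"
    using height_shift_comp[OF height_shift_comp[OF height_shift_inv[OF gy_shift] Suc.prems(1)] gy_shift] by simp
  ultimately have XB: "gy \<circ> g \<circ> ?y' \<in> B" using Suc.IH unfolding e2 comp_assoc by blast
  have "?y' \<circ> ((gy \<circ> g \<circ> ?y') \<circ> gy) \<in> B" by (rule B_comp[OF B_comp[OF gy_B XB] B_inv[OF gy_B]])
  also have "?y' \<circ> ((gy \<circ> g \<circ> ?y') \<circ> gy) = g" using gy_Homeo by (simp add: fun_eq_iff)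
  finally show ?case .
qed

lemma height_shift_subset_B: assumes "g \<in> height_shift k" shows "g \<in> B"
proof -
  let ?u = "gy [^]\<^bsub>Homeo\<^esub> (- k)"
  have u: "?u \<in> height_shift (- k)" using height_shift_int_pow[OF gy_shift, of "- k"] by simp
  have f: "?u \<circ> g \<in> height_shift 0" using height_shift_comp[OF assms u] by simp
  obtain n where n: "\<And>t. t \<le> 1 / 2 ^ n \<Longrightarrow> (?u \<circ> g) t = t" "\<And>t. t \<ge> 1 - 1 / 2 ^ n \<Longrightarrow> (?u \<circ> g) t = t"
    using height_shift_0_germs[OF f] by blast
  have "fixes_outside (1 / 2 ^ (n + 2)) (1 - 1 / 2 ^ (n + 2)) (?u \<circ> g)"
    unfolding fixes_outside_def using n half_power_mono(1)[of n 2]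
    by (metis diff_left_mono order_trans)
  then have XB: "?u \<circ> g \<in> B" using f by (intro outer_support_in_B)
  have "hinv ?u \<circ> (?u \<circ> g) \<in> B" by (rule B_comp[OF XB B_inv[OF B_int_pow[OF gy_B]]])
  also have "hinv ?u \<circ> (?u \<circ> g) = g"
    using height_shiftD(2)[OF u] by (simp add: fun_eq_iff)
  finally show ?thesis .
qed

theorem B_eq_Int: "B = Thompson_F \<inter> conj_F psi"
proof
  show "Thompson_F \<inter> conj_F psi \<subseteq> B"
  proof
    fix g assume g: "g \<in> Thompson_F \<inter> conj_F psi"
    obtain k where "\<And>t. t \<in> inner_dyadic \<Longrightarrow> height (g t) = height t + k"
      using shifts_height[OF g] by blast
    then have "g \<in> height_shift k" using g by (simp add: height_shift_def)
    then show "g \<in> B" by (rule height_shift_subset_B)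
  qed
qed (rule B_subset)


section \<open>The word problem in the Brin--Navas group\<close>

abbreviation weq :: "'g word set \<Rightarrow> 'g word \<Rightarrow> 'g word \<Rightarrow> bool" where
  "weq Rel \<equiv> equivclp (insertion Rel)"

declare equivclp_trans [trans]

section \<open>Calculus of words modulo relators\<close>

lemma insertion_context:
  assumes "insertion Rel u w" shows "insertion Rel (a @ u @ b) (a @ w @ b)"
  using assms
proof cases
  case (cancel p q g e)
  then show ?thesis using insertion.cancel[of Rel "a @ p" "q @ b" g e] by simp
next
  case (relator r p q)
  then show ?thesis using insertion.relator[of r Rel "a @ p" "q @ b"] by simp
qed

lemma weq_context:
  assumes "weq Rel u w" shows "weq Rel (a @ u @ b) (a @ w @ b)"
  using assms
proof (induction rule: equivclp_induct)
  case (step y z)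
  have "weq Rel (a @ y @ b) (a @ z @ b)"
    using step.hyps(2) insertion_context[of Rel y z a b] insertion_context[of Rel z y a b]
    by (auto intro: r_into_equivclp equivclp_sym)
  with step.IH show ?case by (rule equivclp_trans)
qed simp

lemma weq_append: assumes "weq Rel u u'" "weq Rel w w'" shows "weq Rel (u @ w) (u' @ w')"
proof -
  have "weq Rel (u @ w) (u' @ w)" using weq_context[OF assms(1), of "[]" w] by simp
  moreover have "weq Rel (u' @ w) (u' @ w')" using weq_context[OF assms(2), of u' "[]"] by simp
  ultimately show ?thesis by (rule equivclp_trans)
qed

lemma weq_append_left: "weq Rel w w' \<Longrightarrow> weq Rel (u @ w) (u @ w')"
  by (rule weq_append) simp_all

lemma weq_append_right: "weq Rel u u' \<Longrightarrow> weq Rel (u @ w) (u' @ w)"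
  by (rule weq_append) simp_all

lemma word_inv_append: "word_inv (u @ w) = word_inv w @ word_inv u"
  by (simp add: word_inv_def)

lemma word_inv_inv [simp]: "word_inv (word_inv w) = w"
  by (induction w) (auto simp: word_inv_def)

lemma word_inv_Nil [simp]: "word_inv [] = []"
  by (simp add: word_inv_def)

lemma word_inv_Cons: "word_inv ((g, e) # w) = word_inv w @ [(g, \<not> e)]"
  by (simp add: word_inv_def)

lemma weq_inv_right: "weq Rel (w @ word_inv w) []"
proof (induction w)
  case (Cons x w)
  obtain g e where x: "x = (g, e)" by (cases x)
  have "weq Rel ([(g, e)] @ (w @ word_inv w) @ [(g, \<not> e)]) ([(g, e)] @ [] @ [(g, \<not> e)])"
    by (rule weq_context[OF Cons.IH])
  also have "weq Rel \<dots> []"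
    using insertion.cancel[of Rel "[]" "[]" g e] by (auto intro: equivclp_sym r_into_equivclp)
  finally show ?case by (simp add: x word_inv_Cons)
qed simp

lemma weq_inv_left: "weq Rel (word_inv w @ w) []"
  using weq_inv_right[of Rel "word_inv w"] by simp

lemma weq_relator: "r \<in> Rel \<Longrightarrow> weq Rel r []"
  using insertion.relator[of r Rel "[]" "[]"] by (auto intro: equivclp_sym r_into_equivclp)

lemma weq_cancel_left: "weq Rel (word_inv u @ u @ w) w" "weq Rel (u @ word_inv u @ w) w"
  using weq_append_right[OF weq_inv_left[of Rel u], of w] weq_append_right[OF weq_inv_right[of Rel u], of w]
  by simp_all

lemma weq_if_comm:
  assumes "weq Rel (word_comm u w) []" shows "weq Rel (u @ w) (w @ u)"
proof -
  have "weq Rel (u @ w) (w @ (word_inv w @ (u @ w)))" by (rule equivclp_sym[OF weq_cancel_left(2)])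
  also have "weq Rel \<dots> (w @ (u @ word_inv u @ (word_inv w @ u @ w)))"
    using weq_append_left[OF equivclp_sym[OF weq_cancel_left(2)[of Rel u "word_inv w @ u @ w"]], of w] by simp
  also have "weq Rel \<dots> ((w @ u) @ [])"
    using weq_append_left[OF assms, of "w @ u"] by (simp add: word_comm_def)
  finally show ?thesis by simp
qed

lemma weq_commute_inv:
  assumes "weq Rel (u @ w) (w @ u)" shows "weq Rel (word_inv u @ w) (w @ word_inv u)"
proof -
  have "weq Rel (word_inv u @ w) (word_inv u @ (w @ u) @ word_inv u)"
    using weq_append_left[OF equivclp_sym[OF weq_inv_right[of Rel u]], of "word_inv u @ w"] by simp
  also have "weq Rel \<dots> (word_inv u @ (u @ w) @ word_inv u)"
    by (rule weq_context[OF equivclp_sym[OF assms]])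
  also have "weq Rel \<dots> (w @ word_inv u)"
    using weq_cancel_left(1)[of Rel u "w @ word_inv u"] by simp
  finally show ?thesis .
qed

lemma word_conj_inv: "word_conj (word_inv u) v = word_inv (word_conj u v)"
  by (simp add: word_conj_def word_inv_append)

lemma weq_conj: "weq Rel u u' \<Longrightarrow> weq Rel (word_conj u v) (word_conj u' v)"
  unfolding word_conj_def by (rule weq_context)

lemma weq_conj_Nil: "weq Rel (word_conj [] v) []"
  using weq_inv_left by (simp add: word_conj_def)

lemma weq_conj_append: "weq Rel (word_conj (u @ w) v) (word_conj u v @ word_conj w v)"
proof -
  have "weq Rel ((word_inv v @ u) @ (w @ v)) ((word_inv v @ u) @ (v @ word_inv v @ (w @ v)))"
    by (rule weq_append_left[OF equivclp_sym[OF weq_cancel_left(2)]])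
  then show ?thesis by (simp add: word_conj_def)
qed

lemma weq_conj_conj:
  assumes "weq Rel v (v1 @ v2)" "weq Rel (word_inv v) (word_inv v2 @ word_inv v1)"
  shows "weq Rel (word_conj u v) (word_conj (word_conj u v1) v2)"
  using weq_append[OF assms(2) weq_append_left[OF assms(1), of u]] by (simp add: word_conj_def)

lemma weq_word_inv: assumes "weq Rel u w" shows "weq Rel (word_inv u) (word_inv w)"
proof -
  have "weq Rel (word_inv u) (word_inv u @ (w @ word_inv w))"
    using weq_append_left[OF equivclp_sym[OF weq_inv_right[of Rel w]], of "word_inv u"] by simp
  also have "weq Rel \<dots> (word_inv u @ u @ word_inv w)"
    by (rule weq_append_left, rule weq_append_right, rule equivclp_sym, rule assms)
  also have "weq Rel \<dots> (word_inv w)" by (rule weq_cancel_left)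
  finally show ?thesis .
qed

lemma word_pow_0 [simp]: "word_pow w 0 = []"
  by (simp add: word_pow_def)

lemma weq_pow_Suc: "weq Rel (w @ word_pow w k) (word_pow w (k + 1))"
proof (cases "k \<ge> 0")
  case True
  then have "nat (k + 1) = Suc (nat k)" by simp
  then have "word_pow w (k + 1) = w @ word_pow w k" using True by (simp add: word_pow_def)
  then show ?thesis by simp
next
  case False
  then have "nat (- k) = Suc (nat (- (k + 1)))" by simp
  then have "word_pow w k = word_inv w @ word_pow w (k + 1)" using False by (auto simp: word_pow_def)
  then show ?thesis by (simp add: weq_cancel_left)
qed

lemma weq_pow_pred: "weq Rel (word_inv w @ word_pow w k) (word_pow w (k - 1))"
proof -
  have "weq Rel (word_inv w @ word_pow w k) (word_inv w @ (w @ word_pow w (k - 1)))"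
    using weq_append_left[OF equivclp_sym[OF weq_pow_Suc[of Rel w "k - 1"]], of "word_inv w"] by simp
  also have "weq Rel \<dots> (word_pow w (k - 1))" by (rule weq_cancel_left)
  finally show ?thesis .
qed

lemma weq_pow_add: "weq Rel (word_pow w (j + k)) (word_pow w j @ word_pow w k)"
proof (induction j rule: int_induct[where k = 0])
  case base
  then show ?case by simp
next
  case (step1 j)
  have "weq Rel (word_pow w (j + 1 + k)) (w @ word_pow w (j + k))"
    using equivclp_sym[OF weq_pow_Suc[of Rel w "j + k"]] by (simp add: algebra_simps)
  also have "weq Rel \<dots> ((w @ word_pow w j) @ word_pow w k)"
    using weq_append_left[OF step1(2), of w] by simp
  also have "weq Rel \<dots> (word_pow w (j + 1) @ word_pow w k)"
    by (rule weq_append_right[OF weq_pow_Suc])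
  finally show ?case .
next
  case (step2 j)
  have "weq Rel (word_pow w (j - 1 + k)) (word_inv w @ word_pow w (j + k))"
    using equivclp_sym[OF weq_pow_pred[of Rel w "j + k"]] by (simp add: algebra_simps)
  also have "weq Rel \<dots> ((word_inv w @ word_pow w j) @ word_pow w k)"
    using weq_append_left[OF step2(2), of "word_inv w"] by simp
  also have "weq Rel \<dots> (word_pow w (j - 1) @ word_pow w k)"
    by (rule weq_append_right[OF weq_pow_pred])
  finally show ?case .
qed

text \<open>Moves all letters \<open>p\<close> to the front; a word \<open>x\<close> in
  \<open>X\<close> that is passed by \<open>p^e\<close> becomes its conjugate, since x p^e = p^e
  (p^-e x p^e). It is used with \<open>p\<close> the shift and with \<open>p\<close> each
  \<open>bn_base m\<close>.\<close>

lemma weq_collect: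
  assumes "set xs \<subseteq> {p, word_inv p} \<union> X"
  shows "\<exists>e H. snd ` set H \<subseteq> X \<and>
    weq Rel (concat xs) (word_pow p e @ concat (map (\<lambda>(k, x). word_conj x (word_pow p k)) H))"
  using assms
proof (induction xs)
  case Nil
  show ?case by (intro exI[of _ 0] exI[of _ "[]"]) simp
next
  case (Cons c xs)
  then obtain e H where H: "snd ` set H \<subseteq> X"
    "weq Rel (concat xs) (word_pow p e @ concat (map (\<lambda>(k, x). word_conj x (word_pow p k)) H))" (is "weq Rel _ (_ @ ?V)")
    by auto
  have c: "weq Rel (concat (c # xs)) ((c @ word_pow p e) @ ?V)"
    using weq_append_left[OF H(2), of c] by simp
  consider "c = p" | "c = word_inv p" | "c \<in> X" using Cons.prems by auto
  then show ?case
  proof cases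
    case 1
    have "weq Rel (concat (c # xs)) (word_pow p (e + 1) @ ?V)"
      using equivclp_trans[OF c weq_append_right] weq_pow_Suc[of Rel p e] unfolding 1 by blast
    then show ?thesis using H(1) by blast
  next
    case 2
    have "weq Rel (concat (c # xs)) (word_pow p (e - 1) @ ?V)"
      using equivclp_trans[OF c weq_append_right] weq_pow_pred[of Rel p e] unfolding 2 by blast
    then show ?thesis using H(1) by blast
  next
    case 3
    have "weq Rel ((c @ word_pow p e) @ ?V) (word_pow p e @ word_inv (word_pow p e) @ ((c @ word_pow p e) @ ?V))"
      by (rule equivclp_sym[OF weq_cancel_left(2)])
    then have "weq Rel (concat (c # xs)) (word_pow p e @ concat (map (\<lambda>(k, x). word_conj x (word_pow p k)) ((e, c) # H)))"
      using equivclp_trans[OF c] by (simp add: word_conj_def)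
    moreover have "snd ` set ((e, c) # H) \<subseteq> X" using H(1) 3 by simp
    ultimately show ?thesis by blast
  qed
qed

lemma weq_concat_conj:
  "weq Rel (concat (map (\<lambda>x. word_conj x v) xs)) (word_conj (concat xs) v)"
proof (induction xs)
  case Nil
  show ?case using equivclp_sym[OF weq_conj_Nil[of Rel v]] by simp
next
  case (Cons x xs)
  have "weq Rel (concat (map (\<lambda>x. word_conj x v) (x # xs))) (word_conj x v @ word_conj (concat xs) v)"
    using weq_append_left[OF Cons.IH] by simp
  also have "weq Rel \<dots> (word_conj (concat (x # xs)) v)"
    using equivclp_sym[OF weq_conj_append[of Rel x "concat xs" v]] by simp
  finally show ?case .
qed

lemma weq_commute_concat:
  assumes "\<And>x. x \<in> set xs \<Longrightarrow> weq Rel (x @ y) (y @ x)"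
  shows "weq Rel (concat xs @ y) (y @ concat xs)"
  using assms
proof (induction xs)
  case (Cons x xs)
  have "weq Rel (concat (x # xs) @ y) (x @ (y @ concat xs))"
    using weq_append_left[OF Cons.IH, of x] Cons.prems by simp
  also have "weq Rel \<dots> ((y @ x) @ concat xs)"
    using weq_append_right[OF Cons.prems[of x], of "concat xs"] by simp
  finally show ?case by simp
qed simp

text \<open>Factors with different indices commute, so those of index \<open>k\<close> can be
  gathered in front without changing the order within either group.\<close>

lemma weq_partition:
  assumes "\<And>a b. a \<in> set H \<Longrightarrow> b \<in> set H \<Longrightarrow> fst a \<noteq> fst b \<Longrightarrow> weq Rel (f a @ f b) (f b @ f a)"
  shows "weq Rel (concat (map f H))
    (concat (map f (filter (\<lambda>a. fst a = k) H)) @ concat (map f (filter (\<lambda>a. fst a \<noteq> k) H)))"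
  using assms
proof (induction H)
  case (Cons a H)
  let ?H1 = "concat (map f (filter (\<lambda>a. fst a = k) H))" and ?H2 = "concat (map f (filter (\<lambda>a. fst a \<noteq> k) H))"
  have IH: "weq Rel (f a @ concat (map f H)) (f a @ ?H1 @ ?H2)"
    by (rule weq_append_left[OF Cons.IH]) (use Cons.prems in simp)
  show ?case
  proof (cases "fst a = k")
    case True
    then show ?thesis using IH by simp
  next
    case False
    have "weq Rel (?H1 @ f a) (f a @ ?H1)"
    proof (rule weq_commute_concat)
      fix x assume "x \<in> set (map f (filter (\<lambda>a. fst a = k) H))"
      then obtain b where "b \<in> set H" "fst b = k" "x = f b" by auto
      then show "weq Rel (x @ f a) (f a @ x)" using Cons.prems[of b a] False by simp
    qed
    then have "weq Rel (f a @ ?H1 @ ?H2) (?H1 @ f a @ ?H2)"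
      using weq_append_right[OF equivclp_sym, of Rel "?H1 @ f a" "f a @ ?H1" ?H2] by simp
    with IH have "weq Rel (f a @ concat (map f H)) (?H1 @ f a @ ?H2)" by (rule equivclp_trans)
    then show ?thesis using False by simp
  qed
qed simp

subsection \<open>Evaluation of words\<close>

fun gen :: "bn_gen \<Rightarrow> real \<Rightarrow> real" where
  "gen Shift = gy"
| "gen Base = gx"

fun ev :: "bn_gen word \<Rightarrow> real \<Rightarrow> real" where
  "ev [] = id"
| "ev ((g, e) # w) = ev w \<circ> (if e then gen g else hinv (gen g))"

lemma gen_B: "gen g \<in> B"
  by (cases g) (simp_all add: gx_B gy_B)

lemma ev_B: "ev w \<in> B"
proof (induction w)
  case Nil
  show ?case unfolding ev.simps by (rule id_B)
next
  case (Cons x w)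
  obtain g e where x: "x = (g, e)" by (cases x)
  have "(if e then gen g else hinv (gen g)) \<in> B" using gen_B B_inv by simp
  then show ?case unfolding x ev.simps using Cons.IH by (rule B_comp)
qed

lemma ev_Homeo: "ev w \<in> carrier Homeo"
  using ev_B subgroup.mem_carrier[OF subgroup_B] by blast

lemma ev_append: "ev (u @ w) = ev w \<circ> ev u"
proof (induction u)
  case (Cons x u)
  then show ?case by (cases x) (simp add: comp_assoc)
qed simp

lemma ev_append_Homeo: "ev (u @ w) = ev u \<otimes>\<^bsub>Homeo\<^esub> ev w"
  by (simp add: ev_append)

lemma ev_word_inv: "ev (word_inv w) = hinv (ev w)"
proof (induction w)
  case Nil
  show ?case using Homeo.inv_one by (simp only: ev.simps word_inv_Nil Homeo_simps)
next
  case (Cons x w)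
  obtain g e where x: "x = (g, e)" by (cases x)
  have gH: "gen g \<in> carrier Homeo" by (cases g) (simp_all add: gx_Homeo gy_Homeo)
  let ?a = "if e then gen g else hinv (gen g)"
  have aH: "?a \<in> carrier Homeo" using gH by simp
  have "ev [(g, \<not> e)] = hinv ?a" using gH by simp
  then have "ev (word_inv (x # w)) = hinv (ev w) \<otimes>\<^bsub>Homeo\<^esub> hinv ?a"
    unfolding x word_inv_Cons ev_append_Homeo Cons.IH by simp
  also have "\<dots> = hinv (?a \<otimes>\<^bsub>Homeo\<^esub> ev w)"
    by (rule Homeo.inv_mult_group[OF aH ev_Homeo, symmetric])
  also have "?a \<otimes>\<^bsub>Homeo\<^esub> ev w = ev (x # w)" by (simp add: x)
  finally show ?case .
qed

lemma ev_word_pow: "ev (word_pow w k) = ev w [^]\<^bsub>Homeo\<^esub> k"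
proof -
  have rep: "ev (concat (replicate n w)) = ev w [^]\<^bsub>Homeo\<^esub> n" for n w
  proof (induction n)
    case 0 show ?case by simp
  next
    case (Suc n)
    have "ev (concat (replicate (Suc n) w)) = ev w \<otimes>\<^bsub>Homeo\<^esub> ev (concat (replicate n w))"
      unfolding replicate_Suc concat.simps ev_append_Homeo ..
    then show ?case unfolding Suc.IH Homeo.nat_pow_Suc2[OF ev_Homeo] .
  qed
  show ?thesis
  proof (cases k rule: int_cases2)
    case (nonneg n)
    then show ?thesis using rep[of n w] by (simp add: word_pow_def int_pow_int)
  next
    case (nonpos n)
    have "word_pow w k = concat (replicate n (word_inv w))"
      unfolding nonpos word_pow_def by (cases "n = 0") simp_all
    then have "ev (word_pow w k) = hinv (ev w) [^]\<^bsub>Homeo\<^esub> n"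
      using rep[of n "word_inv w"] by (simp only: ev_word_inv)
    also have "\<dots> = hinv (ev w [^]\<^bsub>Homeo\<^esub> n)" by (rule Homeo.nat_pow_inv[OF ev_Homeo])
    finally show ?thesis unfolding nonpos Homeo.int_pow_neg[OF ev_Homeo] int_pow_int .
  qed
qed

lemma ev_word_conj: "ev (word_conj u w) = ev w \<circ> ev u \<circ> hinv (ev w)"
  by (simp add: word_conj_def ev_append ev_word_inv comp_assoc)

lemma ev_concat_id_on: "(\<And>x. x \<in> set xs \<Longrightarrow> ev x t = t) \<Longrightarrow> ev (concat xs) t = t"
  by (induction xs) (simp_all add: ev_append)

lemma ev_concat_fixes_outside:
  "(\<And>x. x \<in> set xs \<Longrightarrow> fixes_outside a b (ev x)) \<Longrightarrow> fixes_outside a b (ev (concat xs))"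
  by (auto simp: fixes_outside_def intro: ev_concat_id_on)

subsection \<open>Supports\<close>

abbreviation ypow :: "int \<Rightarrow> real \<Rightarrow> real" where
  "ypow m \<equiv> gy [^]\<^bsub>Homeo\<^esub> m"

lemma ypow_Homeo: "ypow m \<in> carrier Homeo"
  using gy_Homeo by (rule Homeo.int_pow_closed)

lemma ypow_Suc: "ypow (m + 1) t = ypow m (gy t)"
proof -
  have "ypow (1 + m) = ypow 1 \<otimes>\<^bsub>Homeo\<^esub> ypow m" by (rule Homeo.int_pow_mult[OF gy_Homeo])
  then show ?thesis using gy_Homeo by (simp add: add.commute Homeo.int_pow_1)
qed

text \<open>\<open>gy\<close> sends 1/4 and 3/4 to the neighbouring chain points 1/2 and 5/8. Hence
  the support of \<open>bn_base (m + 1)\<close> lies in a fundamental interval of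
  \<open>bn_base m\<close>.\<close>

lemma ypow_ends: "ypow (m + 1) (1 / 4) = ypow m (chain 0)" "ypow (m + 1) (3 / 4) = ypow m (chain 1)"
  by (simp_all add: ypow_Suc gy_eq chain_0_1)

lemma ypow_nested: "m \<le> i \<Longrightarrow> ypow m (1 / 4) \<le> ypow i (1 / 4) \<and> ypow i (3 / 4) \<le> ypow m (3 / 4)"
proof (induction i rule: int_ge_induct)
  case (step i)
  have "ypow i (1 / 4) \<le> ypow (i + 1) (1 / 4)" "ypow (i + 1) (3 / 4) \<le> ypow i (3 / 4)"
    unfolding ypow_ends using Homeo_le_iff[OF ypow_Homeo] by (simp_all add: chain_0_1)
  then show ?case using step.IH by linarith
qed simp

definition letters :: "int \<Rightarrow> bn_gen word set" where
  "letters i = {bn_base i, word_inv (bn_base i)}"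

lemma ev_bn_base: "ev (bn_base i) = ypow i \<circ> gx \<circ> hinv (ypow i)"
proof -
  have "ev [(Shift, True)] = gy" "ev [(Base, True)] = gx" by simp_all
  then show ?thesis unfolding bn_base_def ev_word_conj ev_word_pow by (simp only:)
qed

lemma fixes_outside_conj':
  assumes q: "q \<in> carrier Homeo" and f: "fixes_outside a b f"
  shows "fixes_outside (q a) (q b) (q \<circ> f \<circ> hinv q)"
proof -
  have "fixes_outside (q a) (q b) (hinv (hinv q) \<circ> f \<circ> hinv q)"
    by (rule fixes_outside_conj) (use q f in simp_all)
  then show ?thesis unfolding Homeo.inv_inv[OF q] .
qed

lemma bn_base_fixes_outside: "fixes_outside (ypow i (1 / 4)) (ypow i (3 / 4)) (ev (bn_base i))"
  unfolding ev_bn_base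
  by (rule fixes_outside_conj'[OF ypow_Homeo]) (rule core_groupD(3)[OF gx_core[of 0]], simp)

lemma fixes_outside_mono: "fixes_outside c d f \<Longrightarrow> a \<le> c \<Longrightarrow> d \<le> b \<Longrightarrow> fixes_outside a b f"
  unfolding fixes_outside_def by (meson order_trans)

lemma letter_fixes_outside:
  assumes "x \<in> letters i" "m < i"
  shows "fixes_outside (ypow m (chain 0)) (ypow m (chain 1)) (ev x)"
proof -
  have "fixes_outside (ypow m (chain 0)) (ypow m (chain 1)) (ev (bn_base i))"
    unfolding ypow_ends[symmetric]
    using ypow_nested[of "m + 1" i] assms(2) by (intro fixes_outside_mono[OF bn_base_fixes_outside]) auto
  then show ?thesis
    using assms(1) fixes_outside_inv[OF ev_Homeo] by (auto simp: letters_def ev_word_inv)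
qed

lemma ev_bn_base_pow_chain: "ev (word_pow (bn_base m) k) (ypow m (chain i)) = ypow m (chain (i + k))"
proof -
  have "\<forall>i. (ev (bn_base m) [^]\<^bsub>Homeo\<^esub> k) (ypow m (chain i)) = ypow m (chain (i + k * 1))"
  proof (rule Homeo_int_pow_induct[where P = "\<lambda>k a. \<forall>i. a (ypow m (chain i)) = ypow m (chain (i + k))"])
    show "\<forall>i. ev (bn_base m) (ypow m (chain i)) = ypow m (chain (i + 1))"
      by (simp add: ev_bn_base gx_chain ypow_Homeo)
    show "\<forall>i. (hinv a) (ypow m (chain i)) = ypow m (chain (i + - k))"
      if a: "a \<in> carrier Homeo" "\<forall>i. a (ypow m (chain i)) = ypow m (chain (i + k))" for k a
    proof
      fix i
      have "a (ypow m (chain (i - k))) = ypow m (chain i)" using a(2) by simp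
      then show "(hinv a) (ypow m (chain i)) = ypow m (chain (i + - k))"
        using Homeo_inv_apply(2)[OF a(1), of "ypow m (chain (i - k))"] by simp
    qed
  qed (auto simp: ev_Homeo algebra_simps)
  then show ?thesis by (simp add: ev_word_pow)
qed

lemma conj_fixes_outside:
  assumes "fixes_outside (ypow m (chain 0)) (ypow m (chain 1)) (ev x)"
  shows "fixes_outside (ypow m (chain k)) (ypow m (chain (k + 1))) (ev (word_conj x (word_pow (bn_base m) k)))"
  using fixes_outside_conj'[OF ev_Homeo assms, of "word_pow (bn_base m) k"]
  unfolding ev_word_conj ev_bn_base_pow_chain by (simp add: add.commute)

lemma fixes_outside_commute:
  assumes f: "f \<in> carrier Homeo" "fixes_outside a b f" and g: "g \<in> carrier Homeo" "fixes_outside c d g"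
    and "b \<le> c"
  shows "g \<circ> f = f \<circ> g"
proof
  fix t
  have fb: "f b = b" and gc: "g c = c" using f(2) g(2) by (auto simp: fixes_outside_def)
  show "(g \<circ> f) t = (f \<circ> g) t"
  proof (cases "t \<le> b")
    case True
    then have "f t \<le> b" using Homeo_le_iff[OF f(1), of t b] fb by simp
    then show ?thesis using True assms(5) g(2) by (simp add: fixes_outside_def)
  next
    case False
    then have "b \<le> g t"
    proof (cases "t \<le> c")
      case True then show ?thesis using False g(2) by (simp add: fixes_outside_def)
    next
      case False
      then have "c \<le> g t" using Homeo_le_iff[OF g(1), of c t] gc by simp
      then show ?thesis using assms(5) by simp
    qed
    then show ?thesis using False f(2) by (simp add: fixes_outside_def)
  qed
qed

subsection \<open>The relators hold\<close>

abbreviation bn_relators :: "bn_gen word set" where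
  "bn_relators \<equiv> {word_comm (word_conj (bn_base i) (word_pow (bn_base m) k)) (bn_base j) | i j m k.
        m < i \<and> m < j \<and> k \<noteq> 0}"

text \<open>Both \<open>bn_base i\<close> and \<open>bn_base j\<close> live on the interval with
  index 0 of the chain moved by \<open>ypow m\<close>. Conjugation takes the first to the interval
  with index \<open>k\<close>, and maps with disjoint supports commute.\<close>

lemma ev_relator: assumes "r \<in> bn_relators" shows "ev r = id"
proof -
  obtain i j m k where r: "r = word_comm (word_conj (bn_base i) (word_pow (bn_base m) k)) (bn_base j)"
    and ij: "m < i" "m < j" and k: "k \<noteq> 0" using assms by blast
  let ?u = "word_conj (bn_base i) (word_pow (bn_base m) k)" and ?w = "bn_base j"
  have u: "fixes_outside (ypow m (chain k)) (ypow m (chain (k + 1))) (ev ?u)"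
    by (rule conj_fixes_outside, rule letter_fixes_outside[OF _ ij(1)]) (simp add: letters_def)
  have w: "fixes_outside (ypow m (chain 0)) (ypow m (chain 1)) (ev ?w)"
    by (rule letter_fixes_outside[OF _ ij(2)]) (simp add: letters_def)
  have le: "ypow m (chain i) \<le> ypow m (chain j)" if "i \<le> j" for i j
    using that chain_less_iff[of j i] Homeo_le_iff[OF ypow_Homeo] by (simp add: not_less[symmetric])
  have "ev ?w \<circ> ev ?u = ev ?u \<circ> ev ?w"
  proof (cases "k < 0")
    case True
    then show ?thesis by (intro fixes_outside_commute[OF ev_Homeo u ev_Homeo w] le) simp
  next
    case False
    then show ?thesis
      using k by (intro fixes_outside_commute[OF ev_Homeo w ev_Homeo u, symmetric] le) simp
  qed
  then have "ev ?w (ev ?u t) = ev ?u (ev ?w t)" for t by (simp add: fun_eq_iff)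
  then show ?thesis unfolding r word_comm_def ev_append ev_word_inv
    by (simp add: fun_eq_iff ev_Homeo)
qed

lemma weq_ev: assumes "weq bn_relators u w" shows "ev u = ev w"
  using assms
proof (induction rule: equivclp_induct)
  case (step y z)
  have ins: "ev u = ev w" if "insertion bn_relators u w" for u w
    using that
  proof cases
    case (cancel p q g e)
    have "gen g \<in> carrier Homeo" by (cases g) (simp_all add: gx_Homeo gy_Homeo)
    then show ?thesis unfolding cancel by (simp add: ev_append fun_eq_iff)
  next
    case (relator r p q)
    then show ?thesis using ev_relator[of r] by (simp only: ev_append) simp
  qed
  show ?case using step.hyps(2) step.IH ins[of y z] ins[of z y] by auto
qed simp

subsection \<open>Faithfulness\<close>

text \<open>The relators give the case of positive letters with \<open>k'\<close> equal to 0.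
  Inverses follow from \<open>weq_commute_inv\<close>, the general case by conjugation with the
  power \<open>k'\<close>.\<close>

lemma letters_commute:
  assumes x: "x \<in> letters i" "x' \<in> letters j" and m: "m < i" "m < j" and k: "k \<noteq> k'"
  shows "weq bn_relators (word_conj x (word_pow (bn_base m) k) @ word_conj x' (word_pow (bn_base m) k'))
    (word_conj x' (word_pow (bn_base m) k') @ word_conj x (word_pow (bn_base m) k))"
proof -
  let ?P = "word_pow (bn_base m)"
  let ?Q = "weq bn_relators"
  have base: "?Q (word_conj (bn_base i) (?P (k - k')) @ bn_base j) (bn_base j @ word_conj (bn_base i) (?P (k - k')))"
    by (rule weq_if_comm, rule weq_relator, rule CollectI, intro exI conjI, rule refl) (use m k in simp_all)
  have x1: "?Q (word_conj x (?P (k - k')) @ bn_base j) (bn_base j @ word_conj x (?P (k - k')))"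
    using x(1) base weq_commute_inv[OF base] by (auto simp: letters_def word_conj_inv)
  have x2: "?Q (word_conj x (?P (k - k')) @ x') (x' @ word_conj x (?P (k - k')))"
    using x(2) x1 equivclp_sym[OF weq_commute_inv[OF equivclp_sym[OF x1]]] by (auto simp: letters_def)
  have add: "?Q (?P k) (?P (k - k') @ ?P k')" using weq_pow_add[of bn_relators "bn_base m" "k - k'" k'] by simp
  have e: "?Q (word_conj x (?P k)) (word_conj (word_conj x (?P (k - k'))) (?P k'))"
    using weq_word_inv[OF add] by (intro weq_conj_conj[OF add]) (simp add: word_inv_append)
  have "?Q (word_conj x (?P k) @ word_conj x' (?P k')) (word_conj (word_conj x (?P (k - k'))) (?P k') @ word_conj x' (?P k'))"
    by (rule weq_append_right[OF e])
  also have "?Q \<dots> (word_conj (word_conj x (?P (k - k')) @ x') (?P k'))"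
    by (rule equivclp_sym[OF weq_conj_append])
  also have "?Q \<dots> (word_conj (x' @ word_conj x (?P (k - k'))) (?P k'))"
    by (rule weq_conj[OF x2])
  also have "?Q \<dots> (word_conj x' (?P k') @ word_conj (word_conj x (?P (k - k'))) (?P k'))"
    by (rule weq_conj_append)
  also have "?Q \<dots> (word_conj x' (?P k') @ word_conj x (?P k))"
    by (rule weq_append_left[OF equivclp_sym[OF e]])
  finally show ?thesis .
qed

definition letter_range :: "int \<Rightarrow> nat \<Rightarrow> bn_gen word set" where
  "letter_range m n = (\<Union>i\<in>{m..<m + int n}. letters i)"

lemma ev_conj_eq_id: assumes "ev (word_conj u v) = id" shows "ev u = id"
proof
  fix t
  have "ev v (ev u t) = ev v t"
    using fun_cong[OF assms, of "ev v t"] by (simp add: ev_word_conj ev_Homeo)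
  then show "ev u t = id t" by (simp add: Homeo_eq_iff[OF ev_Homeo])
qed

text \<open>In a product of conjugates \<open>x\<^sup>p\<^sup>k\<close>, the factors with different \<open>k\<close> have disjoint supports, so that
  each of the partial products with constant \<open>k\<close> must be trivial.\<close>

lemma conj_product_trivial:
  assumes IH: "\<And>xs. set xs \<subseteq> letter_range (m + 1) n \<Longrightarrow> ev (concat xs) = id \<Longrightarrow> weq bn_relators (concat xs) []"
  shows "snd ` set H \<subseteq> letter_range (m + 1) n \<Longrightarrow>
    ev (concat (map (\<lambda>(k, x). word_conj x (word_pow (bn_base m) k)) H)) = id \<Longrightarrow>
    weq bn_relators (concat (map (\<lambda>(k, x). word_conj x (word_pow (bn_base m) k)) H)) []"
proof (induction "length H" arbitrary: H rule: less_induct)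
  case less
  define f where "f = (\<lambda>(k, x). word_conj x (word_pow (bn_base m) k))"
  have f: "f (k, x) = word_conj x (word_pow (bn_base m) k)" for k x by (simp add: f_def)
  have letter: "\<exists>i. m < i \<and> snd a \<in> letters i" if "a \<in> set H" for a
  proof -
    have "snd a \<in> letter_range (m + 1) n" using less.prems(1) that by blast
    then obtain i where "i \<in> {m + 1..<m + 1 + int n}" "snd a \<in> letters i"
      unfolding letter_range_def by blast
    then show ?thesis by (intro exI[of _ i]) simp
  qed
  have supp: "fixes_outside (ypow m (chain (fst a))) (ypow m (chain (fst a + 1))) (ev (f a))" if a: "a \<in> set H" for a
  proof -
    obtain i where "m < i" "snd a \<in> letters i" using letter[OF a] by blast
    then have "fixes_outside (ypow m (chain 0)) (ypow m (chain 1)) (ev (snd a))"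
      by (intro letter_fixes_outside)
    from conj_fixes_outside[OF this, of "fst a"] show ?thesis by (simp add: f_def case_prod_unfold)
  qed
  show ?case
  proof (cases H)
    case Nil
    then show ?thesis by simp
  next
    case (Cons a0 H')
    define k where "k = fst a0"
    define H1 where "H1 = filter (\<lambda>a. fst a = k) H"
    define H2 where "H2 = filter (\<lambda>a. fst a \<noteq> k) H"
    let ?W1 = "concat (map f H1)" and ?W2 = "concat (map f H2)"
    have part: "weq bn_relators (concat (map f H)) (?W1 @ ?W2)"
      unfolding H1_def H2_def
    proof (rule weq_partition)
      fix a b assume ab: "a \<in> set H" "b \<in> set H" "fst a \<noteq> fst b"
      obtain i j where "m < i" "snd a \<in> letters i" "m < j" "snd b \<in> letters j"
        using letter[OF ab(1)] letter[OF ab(2)] by blast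
      then show "weq bn_relators (f a @ f b) (f b @ f a)"
        using letters_commute[of "snd a" i "snd b" j m "fst a" "fst b"] ab(3) by (simp add: f_def case_prod_unfold)
    qed
    have "ev (?W1 @ ?W2) = id" by (rule trans[OF weq_ev[OF part, symmetric]]) (use less.prems(2) in \<open>simp only: f_def\<close>)
    then have comp: "ev ?W2 (ev ?W1 t) = t" for t by (simp add: ev_append fun_eq_iff)
    let ?a = "ypow m (chain k)" and ?b = "ypow m (chain (k + 1))"
    have s1: "fixes_outside ?a ?b (ev ?W1)"
      by (rule ev_concat_fixes_outside) (use supp in \<open>auto simp: H1_def\<close>)
    \<comment> \<open>The factors of \<open>?W2\<close> are supported in other intervals of the
      chain. As \<open>?W1\<close> maps the \<open>k\<close>-th interval to itself, the trivial
      product equals \<open>?W1\<close> there.\<close>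
    have s2: "ev ?W2 t = t" if t: "?a \<le> t" "t \<le> ?b" for t
    proof (rule ev_concat_id_on)
      fix x assume "x \<in> set (map f H2)"
      then obtain b where b: "b \<in> set H" "fst b \<noteq> k" "x = f b" unfolding H2_def by auto
      have le: "ypow m (chain i) \<le> ypow m (chain j)" if "i \<le> j" for i j
        using that chain_less_iff[of j i] Homeo_le_iff[OF ypow_Homeo] by (simp add: not_less[symmetric])
      have "t \<le> ypow m (chain (fst b)) \<or> ypow m (chain (fst b + 1)) \<le> t"
        using le[of "k + 1" "fst b"] le[of "fst b + 1" k] t b(2) by (cases "fst b < k") auto
      then show "ev x t = t" using supp[OF b(1)] b(3) unfolding fixes_outside_def by blast
    qed
    have ev1: "ev ?W1 = id"
    proof
      fix t
      show "ev ?W1 t = id t"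
      proof (cases "?a \<le> t \<and> t \<le> ?b")
        case True
        have "ev ?W1 ?a = ?a" "ev ?W1 ?b = ?b" using s1 by (auto simp: fixes_outside_def)
        then have "?a \<le> ev ?W1 t" "ev ?W1 t \<le> ?b"
          using True Homeo_le_iff[OF ev_Homeo, of ?W1 ?a t] Homeo_le_iff[OF ev_Homeo, of ?W1 t ?b] by auto
        then show ?thesis using s2[of "ev ?W1 t"] comp[of t] by simp
      next
        case False
        then show ?thesis using s1 by (auto simp: fixes_outside_def)
      qed
    qed
    then have ev2: "ev ?W2 = id" using comp by (simp add: fun_eq_iff)
    have "map f H1 = map (\<lambda>x. word_conj x (word_pow (bn_base m) k)) (map snd H1)"
      by (auto simp: H1_def f_def case_prod_unfold)
    then have c1: "weq bn_relators ?W1 (word_conj (concat (map snd H1)) (word_pow (bn_base m) k))"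
      using weq_concat_conj[of bn_relators "word_pow (bn_base m) k" "map snd H1"] by (simp only:)
    have "ev (word_conj (concat (map snd H1)) (word_pow (bn_base m) k)) = id"
      by (rule trans[OF weq_ev[OF c1, symmetric] ev1])
    then have "ev (concat (map snd H1)) = id" by (rule ev_conj_eq_id)
    moreover have "set (map snd H1) \<subseteq> letter_range (m + 1) n" using less.prems(1) by (auto simp: H1_def)
    ultimately have "weq bn_relators (concat (map snd H1)) []" by (intro IH)
    then have "weq bn_relators ?W1 []"
      by (rule equivclp_trans[OF c1 equivclp_trans[OF weq_conj weq_conj_Nil]])
    moreover have "weq bn_relators ?W2 []"
      unfolding f_def
    proof (rule less.hyps)
      have "length H2 \<le> length H'" unfolding H2_def Cons k_def by simp
      then show "length H2 < length H" unfolding Cons by simp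
      show "snd ` set H2 \<subseteq> letter_range (m + 1) n" using less.prems(1) by (auto simp: H2_def)
      show "ev (concat (map (\<lambda>(k, x). word_conj x (word_pow (bn_base m) k)) H2)) = id"
        using ev2 unfolding f_def .
    qed
    ultimately have "weq bn_relators (?W1 @ ?W2) ([] @ [])" by (rule weq_append)
    then have "weq bn_relators (?W1 @ ?W2) []" by simp
    from equivclp_trans[OF part this] show ?thesis unfolding f_def .
  qed
qed

text \<open>Induction on the number of levels: powers of the outermost letter
  \<open>bn_base m\<close> are collected in front. The remaining factors are supported between
  neighbouring chain points and fix all of them, so the exponent is visible in the displacement of
  \<open>chain 0\<close> and must vanish.\<close>

lemma letter_product_trivial:
  "set xs \<subseteq> letter_range m n \<Longrightarrow> ev (concat xs) = id \<Longrightarrow> weq bn_relators (concat xs) []"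
proof (induction n arbitrary: m xs)
  case 0
  then show ?case by (cases xs) (auto simp: letter_range_def)
next
  case (Suc n)
  let ?P = "word_pow (bn_base m)"
  have "{m..<m + int (Suc n)} = insert m {m + 1..<m + 1 + int n}" by auto
  then have "letter_range m (Suc n) = {bn_base m, word_inv (bn_base m)} \<union> letter_range (m + 1) n"
    by (simp add: letter_range_def letters_def)
  then have "set xs \<subseteq> {bn_base m, word_inv (bn_base m)} \<union> letter_range (m + 1) n" using Suc.prems(1) by simp
  from weq_collect[OF this, of bn_relators]
  obtain e H where H: "snd ` set H \<subseteq> letter_range (m + 1) n"
    and w: "weq bn_relators (concat xs) (?P e @ concat (map (\<lambda>(k, x). word_conj x (?P k)) H))" (is "weq _ _ (_ @ ?V)")
    by blast
  have id: "ev (?P e @ ?V) = id" by (rule trans[OF weq_ev[OF w, symmetric] Suc.prems(2)])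
  have V: "ev ?V (ypow m (chain e)) = ypow m (chain e)"
  proof (rule ev_concat_id_on)
    fix y assume "y \<in> set (map (\<lambda>(k, x). word_conj x (?P k)) H)"
    then obtain k x where kx: "(k, x) \<in> set H" "y = word_conj x (?P k)" by auto
    have "x \<in> letter_range (m + 1) n" using subsetD[OF H imageI[OF kx(1)]] by (simp only: snd_conv)
    then obtain i where "x \<in> letters i" "m < i" by (auto simp: letter_range_def)
    then have supp: "fixes_outside (ypow m (chain k)) (ypow m (chain (k + 1))) (ev y)"
      unfolding kx(2) by (intro conj_fixes_outside letter_fixes_outside)
    have "ypow m (chain e) \<le> ypow m (chain k) \<or> ypow m (chain (k + 1)) \<le> ypow m (chain e)"
      using chain_less_iff[of k e] chain_less_iff[of e "k + 1"] Homeo_le_iff[OF ypow_Homeo, of m] by auto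
    then show "ev y (ypow m (chain e)) = ypow m (chain e)"
      using supp unfolding fixes_outside_def by blast
  qed
  have "ev (?P e @ ?V) (ypow m (chain 0)) = ypow m (chain e)"
    using V by (simp add: ev_append ev_bn_base_pow_chain)
  then have "chain e = chain 0" unfolding id using Homeo_eq_iff[OF ypow_Homeo, of m] by simp
  then have e: "e = 0" using chain_less_iff[of e 0] chain_less_iff[of 0 e] by auto
  have "weq bn_relators ?V []"
    by (rule conj_product_trivial[OF Suc.IH H]) (use id in \<open>simp_all add: e\<close>)
  moreover have "weq bn_relators (concat xs) ?V" using w unfolding e by simp
  ultimately show ?case by (rule equivclp_trans[rotated])
qed

text \<open>With the shifts collected in front, the other factors are letters and preserve heights;
  the exponent of the shift is therefore the height shift of the identity, which is 0.\<close>

theorem ev_eq_id_imp_weq: assumes "ev w = id" shows "weq bn_relators w []"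
proof -
  let ?s = "[(Shift, True)]" and ?X = "{[(Base, True)], [(Base, False)]}"
  let ?P = "word_pow ?s"
  have "set (map (\<lambda>l. [l]) w) \<subseteq> {?s, word_inv ?s} \<union> ?X"
  proof -
    have "[(g, e)] \<in> {?s, word_inv ?s} \<union> ?X" for g e
      by (cases g; cases e) (simp_all add: word_inv_def)
    then show ?thesis by auto
  qed
  from weq_collect[OF this, of bn_relators]
  obtain e H where H: "snd ` set H \<subseteq> ?X"
    and w: "weq bn_relators w (?P e @ concat (map (\<lambda>(k, x). word_conj x (?P k)) H))" (is "weq _ _ (_ @ concat ?xs)")
    by (auto simp: concat_map_singleton)
  have letter: "word_conj x (?P k) \<in> letters k" if "x \<in> ?X" for x k
    using that by (auto simp: letters_def bn_base_def word_conj_def word_inv_append word_inv_Cons)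
  \<comment> \<open>Only levels from \<open>- M\<close> to \<open>M\<close> occur, which are
    \<open>2 * M + 1\<close> in number.\<close>
  define M where "M = Max (insert 0 ((\<lambda>a. nat \<bar>fst a\<bar>) ` set H))"
  have M: "nat \<bar>fst a\<bar> \<le> M" if "a \<in> set H" for a unfolding M_def using that by (intro Max_ge) auto
  have xs: "set ?xs \<subseteq> letter_range (- int M) (2 * M + 1)"
  proof
    fix y assume "y \<in> set ?xs"
    then obtain k x where kx: "(k, x) \<in> set H" "y = word_conj x (?P k)" by auto
    have "x \<in> ?X" using subsetD[OF H imageI[OF kx(1)]] by (simp only: snd_conv)
    then have "y \<in> letters k" unfolding kx(2) by (rule letter)
    moreover have "nat \<bar>k\<bar> \<le> M" using M[OF kx(1)] by simp
    then have "k \<in> {- int M..<- int M + int (2 * M + 1)}" by auto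
    ultimately show "y \<in> letter_range (- int M) (2 * M + 1)" unfolding letter_range_def by blast
  qed
  have shift0: "ev (concat ys) \<in> height_shift 0" if "\<And>y. y \<in> set ys \<Longrightarrow> ev y \<in> height_shift 0" for ys
    using that
  proof (induction ys)
    case Nil
    show ?case unfolding concat.simps ev.simps by (rule id_shift)
  next
    case (Cons y ys)
    then have "ev y \<in> height_shift 0" "ev (concat ys) \<in> height_shift 0" by simp_all
    from height_shift_comp[OF this] have "ev (concat ys) \<circ> ev y \<in> height_shift 0" by simp
    then show ?case by (simp only: concat.simps ev_append)
  qed
  have base_shift: "ev (bn_base k) \<in> height_shift 0" for k
    unfolding ev_bn_base
    using height_shift_comp[OF height_shift_inv[OF height_shift_int_pow[OF gy_shift, of k]]
        height_shift_comp[OF gx_shift height_shift_int_pow[OF gy_shift, of k]]]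
    by (simp add: comp_assoc)
  have "ev y \<in> height_shift 0" if y: "y \<in> set ?xs" for y
  proof -
    obtain k where "y \<in> letters k" using subsetD[OF xs y] unfolding letter_range_def by blast
    then show ?thesis
      using base_shift[of k] height_shift_inv[OF base_shift[of k]] by (auto simp: letters_def ev_word_inv)
  qed
  then have V: "ev (concat ?xs) \<in> height_shift 0" by (rule shift0)
  have "ev (?P e) \<in> height_shift e"
    using height_shift_int_pow[OF gy_shift, of e] by (simp add: ev_word_pow)
  then have "ev (?P e @ concat ?xs) \<in> height_shift e"
    using height_shift_comp[OF _ V, of "ev (?P e)" e] by (simp add: ev_append)
  moreover have id: "ev (?P e @ concat ?xs) = id" by (rule trans[OF weq_ev[OF w, symmetric] assms])
  ultimately have "id \<in> height_shift e" by (simp only:)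
  then have e: "e = 0" using height_shiftD(3)[of id e "1 / 2"] eighths_inner(3) by simp
  have "weq bn_relators (concat ?xs) []"
    by (rule letter_product_trivial[OF xs]) (use id in \<open>simp add: e\<close>)
  moreover have "weq bn_relators w (concat ?xs)" using w unfolding e by simp
  ultimately show ?thesis by (rule equivclp_trans[rotated])
qed

lemma ev_eq_iff: "ev u = ev w \<longleftrightarrow> weq bn_relators u w"
proof
  assume eq: "ev u = ev w"
  have "ev (u @ word_inv w) = id"
    by (simp add: ev_append ev_word_inv eq fun_eq_iff ev_Homeo)
  then have "weq bn_relators (u @ word_inv w) []" by (rule ev_eq_id_imp_weq)
  then have "weq bn_relators ((u @ word_inv w) @ w) ([] @ w)" by (rule weq_append_right)
  then have "weq bn_relators ((u @ word_inv w) @ w) w" by simp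
  moreover have "weq bn_relators u ((u @ word_inv w) @ w)"
    using weq_append_left[OF equivclp_sym[OF weq_inv_left[of bn_relators w]], of u] by simp
  ultimately show "weq bn_relators u w" by (rule equivclp_trans[rotated])
qed (rule weq_ev)

lemma range_ev: "range ev = B"
proof
  show "range ev \<subseteq> B" using ev_B by blast
  have "f \<in> range ev" if "f \<in> generate Homeo {gx, gy}" for f
    using that
  proof (induction rule: generate.induct)
    case one
    show ?case using rangeI[of ev "[]"] by (simp only: ev.simps Homeo_simps)
  next
    case (incl h)
    have "ev [(Base, True)] = gx" "ev [(Shift, True)] = gy" by simp_all
    then show ?case using incl rangeI[of ev "[(Base, True)]"] rangeI[of ev "[(Shift, True)]"] by auto
  next
    case (inv h)
    have "ev [(Base, False)] = hinv gx" "ev [(Shift, False)] = hinv gy" by simp_all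
    then show ?case using inv rangeI[of ev "[(Base, False)]"] rangeI[of ev "[(Shift, False)]"] by auto
  next
    case (eng h1 h2)
    then obtain u w where "h1 = ev u" "h2 = ev w" by blast
    then show ?case using rangeI[of ev "u @ w"] by (simp only: ev_append_Homeo)
  qed
  then show "B \<subseteq> range ev" unfolding B_eq by blast
qed

lemma word_eq_class_eq_iff: "word_eq Rel `` {u} = word_eq Rel `` {w} \<longleftrightarrow> weq Rel u w"
proof
  assume "word_eq Rel `` {u} = word_eq Rel `` {w}"
  moreover have "w \<in> word_eq Rel `` {w}" by (simp add: word_eq_def)
  ultimately have "w \<in> word_eq Rel `` {u}" by simp
  then show "weq Rel u w" by (simp add: word_eq_def)
next
  assume "weq Rel u w"
  then show "word_eq Rel `` {u} = word_eq Rel `` {w}"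
    by (auto simp: word_eq_def intro: equivclp_trans equivclp_sym)
qed

lemma presented_group_mult:
  "word_eq Rel `` {u} \<otimes>\<^bsub>presented_group Rel\<^esub> word_eq Rel `` {w} = word_eq Rel `` {u @ w}"
proof -
  have "word_eq Rel `` {u' @ w'} = word_eq Rel `` {u @ w}"
    if "u' \<in> word_eq Rel `` {u}" "w' \<in> word_eq Rel `` {w}" for u' w'
    unfolding word_eq_class_eq_iff using that
    by (intro weq_append) (auto simp: word_eq_def intro: equivclp_sym)
  moreover have "u \<in> word_eq Rel `` {u}" "w \<in> word_eq Rel `` {w}" by (simp_all add: word_eq_def)
  ultimately have "(\<Union>u'\<in>word_eq Rel `` {u}. \<Union>w'\<in>word_eq Rel `` {w}. word_eq Rel `` {u' @ w'}) = word_eq Rel `` {u @ w}"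
    by blast
  then show ?thesis by (simp add: presented_group_def)
qed

theorem Brin_Navas_iso: "Brin_Navas \<cong> Homeo\<lparr>carrier := B\<rparr>"
proof -
  let ?cl = "\<lambda>u. word_eq bn_relators `` {u}"
  \<comment> \<open>The choice of representative does not matter, since \<open>ev\<close> is
    constant on classes by \<open>ev_eq_iff\<close>; the converse direction of the same lemma gives
    injectivity.\<close>
  define \<Phi> where "\<Phi> C = ev (SOME w. w \<in> C)" for C :: "bn_gen word set"
  have \<Phi>: "\<Phi> (?cl u) = ev u" for u
  proof -
    have "u \<in> ?cl u" by (simp add: word_eq_def)
    then have "(SOME w. w \<in> ?cl u) \<in> ?cl u" by (rule someI)
    then show ?thesis unfolding \<Phi>_def ev_eq_iff by (auto simp: word_eq_def intro: equivclp_sym)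
  qed
  have carrier: "carrier Brin_Navas = range ?cl"
    by (auto simp: Brin_Navas_def presented_group_def quotient_def)
  have "\<Phi> \<in> iso Brin_Navas (Homeo\<lparr>carrier := B\<rparr>)"
  proof (rule isoI)
    show "\<Phi> \<in> hom Brin_Navas (Homeo\<lparr>carrier := B\<rparr>)"
    proof (rule homI)
      show "\<Phi> C \<in> carrier (Homeo\<lparr>carrier := B\<rparr>)" for C by (simp add: \<Phi>_def ev_B)
      fix C D assume "C \<in> carrier Brin_Navas" "D \<in> carrier Brin_Navas"
      then obtain u w where CD: "C = ?cl u" "D = ?cl w" unfolding carrier by blast
      have "C \<otimes>\<^bsub>Brin_Navas\<^esub> D = ?cl (u @ w)"
        unfolding CD Brin_Navas_def by (rule presented_group_mult)
      then show "\<Phi> (C \<otimes>\<^bsub>Brin_Navas\<^esub> D) = \<Phi> C \<otimes>\<^bsub>Homeo\<lparr>carrier := B\<rparr>\<^esub> \<Phi> D"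
        by (simp add: CD \<Phi> ev_append)
    qed
    show "bij_betw \<Phi> (carrier Brin_Navas) (carrier (Homeo\<lparr>carrier := B\<rparr>))"
      unfolding bij_betw_def
    proof
      show "inj_on \<Phi> (carrier Brin_Navas)"
      proof (rule inj_onI)
        fix C D assume "C \<in> carrier Brin_Navas" "D \<in> carrier Brin_Navas" and eq: "\<Phi> C = \<Phi> D"
        then obtain u w where CD: "C = ?cl u" "D = ?cl w" unfolding carrier by blast
        show "C = D" using eq unfolding CD \<Phi> ev_eq_iff word_eq_class_eq_iff .
      qed
      have "\<Phi> ` range ?cl = range ev" by (simp add: image_image \<Phi>)
      then show "\<Phi> ` carrier Brin_Navas = carrier (Homeo\<lparr>carrier := B\<rparr>)"
        unfolding carrier range_ev by simp
    qed
  qed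
  then show ?thesis by (auto simp: is_iso_def)
qed

theorem corollary5p39:
  shows "order_homeo psi_cantor \<and> psi \<in> carrier Homeo \<and>
    subgroup Thompson_F Homeo \<and> subgroup (conj_F psi) Homeo \<and>
    B = Thompson_F \<inter> conj_F psi \<and>
    Homeo\<lparr>carrier := conj_F psi\<rparr> \<cong> Homeo\<lparr>carrier := Thompson_F\<rparr> \<and>
    Brin_Navas \<cong> Homeo\<lparr>carrier := Thompson_F \<inter> conj_F psi\<rparr>"
  using order_homeo_psi_cantor psi_Homeo subgroup_Thompson_F subgroup_conj_F B_eq_Int conj_F_iso
    Brin_Navas_iso[unfolded B_eq_Int] by (intro conjI)

end
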